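(* Let $(X,d,\mu)$ be a complete Lipschitz differentiability space. Then $\dim_C(X)\le\dim_L(X)$.
   Context: A metric measure space is a complete metric space $(X,d)$ equipped with a finite Radon measure $\mu$. Lipschitz differentiability space: a metric measure space $(X,d,\mu)$ for which there are countably many Borel sets (charts) $U_i$ of positive measure covering $X$, positive integers $n_i$ (dimensions of the charts), and Lipschitz maps $\phi_i\colon X\to\mathbb{R}^{n_i}$ such that for every Lipschitz function $f\colon X\to\mathbb{R}$, every $i$ and $\mu$-almost every $x\in U_i$, there exists a unique $df(x)\in\mathbb{R}^{n_i}$ with $$\lim_{y\to x}\frac{|f(y)-f(x)-df(x)\cdot(\phi_i(y)-\phi_i(x))|}{d(x,y)}=0,$$ where $\cdot$ is the standard scalar product. The dimensions are chart-independent in the sense that two charts $(U,\phi)$, $(V,\psi)$ with $\mu(U\cap V)>0$ have the same dimension. The analytic dimension $\dim_C(X)$ is the supremum of the numbers $n_i$. Lipschitz dimension: for $r>0$, an $r$-path in a metric space $X$ is a finite sequence $(x_1,\dots,x_k)$ in $X$ with $d(x_i,x_{i+1})\le r$ for $1\le i\le k-1$. Two points are in the same $r$-component of $X$ if some $r$-path in $X$ contains both. The $r$-components of a subset are those of the subset as a metric space. A map $f\colon X\to Y$ is Lipschitz light if there is $C>0$ such that $f$ is $C$-Lipschitz and, for every $r>0$ and every $W\subset Y$ with $\mathrm{diam}(W)\le r$, the $r$-components of $f^{-1}(W)$ have diameter at most $Cr$. $\dim_L(X)$ is the minimal integer $n\ge0$ such that there is a Lipschitz light map $X\to\mathbb{R}^n$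 (with $\mathbb{R}^0$ a one-point space), or $\infty$ if there is none. *)

theory Defs
  imports "HOL-Analysis.Analysis" "HOL-Library.Extended_Nat"
begin

section \<open>Euclidean spaces of variable dimension\<close>

text \<open>
  The dimension varies inside the notions below, so it cannot be a type. The carrier is that of
  \<^const>\<open>Euclidean_space\<close>: sequences that vanish from index \<open>n\<close> on. The space of dimension \<open>0\<close>
  has exactly one point.
\<close>

definition Rn :: "nat \<Rightarrow> (nat \<Rightarrow> real) metric" where
  "Rn n = metric (topspace (Euclidean_space n), \<lambda>x y. L2_set (\<lambda>i. x i - y i) {..<n})"

lemma Metric_space_Rn:
  "Metric_space (topspace (Euclidean_space n)) (\<lambda>x y. L2_set (\<lambda>i. x i - y i) {..<n})"
proof
  fix x y z :: "nat \<Rightarrow> real"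
  show "0 \<le> L2_set (\<lambda>i. x i - y i) {..<n}" by simp
  show "L2_set (\<lambda>i. x i - y i) {..<n} = L2_set (\<lambda>i. y i - x i) {..<n}"
    by (simp add: L2_set_def power2_commute)
  have "L2_set (\<lambda>i. x i - z i) {..<n} = L2_set (\<lambda>i. (x i - y i) + (y i - z i)) {..<n}"
    by simp
  also have "\<dots> \<le> L2_set (\<lambda>i. x i - y i) {..<n} + L2_set (\<lambda>i. y i - z i) {..<n}"
    by (rule L2_set_triangle_ineq)
  finally show "L2_set (\<lambda>i. x i - z i) {..<n}
      \<le> L2_set (\<lambda>i. x i - y i) {..<n} + L2_set (\<lambda>i. y i - z i) {..<n}" .
  assume "x \<in> topspace (Euclidean_space n)" "y \<in> topspace (Euclidean_space n)"
  then have "\<forall>i\<ge>n. x i = 0" "\<forall>i\<ge>n. y i = 0"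
    by (simp_all add: topspace_Euclidean_space)
  then show "L2_set (\<lambda>i. x i - y i) {..<n} = 0 \<longleftrightarrow> x = y"
    by (auto simp: L2_set_eq_0_iff fun_eq_iff) (metis lessThan_iff not_less)
qed

lemma mspace_Rn: "mspace (Rn n) = {x. \<forall>i\<ge>n. x i = 0}"
  by (simp add: Rn_def Metric_space_Rn Metric_space.mspace_metric topspace_Euclidean_space
      flip: topspace_Euclidean_space)

lemma mdist_Rn: "mdist (Rn n) x y = L2_set (\<lambda>i. x i - y i) {..<n}"
  by (simp add: Rn_def Metric_space_Rn Metric_space.mdist_metric)

definition inner_Rn :: "nat \<Rightarrow> (nat \<Rightarrow> real) \<Rightarrow> (nat \<Rightarrow> real) \<Rightarrow> real" where
  "inner_Rn n v w = (\<Sum>j<n. v j * w j)"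


section \<open>Metric measure spaces and Lipschitz differentiability spaces\<close>

text \<open>
  Completeness comes from the type class. For a finite Borel measure on a metric space, being a
  Radon measure means inner regularity with respect to compact sets.
\<close>

definition metric_measure_space :: "'a::complete_space measure \<Rightarrow> bool" where
  "metric_measure_space M \<longleftrightarrow>
     sets M = sets borel \<and> finite_measure M \<and>
     (\<forall>A\<in>sets borel. emeasure M A = (SUP K\<in>{K. K \<subseteq> A \<and> compact K}. emeasure M K))"

definition differential_at ::
  "nat \<Rightarrow> ('a::metric_space \<Rightarrow> nat \<Rightarrow> real) \<Rightarrow> ('a \<Rightarrow> real) \<Rightarrow> 'a \<Rightarrow> (nat \<Rightarrow> real) \<Rightarrow> bool" where
  "differential_at n \<phi> f x v \<longleftrightarrow>
     ((\<lambda>y. \<bar>f y - f x - inner_Rn n v (\<lambda>j. \<phi> y j - \<phi> x j)\<bar> / dist x y) \<longlongrightarrow> 0) (at x)"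

definition chart ::
  "'a::metric_space measure \<Rightarrow> nat \<Rightarrow> 'a set \<Rightarrow> ('a \<Rightarrow> nat \<Rightarrow> real) \<Rightarrow> bool" where
  "chart M n U \<phi> \<longleftrightarrow>
     U \<in> sets borel \<and> emeasure M U > 0 \<and> n > 0 \<and>
     Lipschitz_continuous_map euclidean_metric (Rn n) \<phi> \<and>
     (\<forall>f :: 'a \<Rightarrow> real. Lipschitz_continuous_map euclidean_metric euclidean_metric f \<longrightarrow>
        (AE x in M. x \<in> U \<longrightarrow> (\<exists>!v. v \<in> mspace (Rn n) \<and> differential_at n \<phi> f x v)))"

definition atlas ::
  "'a::metric_space measure \<Rightarrow> nat set \<Rightarrow> (nat \<Rightarrow> nat) \<Rightarrow> (nat \<Rightarrow> 'a set) \<Rightarrow>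
     (nat \<Rightarrow> 'a \<Rightarrow> nat \<Rightarrow> real) \<Rightarrow> bool" where
  "atlas M I n U \<phi> \<longleftrightarrow> (\<forall>i\<in>I. chart M (n i) (U i) (\<phi> i)) \<and> (\<Union>i\<in>I. U i) = UNIV"

definition lipschitz_differentiability_space :: "'a::complete_space measure \<Rightarrow> bool" where
  "lipschitz_differentiability_space M \<longleftrightarrow>
     metric_measure_space M \<and> (\<exists>I n U \<phi>. atlas M I n U \<phi>)"

text \<open>
  To obtain a function of the space alone, the supremum runs over all charts; by lemma
  \<open>analytic_dim_eq\<close> below it equals the supremum of the dimensions in any single atlas.
\<close>

definition analytic_dim :: "'a::metric_space measure \<Rightarrow> enat" where
  "analytic_dim M = Sup {enat n |n. \<exists>U \<phi>. chart M n U \<phi>}"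


subsection \<open>Independence of the atlas\<close>

lemma homogeneous_system_nontrivial:
  fixes b :: "nat \<Rightarrow> nat \<Rightarrow> real"
  assumes "m < n"
  shows "\<exists>v. (\<exists>i<n. v i \<noteq> 0) \<and> (\<forall>i\<ge>n. v i = 0) \<and> (\<forall>j<m. (\<Sum>i<n. v i * b i j) = 0)"
  using assms
proof (induction m arbitrary: n b)
  case 0
  then show ?case
    by (intro exI[of _ "\<lambda>i. if i = 0 then 1 else 0"]) auto
next
  case (Suc m)
  then obtain n' where n: "n = Suc n'" "m < n'"
    by (cases n) auto
  show ?case
  proof (cases "\<forall>i<n. b i m = 0")
    case True
    from Suc.IH[of n b] Suc.prems obtain v where
      "\<exists>i<n. v i \<noteq> 0" "\<forall>i\<ge>n. v i = 0" "\<forall>j<m. (\<Sum>i<n. v i * b i j) = 0"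
      by auto
    with True show ?thesis
      by (intro exI[of _ v]) (auto simp: less_Suc_eq)
  next
    case False
    then obtain p where p: "p < n" "b p m \<noteq> 0" by auto
    define s where "s i = (if i < p then i else Suc i)" for i
    define c where "c i j = b (s i) j - b (s i) m / b p m * b p j" for i j
    from Suc.IH[of n' c] n obtain w where
      w: "\<exists>i<n'. w i \<noteq> 0" "\<forall>j<m. (\<Sum>i<n'. w i * c i j) = 0"
      by auto
    define v where "v i = (if i < p then w i else if i = p then - (\<Sum>i<n'. w i * b (s i) m) / b p m
        else if i < n then w (i - 1) else 0)" for i
    have vs: "v (s i) = w i" if "i < n'" for i
      using that n p by (auto simp: v_def s_def)
    have bij: "bij_betw s {..<n'} ({..<n} - {p})"
    proof (rule bij_betw_byWitness[where f' = "\<lambda>i. if i < p then i else i - 1"])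
    qed (use p n in \<open>auto simp: s_def\<close>)
    have sum: "(\<Sum>i<n. v i * b i j) = v p * b p j + (\<Sum>i<n'. w i * b (s i) j)" for j
    proof -
      have "(\<Sum>i<n. v i * b i j) = v p * b p j + (\<Sum>i\<in>{..<n} - {p}. v i * b i j)"
        using p by (simp add: sum.remove)
      also have "(\<Sum>i\<in>{..<n} - {p}. v i * b i j) = (\<Sum>i<n'. v (s i) * b (s i) j)"
        by (rule sum.reindex_bij_betw[OF bij, symmetric])
      finally show ?thesis by (simp add: vs)
    qed
    have "(\<Sum>i<n. v i * b i j) = (\<Sum>i<n'. w i * c i j)" for j
    proof -
      have "v p = - (\<Sum>i<n'. w i * b (s i) m) / b p m"
        by (simp add: v_def)
      then show ?thesis
        by (simp add: sum c_def algebra_simps sum_subtractf sum_distrib_left sum_distrib_right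
            sum_divide_distrib)
    qed
    moreover have "c i m = 0" for i
      using p by (simp add: c_def)
    ultimately have "\<forall>j<Suc m. (\<Sum>i<n. v i * b i j) = 0"
      using w(2) by (auto simp: less_Suc_eq)
    moreover have "\<exists>i<n. v i \<noteq> 0"
    proof -
      from w(1) obtain i where "i < n'" "w i \<noteq> 0" by auto
      moreover have "s i < n" using \<open>i < n'\<close> n by (auto simp: s_def)
      ultimately show ?thesis using vs by metis
    qed
    moreover have "\<forall>i\<ge>n. v i = 0"
      using p by (auto simp: v_def)
    ultimately show ?thesis by blast
  qed
qed

lemma Lipschitz_continuous_map_component:
  assumes "Lipschitz_continuous_map euclidean_metric (Rn n) \<phi>" "i < n"
  shows "Lipschitz_continuous_map euclidean_metric euclidean_metric (\<lambda>x::'a::metric_space. \<phi> x i)"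
proof -
  from assms(1) obtain B where
    B: "\<And>x y. L2_set (\<lambda>i. \<phi> x i - \<phi> y i) {..<n} \<le> B * dist x y"
    by (auto simp: Lipschitz_continuous_map_def mdist_Rn)
  have "\<bar>\<phi> x i - \<phi> y i\<bar> \<le> B * dist x y" for x y
  proof -
    have "\<bar>\<phi> x i - \<phi> y i\<bar> = L2_set (\<lambda>i. \<phi> x i - \<phi> y i) {i}"
      by (simp add: L2_set_def)
    also have "\<dots> \<le> L2_set (\<lambda>i. \<phi> x i - \<phi> y i) {..<n}"
      using assms(2) unfolding L2_set_def by (intro real_sqrt_le_mono sum_mono2) auto
    finally show ?thesis using B[of x y] by simp
  qed
  then show ?thesis
    by (auto simp: Lipschitz_continuous_map_def dist_real_def)
qed

lemma chart_dim_le: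
  assumes "chart M n U \<phi>" "chart M m V \<psi>"
    and sets: "sets M = sets borel" and pos: "emeasure M (U \<inter> V) > 0"
  shows "n \<le> m"
proof (rule ccontr)
  assume "\<not> n \<le> m"
  then have "m < n" by simp
  have "Lipschitz_continuous_map euclidean_metric euclidean_metric (\<lambda>_::'a. 0::real)"
    by (simp add: Lipschitz_continuous_map_const)
  then have AE_U: "AE x in M. x \<in> U \<longrightarrow>
      (\<exists>!v. v \<in> mspace (Rn n) \<and> differential_at n \<phi> (\<lambda>_. 0) x v)"
    using assms(1) unfolding chart_def by blast
  have AE_V: "AE x in M. \<forall>i\<in>{..<n}. x \<in> V \<longrightarrow>
      (\<exists>!v. v \<in> mspace (Rn m) \<and> differential_at m \<psi> (\<lambda>x. \<phi> x i) x v)"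
  proof (rule AE_finite_allI)
    fix i assume "i \<in> {..<n}"
    then have "Lipschitz_continuous_map euclidean_metric euclidean_metric (\<lambda>x. \<phi> x i)"
      using assms(1) Lipschitz_continuous_map_component[of n \<phi> i] by (simp add: chart_def)
    then show "AE x in M. x \<in> V \<longrightarrow>
        (\<exists>!v. v \<in> mspace (Rn m) \<and> differential_at m \<psi> (\<lambda>x. \<phi> x i) x v)"
      using assms(2) unfolding chart_def by blast
  qed simp
  have "\<exists>x. x \<in> U \<and> x \<in> V \<and> (\<exists>!v. v \<in> mspace (Rn n) \<and> differential_at n \<phi> (\<lambda>_. 0) x v) \<and>
     (\<forall>i<n. \<exists>v. differential_at m \<psi> (\<lambda>x. \<phi> x i) x v)"
  proof (rule ccontr)
    assume *: "\<not> ?thesis"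
    have "AE x in M. x \<notin> U \<inter> V"
      using AE_U AE_V by eventually_elim (use * in blast)
    moreover have "U \<inter> V \<in> sets M"
      using assms by (auto simp: chart_def)
    ultimately have "U \<inter> V \<in> null_sets M"
      by (simp add: AE_iff_null_sets)
    with pos show False by (simp add: null_sets_def)
  qed
  then obtain x where
    ex1: "\<exists>!v. v \<in> mspace (Rn n) \<and> differential_at n \<phi> (\<lambda>_. 0) x v" and
    "\<forall>i<n. \<exists>v. differential_at m \<psi> (\<lambda>x. \<phi> x i) x v"
    by blast
  then obtain b where b: "\<And>i. i < n \<Longrightarrow> differential_at m \<psi> (\<lambda>x. \<phi> x i) x (b i)"
    by metis
  from homogeneous_system_nontrivial[OF \<open>m < n\<close>, of b] obtain v where
    v: "\<exists>i<n. v i \<noteq> 0" "\<forall>i\<ge>n. v i = 0" "\<forall>j<m. (\<Sum>i<n. v i * b i j) = 0"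
    by blast
  let ?q = "\<lambda>i y. \<bar>\<phi> y i - \<phi> x i - inner_Rn m (b i) (\<lambda>j. \<psi> y j - \<psi> x j)\<bar> / dist x y"
  have lim: "((\<lambda>y. \<Sum>i<n. \<bar>v i\<bar> * ?q i y) \<longlongrightarrow> 0) (at x)"
  proof (rule tendsto_null_sum)
    fix i assume "i \<in> {..<n}"
    then have "(?q i \<longlongrightarrow> 0) (at x)"
      using b by (simp add: differential_at_def)
    then show "((\<lambda>y. \<bar>v i\<bar> * ?q i y) \<longlongrightarrow> 0) (at x)"
      by (rule tendsto_mult_right_zero)
  qed
  have bound: "\<bar>inner_Rn n v (\<lambda>j. \<phi> y j - \<phi> x j)\<bar> / dist x y \<le> (\<Sum>i<n. \<bar>v i\<bar> * ?q i y)" for y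
  proof -
    have "(\<Sum>i<n. v i * inner_Rn m (b i) (\<lambda>j. \<psi> y j - \<psi> x j))
        = (\<Sum>j<m. (\<Sum>i<n. v i * b i j) * (\<psi> y j - \<psi> x j))"
      unfolding inner_Rn_def sum_distrib_left sum_distrib_right
      by (subst sum.swap) (simp add: mult.assoc)
    also have "\<dots> = 0" using v(3) by simp
    finally have "inner_Rn n v (\<lambda>j. \<phi> y j - \<phi> x j)
        = (\<Sum>i<n. v i * (\<phi> y i - \<phi> x i - inner_Rn m (b i) (\<lambda>j. \<psi> y j - \<psi> x j)))"
      by (simp add: inner_Rn_def[of n] right_diff_distrib sum_subtractf)
    also have "\<bar>\<dots>\<bar> \<le> (\<Sum>i<n. \<bar>v i\<bar> * \<bar>\<phi> y i - \<phi> x i - inner_Rn m (b i) (\<lambda>j. \<psi> y j - \<psi> x j)\<bar>)"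
      by (rule order_trans[OF sum_abs]) (simp add: abs_mult)
    finally have "\<bar>inner_Rn n v (\<lambda>j. \<phi> y j - \<phi> x j)\<bar> / dist x y \<le>
       (\<Sum>i<n. \<bar>v i\<bar> * \<bar>\<phi> y i - \<phi> x i - inner_Rn m (b i) (\<lambda>j. \<psi> y j - \<psi> x j)\<bar>) / dist x y"
      by (rule divide_right_mono) simp
    then show ?thesis by (simp add: sum_divide_distrib)
  qed
  have "((\<lambda>y. \<bar>inner_Rn n v (\<lambda>j. \<phi> y j - \<phi> x j)\<bar> / dist x y) \<longlongrightarrow> 0) (at x)"
    by (rule tendsto_sandwich[OF _ _ tendsto_const lim]) (use bound in auto)
  then have "differential_at n \<phi> (\<lambda>_. 0) x v"
    by (simp add: differential_at_def)
  moreover have "differential_at n \<phi> (\<lambda>_. 0) x (\<lambda>_. 0)"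
    by (simp add: differential_at_def inner_Rn_def)
  ultimately have "v = (\<lambda>_. 0)"
    using ex1 v(2) by (auto simp: mspace_Rn)
  with v(1) show False by auto
qed

lemma chart_dim_unique:
  assumes "chart M n U \<phi>" "chart M m V \<psi>" "sets M = sets borel" "emeasure M (U \<inter> V) > 0"
  shows "n = m"
  using chart_dim_le[OF assms(1,2)] chart_dim_le[OF assms(2,1)] assms(3,4)
  by (simp add: Int_commute)

lemma analytic_dim_eq:
  assumes A: "atlas M I n U \<phi>" and sets: "sets M = sets borel"
  shows "analytic_dim M = (SUP i\<in>I. enat (n i))"
proof (rule antisym)
  show "(SUP i\<in>I. enat (n i)) \<le> analytic_dim M"
    using A unfolding analytic_dim_def atlas_def by (intro SUP_least Sup_upper) auto
  show "analytic_dim M \<le> (SUP i\<in>I. enat (n i))"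
    unfolding analytic_dim_def
  proof (rule Sup_least, clarify)
    fix m V \<psi> assume c: "chart M m V \<psi>"
    have "\<exists>i\<in>I. emeasure M (U i \<inter> V) > 0"
    proof (rule ccontr)
      assume "\<not> ?thesis"
      then have "(\<Union>i\<in>I. U i \<inter> V) \<in> null_sets M"
        using A c sets by (intro null_sets_UN') (auto simp: null_sets_def atlas_def chart_def)
      moreover have "(\<Union>i\<in>I. U i \<inter> V) = V"
        using A by (auto simp: atlas_def)
      ultimately show False
        using c by (auto simp: chart_def null_sets_def)
    qed
    then obtain i where i: "i \<in> I" "emeasure M (U i \<inter> V) > 0" by blast
    then have "n i = m"
      using A c sets by (intro chart_dim_unique) (auto simp: atlas_def)
    with i show "enat m \<le> (SUP i\<in>I. enat (n i))"
      by (auto intro: SUP_upper)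
  qed
qed


section \<open>Lipschitz dimension\<close>

definition r_path :: "'a metric \<Rightarrow> real \<Rightarrow> 'a list \<Rightarrow> bool" where
  "r_path m r xs \<longleftrightarrow> xs \<noteq> [] \<and> set xs \<subseteq> mspace m \<and> successively (\<lambda>x y. mdist m x y \<le> r) xs"

definition r_component :: "'a metric \<Rightarrow> real \<Rightarrow> 'a \<Rightarrow> 'a set" where
  "r_component m r x = {y. \<exists>xs. r_path m r xs \<and> x \<in> set xs \<and> y \<in> set xs}"

text \<open>Stated pointwise, because a real-valued supremum of distances is wrong for unbounded sets.\<close>

definition diam_le :: "'a metric \<Rightarrow> 'a set \<Rightarrow> real \<Rightarrow> bool" where
  "diam_le m A c \<longleftrightarrow> (\<forall>x\<in>A. \<forall>y\<in>A. mdist m x y \<le> c)"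

definition lipschitz_light :: "'a metric \<Rightarrow> 'b metric \<Rightarrow> ('a \<Rightarrow> 'b) \<Rightarrow> bool" where
  "lipschitz_light m1 m2 f \<longleftrightarrow>
     f \<in> mspace m1 \<rightarrow> mspace m2 \<and>
     (\<exists>C>0.
        (\<forall>x\<in>mspace m1. \<forall>y\<in>mspace m1. mdist m2 (f x) (f y) \<le> C * mdist m1 x y) \<and>
        (\<forall>r>0. \<forall>W\<subseteq>mspace m2. diam_le m2 W r \<longrightarrow>
           (\<forall>x\<in>mspace m1 \<inter> f -` W.
              diam_le m1 (r_component (submetric m1 (f -` W)) r x) (C * r))))"

text \<open>The infimum of the empty set is \<open>\<infinity>\<close> in \<^typ>\<open>enat\<close>.\<close>

definition lipschitz_dim :: "'a metric \<Rightarrow> enat" where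
  "lipschitz_dim m = Inf {enat n |n. \<exists>f. lipschitz_light m (Rn n) f}"

end

theory Submission
  imports Defs
begin

text \<open>
  Let \<open>f\<close> be a Lipschitz light map into \<open>\<real>\<^sup>m\<close> and \<open>(U, \<phi>)\<close> a chart of dimension \<open>n\<close>. The heart
  of the proof is that at almost every point of \<open>U\<close> every Lipschitz function \<open>h\<close> has a
  differential with respect to \<open>f\<close> (lemma \<open>light_map_spans_differentials\<close>). For \<open>h\<close> ranging over
  the \<open>n\<close> components of \<open>\<phi>\<close> this expresses \<open>n\<close> functions to first order through \<open>m\<close> functions.
  If \<open>m < n\<close>, then some nontrivial combination \<open>v \<bullet> \<phi>\<close> vanishes to first order, and the zero
  function has the two differentials \<open>0\<close> and \<open>v\<close> (lemma \<open>chart_dim_le_light_dim\<close>).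

  Lightness enters through approximation. The preimage of a cube of side \<open>\<delta>\<close> falls into pieces
  of diameter \<open>O(\<delta>)\<close> that are \<open>\<delta>\<close>-separated. Freezing \<open>h\<close> on these pieces and gluing with a
  partition of unity pulled back from \<open>\<real>\<^sup>m\<close> yields functions \<open>F\<close> with \<open>\<bar>F - h\<bar> = O(\<delta>)\<close>, with
  Lipschitz constants independent of \<open>\<delta>\<close>, and with \<open>F y - F x = a x \<bullet> (f y - f x) + O(dist x y ^
  2)\<close> at all points (lemma \<open>jet_approximations_nonempty\<close>). It remains to pass to the limit \<open>\<delta> \<rightarrow>
  0\<close>, that is, to show that differentiation is closed under uniform convergence. The
  approximations of a given accuracy form a convex set, so choosing nearly minimal \<open>L\<^sup>2\<close> norms
  of \<open>a\<close> makes the coefficients converge in \<open>L\<^sup>2\<close> (lemma \<open>strongly_convergent_jets\<close>).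

  Closedness is then a gliding hump argument. Along a fast subsequence \<open>G j\<close> of the
  approximations consider \<open>T = (\<Sum>j. (-1)^j * (G j - h))\<close>. At distances \<open>d\<close> in a range \<open>\<sigma> j < d <
  r j\<close> the terms up to \<open>j\<close> follow their first-order expansions and the later ones are
  negligible. The increments of \<open>T\<close> are therefore close to \<open>b \<bullet> (f y - f x) - (h y - h x)\<close> for
  even \<open>j\<close> and to \<open>b' \<bullet> (f y - f x)\<close> for odd \<open>j\<close>, where \<open>b\<close> and \<open>b'\<close> are the limits of the
  partial alternating sums of the coefficients. A Lipschitz function has one differential at
  almost every point of \<open>U\<close>, which has to serve both parities; subtracting leaves \<open>h - (b - b')
  \<bullet> f\<close> with vanishing differential.

  Two facts make this rigorous. First, the ranges can be chosen so long that a differentiable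
  function whose increments are \<open>o(d)\<close> along infinitely many ranges has increments \<open>o(d)\<close>
  outright (lemma \<open>testing_scales\<close>). Second, \<open>T\<close> is Lipschitz only at the points of a large set
  \<open>A\<close>; it is replaced by a Lipschitz extension from \<open>A\<close>, at a cost proportional to the distance
  to \<open>A\<close>, and this distance is \<open>o(d)\<close> at almost every point of \<open>A \<inter> U\<close> (lemma \<open>set_not_porous\<close>,
  another use of alternating ranges).
\<close>

section \<open>First-order vanishing and differentiability at a point\<close>

text \<open>
  The increments of \<open>D\<close> at \<open>x\<close> are \<open>o(dist x y)\<close>. Unlike the quotient in \<^const>\<open>differential_at\<close>,
  this is visibly linear in \<open>D\<close>.
\<close>

definition flat_at :: "'a::metric_space \<Rightarrow> ('a \<Rightarrow> real) \<Rightarrow> bool" where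
  "flat_at x D \<longleftrightarrow> (\<forall>e>0. \<forall>\<^sub>F y in at x. \<bar>D y - D x\<bar> \<le> e * dist x y)"

lemma flat_at_add:
  assumes "flat_at x D" "flat_at x E"
  shows "flat_at x (\<lambda>y. D y + E y)"
  unfolding flat_at_def
proof (intro allI impI)
  fix e :: real assume "e > 0"
  then have "\<forall>\<^sub>F y in at x. \<bar>D y - D x\<bar> \<le> e / 2 * dist x y"
      "\<forall>\<^sub>F y in at x. \<bar>E y - E x\<bar> \<le> e / 2 * dist x y"
    using assms unfolding flat_at_def by (meson half_gt_zero)+
  then show "\<forall>\<^sub>F y in at x. \<bar>D y + E y - (D x + E x)\<bar> \<le> e * dist x y"
    by eventually_elim (auto simp: abs_if split: if_splits)
qed

lemma flat_at_cmult:
  assumes "flat_at x D"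
  shows "flat_at x (\<lambda>y. c * D y)"
  unfolding flat_at_def
proof (intro allI impI)
  fix e :: real assume "e > 0"
  then have "e / (\<bar>c\<bar> + 1) > 0" by simp
  then have "\<forall>\<^sub>F y in at x. \<bar>D y - D x\<bar> \<le> e / (\<bar>c\<bar> + 1) * dist x y"
    using assms unfolding flat_at_def by blast
  then show "\<forall>\<^sub>F y in at x. \<bar>c * D y - c * D x\<bar> \<le> e * dist x y"
  proof eventually_elim
    case (elim y)
    have "\<bar>c * D y - c * D x\<bar> = \<bar>c\<bar> * \<bar>D y - D x\<bar>"
      by (simp add: abs_mult flip: right_diff_distrib)
    also have "\<dots> \<le> (\<bar>c\<bar> + 1) * (e / (\<bar>c\<bar> + 1) * dist x y)"
      using elim by (intro mult_mono) auto
    also have "\<dots> = e * dist x y" by (simp add: field_simps)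
    finally show ?case .
  qed
qed

lemma flat_at_diff:
  assumes "flat_at x D" "flat_at x E"
  shows "flat_at x (\<lambda>y. D y - E y)"
  using flat_at_add[OF assms(1) flat_at_cmult[OF assms(2), of "-1"]] by simp

lemma flat_at_const: "flat_at x (\<lambda>_. c)"
  by (simp add: flat_at_def)

lemma flat_at_sum:
  assumes "\<And>i. i \<in> I \<Longrightarrow> flat_at x (D i)"
  shows "flat_at x (\<lambda>y. \<Sum>i\<in>I. D i y)"
  using assms
  by (induction I rule: infinite_finite_induct) (auto intro: flat_at_add flat_at_const)

lemma inner_Rn_diff_right: "inner_Rn n v (\<lambda>j. a j - b j) = inner_Rn n v a - inner_Rn n v b"
  by (simp add: inner_Rn_def right_diff_distrib sum_subtractf)

lemma differential_at_iff_flat: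
  "differential_at n \<phi> f x v \<longleftrightarrow> flat_at x (\<lambda>y. f y - inner_Rn n v (\<phi> y))"
proof -
  define G where "G y = f y - f x - inner_Rn n v (\<lambda>j. \<phi> y j - \<phi> x j)" for y
  have G: "f y - inner_Rn n v (\<phi> y) - (f x - inner_Rn n v (\<phi> x)) = G y" for y
    by (simp add: G_def inner_Rn_diff_right)
  have "differential_at n \<phi> f x v \<longleftrightarrow> (\<forall>e>0. \<forall>\<^sub>F y in at x. \<bar>G y\<bar> / dist x y < e)"
    by (simp add: differential_at_def tendsto_iff dist_real_def G_def)
  also have "\<dots> \<longleftrightarrow> (\<forall>e>0. \<forall>\<^sub>F y in at x. \<bar>G y\<bar> < e * dist x y)"
    by (simp add: eventually_at_filter pos_divide_less_eq cong: imp_cong)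
  also have "\<dots> \<longleftrightarrow> (\<forall>e>0. \<forall>\<^sub>F y in at x. \<bar>G y\<bar> \<le> e * dist x y)"
  proof (intro iffI allI impI)
    fix e :: real assume *: "\<forall>e>0. \<forall>\<^sub>F y in at x. \<bar>G y\<bar> \<le> e * dist x y" and "e > 0"
    then have "\<forall>\<^sub>F y in at x. \<bar>G y\<bar> \<le> e / 2 * dist x y" using half_gt_zero by blast
    moreover have "\<forall>\<^sub>F y in at x. y \<noteq> x" by (simp add: eventually_at_filter)
    ultimately show "\<forall>\<^sub>F y in at x. \<bar>G y\<bar> < e * dist x y"
    proof eventually_elim
      case (elim y)
      then have "0 < e * dist x y" using \<open>e > 0\<close> by simp
      then show ?case using elim by (simp add: field_simps)
    qed
  next
    fix e :: real assume *: "\<forall>e>0. \<forall>\<^sub>F y in at x. \<bar>G y\<bar> < e * dist x y" and "e > 0"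
    then have "\<forall>\<^sub>F y in at x. \<bar>G y\<bar> < e * dist x y" by simp
    then show "\<forall>\<^sub>F y in at x. \<bar>G y\<bar> \<le> e * dist x y"
      by eventually_elim simp
  qed
  finally show ?thesis
    by (simp add: flat_at_def G)
qed

definition differentiable_wrt :: "nat \<Rightarrow> ('a::metric_space \<Rightarrow> nat \<Rightarrow> real) \<Rightarrow> 'a \<Rightarrow> ('a \<Rightarrow> real) \<Rightarrow> bool" where
  "differentiable_wrt n \<phi> x f \<longleftrightarrow> (\<exists>v. differential_at n \<phi> f x v)"

lemma differentiable_wrt_add:
  assumes "differentiable_wrt n \<phi> x f" "differentiable_wrt n \<phi> x g"
  shows "differentiable_wrt n \<phi> x (\<lambda>y. f y + g y)"
proof -
  obtain v w where "flat_at x (\<lambda>y. f y - inner_Rn n v (\<phi> y))" "flat_at x (\<lambda>y. g y - inner_Rn n w (\<phi> y))"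
    using assms by (auto simp: differentiable_wrt_def differential_at_iff_flat)
  from flat_at_add[OF this] have "flat_at x (\<lambda>y. f y + g y - inner_Rn n (\<lambda>j. v j + w j) (\<phi> y))"
    by (simp add: inner_Rn_def algebra_simps sum.distrib)
  then show ?thesis by (auto simp: differentiable_wrt_def differential_at_iff_flat)
qed

lemma differentiable_wrt_cmult:
  assumes "differentiable_wrt n \<phi> x f"
  shows "differentiable_wrt n \<phi> x (\<lambda>y. c * f y)"
proof -
  obtain v where "flat_at x (\<lambda>y. f y - inner_Rn n v (\<phi> y))"
    using assms by (auto simp: differentiable_wrt_def differential_at_iff_flat)
  from flat_at_cmult[OF this, of c] have "flat_at x (\<lambda>y. c * f y - inner_Rn n (\<lambda>j. c * v j) (\<phi> y))"
    by (simp add: inner_Rn_def algebra_simps sum_distrib_left)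
  then show ?thesis by (auto simp: differentiable_wrt_def differential_at_iff_flat)
qed

lemma differentiable_wrt_diff:
  assumes "differentiable_wrt n \<phi> x f" "differentiable_wrt n \<phi> x g"
  shows "differentiable_wrt n \<phi> x (\<lambda>y. f y - g y)"
  using differentiable_wrt_add[OF assms(1) differentiable_wrt_cmult[OF assms(2), of "-1"]] by simp

lemma differentiable_wrt_const: "differentiable_wrt n \<phi> x (\<lambda>_. c)"
  unfolding differentiable_wrt_def differential_at_iff_flat
  by (rule exI[of _ "\<lambda>_. 0"]) (simp add: inner_Rn_def flat_at_const)

lemma differentiable_wrt_sum:
  assumes "\<And>i. i \<in> I \<Longrightarrow> differentiable_wrt n \<phi> x (f i)"
  shows "differentiable_wrt n \<phi> x (\<lambda>y. \<Sum>i\<in>I. f i y)"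
  using assms
  by (induction I rule: infinite_finite_induct)
    (auto intro: differentiable_wrt_add differentiable_wrt_const)

section \<open>Scales at which differentials are detected\<close>

definition annulus :: "'a::metric_space \<Rightarrow> real \<Rightarrow> real \<Rightarrow> 'a set" where
  "annulus x s r = {y. s < dist x y \<and> dist x y < r}"

lemma rational_approx:
  fixes w :: "nat \<Rightarrow> real"
  assumes "e > 0"
  obtains us :: "rat list" where "\<And>j. j < n \<Longrightarrow> \<bar>w j - of_rat (us ! j)\<bar> \<le> e"
proof -
  have "\<exists>q::rat. \<bar>w j - of_rat q\<bar> \<le> e" for j
  proof -
    from of_rat_dense[of "w j - e" "w j + e"] assms obtain q :: rat
      where "w j - e < of_rat q" "of_rat q < w j + e" by auto
    then show ?thesis by (intro exI[of _ q]) (auto simp: abs_if)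
  qed
  then obtain q :: "nat \<Rightarrow> rat" where q: "\<And>j. \<bar>w j - of_rat (q j)\<bar> \<le> e" by metis
  show ?thesis
    by (rule that[of "map q [0..<n]"]) (use q in auto)
qed

text \<open>
  A function that is differentiable with respect to \<open>\<phi>\<close> can have small increments at many scales
  without being flat, because difference quotients of \<open>\<phi>\<close> may degenerate there. Detecting scales
  exclude this at almost every point: small increments on infinitely many of the annuli already
  force flatness.
\<close>

definition detecting_scales ::
  "'a::metric_space measure \<Rightarrow> nat \<Rightarrow> ('a \<Rightarrow> nat \<Rightarrow> real) \<Rightarrow> (nat \<Rightarrow> real) \<Rightarrow> (nat \<Rightarrow> real) \<Rightarrow> bool" where
  "detecting_scales M n \<phi> s r \<longleftrightarrow>
     (AE x in M. \<forall>D. differentiable_wrt n \<phi> x D \<longrightarrow>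
        (\<forall>e>0. \<exists>\<^sub>F j in sequentially. \<forall>y\<in>annulus x (s j) (r j). \<bar>D y - D x\<bar> \<le> e * dist x y) \<longrightarrow>
        flat_at x D)"

text \<open>
  Fix a vector \<open>u\<close> and a threshold \<open>q\<close>. The set \<open>O' s r\<close> of points \<open>x\<close> for which the increment
  of \<open>u \<bullet> \<phi>\<close> exceeds \<open>q * dist x y\<close> at some \<open>y\<close> with \<open>s < dist x y < r\<close> is open, and it
  increases to \<open>O' 0 r\<close> as \<open>s\<close> decreases to \<open>0\<close>. The measure being finite, little is lost for
  small \<open>s\<close>. Stage \<open>j\<close> treats only the first \<open>j\<close> pairs \<open>(u, q)\<close> with rational entries, so one
  \<open>s\<close> serves all of them, and by Borel--Cantelli almost every point sees each pair in all late
  annuli if it sees it at arbitrarily small scales. If \<open>D\<close> has differential \<open>w\<close> and is not flat,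
  then a rational \<open>u\<close> near \<open>w\<close> has large increments at arbitrarily small scales, hence in all
  late annuli, and so does \<open>D\<close>.
\<close>

lemma testing_scales:
  fixes M :: "'a::metric_space measure" and \<phi> :: "'a \<Rightarrow> nat \<Rightarrow> real"
  assumes sets: "sets M = sets borel" and fin: "finite_measure M"
    and Lip: "\<forall>i<n. C-lipschitz_on UNIV (\<lambda>x. \<phi> x i)" and "C \<ge> 0"
  shows "\<exists>\<sigma>. (\<forall>j r. 0 < r \<longrightarrow> 0 < \<sigma> j r \<and> \<sigma> j r < r) \<and>
    (\<forall>r. (\<forall>j. 0 < r j) \<longrightarrow> r \<longlonglongrightarrow> 0 \<longrightarrow> detecting_scales M n \<phi> (\<lambda>j. \<sigma> j (r j)) r)"
proof -
  interpret finite_measure M by fact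
  define u :: "nat \<Rightarrow> nat \<Rightarrow> real" where
    "u i l = of_rat (fst (from_nat i :: rat list \<times> rat) ! l)" for i l
  define q :: "nat \<Rightarrow> real" where "q i = of_rat (snd (from_nat i :: rat list \<times> rat))" for i
  define O' where "O' i s r = {x. \<exists>y\<in>annulus x s r. q i * dist x y < \<bar>inner_Rn n (u i) (\<phi> y) - inner_Rn n (u i) (\<phi> x)\<bar>}"
    for i s r
  have cont: "continuous_on UNIV (\<lambda>x. inner_Rn n v (\<phi> x))" for v
    unfolding inner_Rn_def
    by (intro continuous_intros lipschitz_on_continuous_on[OF Lip[rule_format]]) auto
  have "open (O' i s r)" for i s r
  proof -
    have eq: "O' i s r = (\<Union>y. {x. s < dist x y \<and> dist x y < r \<and> q i * dist x y < \<bar>inner_Rn n (u i) (\<phi> y) - inner_Rn n (u i) (\<phi> x)\<bar>})"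
      by (auto simp: O'_def annulus_def)
    show ?thesis unfolding eq
      by (intro open_UN ballI open_Collect_conj open_Collect_less continuous_intros cont)
  qed
  then have O_meas[measurable]: "O' i s r \<in> sets M" for i s r
    by (simp add: sets)
  have O_mono: "O' i s r \<subseteq> O' i s' r" if "s' \<le> s" for i s s' r
    using that by (force simp: O'_def annulus_def)
  define B where "B j s r = (\<Union>i\<le>j. O' i 0 r - O' i s r)" for j s r
  have B_meas[measurable]: "B j s r \<in> sets M" for j s r
    unfolding B_def by measurable
  have B_mono: "B j s' r \<subseteq> B j s r" if "s' \<le> s" for j s s' r
    using O_mono[OF that] by (force simp: B_def)
  \<comment> \<open>\<open>B j s r\<close> is what is lost at stage \<open>j\<close> by restricting to distances above \<open>s\<close>.\<close>
  have "\<exists>s>0. s < r \<and> measure M (B j s r) \<le> (1/2)^j" if "r > 0" for j r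
  proof -
    have "(\<lambda>k. measure M (B j (1 / real (Suc k)) r)) \<longlonglongrightarrow> measure M (\<Inter>k. B j (1 / real (Suc k)) r)"
    proof (rule finite_Lim_measure_decseq)
      show "decseq (\<lambda>k. B j (1 / real (Suc k)) r)"
        unfolding decseq_def by (intro allI impI B_mono) (auto simp: field_simps)
    qed auto
    moreover have "(\<Inter>k. B j (1 / real (Suc k)) r) = {}"
    proof (rule ccontr)
      assume "\<not> ?thesis"
      then obtain x where x: "\<And>k. x \<in> B j (1 / real (Suc k)) r" by blast
      have "\<forall>i\<le>j. \<exists>s>0. x \<in> O' i 0 r \<longrightarrow> x \<in> O' i s r"
      proof (intro allI impI)
        fix i
        show "\<exists>s>0. x \<in> O' i 0 r \<longrightarrow> x \<in> O' i s r"
        proof (cases "x \<in> O' i 0 r")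
          case True
          then obtain y where y: "y \<in> annulus x 0 r"
            "q i * dist x y < \<bar>inner_Rn n (u i) (\<phi> y) - inner_Rn n (u i) (\<phi> x)\<bar>"
            by (auto simp: O'_def)
          then have "y \<in> annulus x (dist x y / 2) r" "dist x y / 2 > 0" by (auto simp: annulus_def)
          with y(2) have "x \<in> O' i (dist x y / 2) r" by (auto simp: O'_def)
          with \<open>dist x y / 2 > 0\<close> show ?thesis by blast
        qed (auto intro: exI[of _ 1])
      qed
      then obtain s where s: "\<And>i. i \<le> j \<Longrightarrow> s i > 0 \<and> (x \<in> O' i 0 r \<longrightarrow> x \<in> O' i (s i) r)" by metis
      define s0 where "s0 = Min (s ` {..j})"
      have s0: "s0 > 0" "\<And>i. i \<le> j \<Longrightarrow> s0 \<le> s i"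
        using s by (auto simp: s0_def)
      obtain k where k: "1 / real (Suc k) < s0"
        using s0(1) reals_Archimedean[of s0] by (auto simp: field_simps)
      from x[of k] obtain i where i: "i \<le> j" "x \<in> O' i 0 r" "x \<notin> O' i (1 / real (Suc k)) r"
        by (auto simp: B_def)
      then have "x \<in> O' i (s i) r" using s by blast
      then show False using O_mono[of "1 / real (Suc k)" "s i" i r] k s0(2)[OF i(1)] i(3) by force
    qed
    ultimately have "(\<lambda>k. measure M (B j (1 / real (Suc k)) r)) \<longlonglongrightarrow> 0" by simp
    then have "\<forall>\<^sub>F k in sequentially. measure M (B j (1 / real (Suc k)) r) < (1/2)^j"
      by (rule order_tendstoD) simp
    then obtain k where k: "measure M (B j (1 / real (Suc k)) r) < (1/2)^j"
      by (auto simp: eventually_sequentially)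
    define s where "s = min (1 / real (Suc k)) (r / 2)"
    have "measure M (B j s r) \<le> measure M (B j (1 / real (Suc k)) r)"
      by (intro finite_measure_mono B_mono) (auto simp: s_def)
    with k that show ?thesis by (intro exI[of _ s]) (auto simp: s_def)
  qed
  then have "\<forall>j r. \<exists>s. r > 0 \<longrightarrow> 0 < s \<and> s < r \<and> measure M (B j s r) \<le> (1/2)^j"
    by blast
  then obtain \<sigma> where \<sigma>: "\<And>j r. r > 0 \<Longrightarrow> 0 < \<sigma> j r \<and> \<sigma> j r < r \<and> measure M (B j (\<sigma> j r) r) \<le> (1/2)^j"
    by metis
  show ?thesis
  proof (intro exI[of _ \<sigma>] conjI allI impI)
    show "0 < \<sigma> j r" "\<sigma> j r < r" if "0 < r" for j r using \<sigma>[OF that] by blast+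
    fix r :: "nat \<Rightarrow> real" assume "\<forall>j. 0 < r j" "r \<longlonglongrightarrow> 0"
    then have r: "\<And>j. 0 < r j" "r \<longlonglongrightarrow> 0" by auto
    have "AE x in M. eventually (\<lambda>j. x \<in> space M - B j (\<sigma> j (r j)) (r j)) sequentially"
    proof (rule borel_cantelli_AE1)
      show "summable (\<lambda>j. measure M (B j (\<sigma> j (r j)) (r j)))"
        by (rule summable_comparison_test[of _ "\<lambda>j. (1/2)^j"]) (use \<sigma> r in \<open>auto simp: summable_geometric\<close>)
    qed (auto simp: emeasure_eq_measure)
    then show "detecting_scales M n \<phi> (\<lambda>j. \<sigma> j (r j)) r"
      unfolding detecting_scales_def
    proof eventually_elim
      case (elim x)
      show ?case
      proof (intro allI impI)
        fix D assume "differentiable_wrt n \<phi> x D" and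
          small: "\<forall>e>0. \<exists>\<^sub>F j in sequentially. \<forall>y\<in>annulus x (\<sigma> j (r j)) (r j). \<bar>D y - D x\<bar> \<le> e * dist x y"
        then obtain w where w: "flat_at x (\<lambda>y. D y - inner_Rn n w (\<phi> y))"
          by (auto simp: differentiable_wrt_def differential_at_iff_flat)
        show "flat_at x D"
        proof (rule ccontr)
          assume "\<not> flat_at x D"
          then obtain e where e: "e > 0" "\<exists>\<^sub>F y in at x. \<not> \<bar>D y - D x\<bar> \<le> e * dist x y"
            unfolding flat_at_def frequently_def by auto
          \<comment> \<open>With \<open>d < e / 8\<close>: increments of \<open>D\<close> above \<open>8 * d\<close> give increments of \<open>u i \<bullet> \<phi>\<close> above the
            threshold \<open>3 * d\<close>, and these in turn give increments of \<open>D\<close> above \<open>d\<close>; each step loses at most \<open>2 * d\<close>.\<close>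
          obtain p :: rat where p: "0 < (of_rat p :: real)" "(of_rat p :: real) < e / 8"
            using of_rat_dense[of 0 "e/8"] e(1) by auto
          define d :: real where "d = of_rat p"
          have d: "0 < d" "8 * d < e" using p by (auto simp: d_def)
          have "d / ((real n + 1) * (C + 1)) > 0" using d \<open>C \<ge> 0\<close> by simp
          then obtain us :: "rat list"
            where us: "\<And>j. j < n \<Longrightarrow> \<bar>w j - of_rat (us ! j)\<bar> \<le> d / ((real n + 1) * (C + 1))"
            using rational_approx by blast
          define i where "i = to_nat (us, 3 * p)"
          have ui: "u i j = of_rat (us ! j)" for j by (simp add: u_def i_def)
          have qi: "q i = 3 * d" by (simp add: q_def i_def d_def of_rat_mult)
          have near: "\<bar>(inner_Rn n w (\<phi> y) - inner_Rn n w (\<phi> x)) - (inner_Rn n (u i) (\<phi> y) - inner_Rn n (u i) (\<phi> x))\<bar>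
              \<le> d * dist x y" for y
          proof -
            have "(inner_Rn n w (\<phi> y) - inner_Rn n w (\<phi> x)) - (inner_Rn n (u i) (\<phi> y) - inner_Rn n (u i) (\<phi> x))
               = (\<Sum>j<n. (w j - u i j) * (\<phi> y j - \<phi> x j))"
              by (simp add: inner_Rn_def algebra_simps sum.distrib sum_subtractf)
            also have "\<bar>\<dots>\<bar> \<le> (\<Sum>j<n. \<bar>(w j - u i j) * (\<phi> y j - \<phi> x j)\<bar>)" by (rule sum_abs)
            also have "\<dots> \<le> (\<Sum>j<n. d / ((real n + 1) * (C + 1)) * (C * dist x y))"
            proof (rule sum_mono)
              fix j assume "j \<in> {..<n}"
              then have "\<bar>\<phi> y j - \<phi> x j\<bar> \<le> C * dist x y"
                using lipschitz_onD[OF Lip[rule_format], of j y x] by (simp add: dist_real_def dist_commute)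
              then show "\<bar>(w j - u i j) * (\<phi> y j - \<phi> x j)\<bar> \<le> d / ((real n + 1) * (C + 1)) * (C * dist x y)"
                unfolding abs_mult using us[of j] \<open>j \<in> _\<close> d \<open>C \<ge> 0\<close>
                by (intro mult_mono) (auto simp: ui)
            qed
            also have "\<dots> = (real n / (real n + 1)) * (C / (C + 1)) * (d * dist x y)"
              by simp
            also have "\<dots> \<le> 1 * 1 * (d * dist x y)"
              using d \<open>C \<ge> 0\<close> by (intro mult_mono) auto
            finally show ?thesis by simp
          qed
          have ev: "\<forall>\<^sub>F y in at x. \<bar>D y - inner_Rn n w (\<phi> y) - (D x - inner_Rn n w (\<phi> x))\<bar> \<le> d * dist x y"
            using w d unfolding flat_at_def by blast
          then obtain r0 where r0: "r0 > 0" "\<And>y. y \<noteq> x \<Longrightarrow> dist y x < r0 \<Longrightarrow>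
              \<bar>D y - inner_Rn n w (\<phi> y) - (D x - inner_Rn n w (\<phi> x))\<bar> \<le> d * dist x y"
            by (auto simp: eventually_at)
          have O0: "x \<in> O' i 0 s" if "s > 0" for s
          proof -
            have "\<forall>\<^sub>F y in at x. dist y x < s \<and> y \<noteq> x"
              unfolding eventually_at using that by auto
            from frequently_eventually_frequently[OF e(2) eventually_conj[OF this ev]]
            have "\<exists>y. \<not> \<bar>D y - D x\<bar> \<le> e * dist x y \<and> (dist y x < s \<and> y \<noteq> x) \<and>
                \<bar>D y - inner_Rn n w (\<phi> y) - (D x - inner_Rn n w (\<phi> x))\<bar> \<le> d * dist x y"
              by (rule frequently_ex)
            then obtain y where y: "\<not> \<bar>D y - D x\<bar> \<le> e * dist x y" "dist y x < s" "y \<noteq> x"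
               "\<bar>D y - inner_Rn n w (\<phi> y) - (D x - inner_Rn n w (\<phi> x))\<bar> \<le> d * dist x y"
              by (elim exE conjE) (rule that)
            have "8 * d * dist x y \<le> e * dist x y" using d by (intro mult_right_mono) auto
            moreover have "3 * d * dist x y + d * dist x y + d * dist x y \<le> 8 * d * dist x y"
              using d by (simp add: algebra_simps)
            ultimately have "q i * dist x y < \<bar>inner_Rn n (u i) (\<phi> y) - inner_Rn n (u i) (\<phi> x)\<bar>"
              using y(1,4) near[of y] unfolding qi by linarith
            then show ?thesis using y by (auto simp: O'_def annulus_def dist_commute)
          qed
          have ev1: "\<forall>\<^sub>F j in sequentially. r j < r0 \<and> i \<le> j \<and> x \<notin> B j (\<sigma> j (r j)) (r j)"
            using elim order_tendstoD(2)[OF r(2) r0(1)] eventually_ge_at_top[of i]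
            by eventually_elim auto
          from small d have "\<exists>\<^sub>F j in sequentially. \<forall>y\<in>annulus x (\<sigma> j (r j)) (r j). \<bar>D y - D x\<bar> \<le> d * dist x y"
            by blast
          from frequently_ex[OF frequently_eventually_frequently[OF this ev1]] obtain j where
            j: "\<forall>y\<in>annulus x (\<sigma> j (r j)) (r j). \<bar>D y - D x\<bar> \<le> d * dist x y" "r j < r0" "i \<le> j"
              "x \<notin> B j (\<sigma> j (r j)) (r j)" by (elim exE conjE) (rule that)
          from j O0[OF r(1)] have "x \<in> O' i (\<sigma> j (r j)) (r j)" by (auto simp: B_def)
          then obtain y where y: "y \<in> annulus x (\<sigma> j (r j)) (r j)"
             "q i * dist x y < \<bar>inner_Rn n (u i) (\<phi> y) - inner_Rn n (u i) (\<phi> x)\<bar>"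
            by (auto simp: O'_def)
          then have yx: "y \<noteq> x" "dist y x < r0" using j(2) \<sigma>[OF r(1)[of j], of j]
            by (auto simp: annulus_def dist_commute)
          have "\<bar>D y - D x\<bar> \<le> d * dist x y" using j(1) y(1) by blast
          moreover have "3 * (d * dist x y) < \<bar>inner_Rn n (u i) (\<phi> y) - inner_Rn n (u i) (\<phi> x)\<bar>"
            using y(2) by (simp add: qi algebra_simps)
          ultimately show False using r0(2)[OF yx] near[of y] by linarith
        qed
      qed
    qed
  qed
qed

section \<open>Sets are not porous at almost all of their points\<close>

lemma le_infdistI:
  assumes "A \<noteq> {}" "\<And>z. z \<in> A \<Longrightarrow> c \<le> dist y z"
  shows "c \<le> infdist y A"
proof -
  have "c \<le> (INF z\<in>A. dist y z)" using assms by (rule cINF_greatest)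
  then show ?thesis using assms(1) by (simp add: infdist_def)
qed

text \<open>
  Let \<open>g\<close> be the distance to \<open>A\<close>, and let \<open>S\<close> be a Lipschitz function of one variable that is
  the identity on even ranges and zero on odd ranges of values. On even annuli around a point of
  \<open>A\<close> the function \<open>S \<circ> g - g\<close> is small, on odd annuli \<open>S \<circ> g\<close> is small. Along detecting scales
  both are therefore flat wherever \<open>g\<close> and \<open>S \<circ> g\<close> are differentiable, and so is their
  difference \<open>g\<close>.
\<close>

lemma set_not_porous:
  fixes M :: "'a::metric_space measure"
  assumes sets: "sets M = sets borel" and fin: "finite_measure M"
    and Lip: "\<forall>i<n. C-lipschitz_on UNIV (\<lambda>x. \<phi> x i)" and "C \<ge> 0"
    and diff: "\<And>L F. L-lipschitz_on UNIV F \<Longrightarrow> AE x in M. x \<in> U \<longrightarrow> differentiable_wrt n \<phi> x F"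
  shows "AE x in M. x \<in> U \<inter> A \<longrightarrow> flat_at x (\<lambda>y. infdist y A)"
proof (cases "A = {}")
  case False
  from testing_scales[OF sets fin Lip \<open>C \<ge> 0\<close>] obtain \<sigma> where
    \<sigma>': "(\<forall>j r. 0 < r \<longrightarrow> 0 < \<sigma> j r \<and> \<sigma> j r < r) \<and>
      (\<forall>r. (\<forall>j. 0 < r j) \<longrightarrow> r \<longlonglongrightarrow> 0 \<longrightarrow> detecting_scales M n \<phi> (\<lambda>j. \<sigma> j (r j)) r)"
    by (elim exE)
  then have \<sigma>: "0 < r \<Longrightarrow> 0 < \<sigma> j r \<and> \<sigma> j r < r" for j r by simp
  define r where "r = rec_nat (1::real) (\<lambda>j s. \<sigma> j s / 2 ^ j / 2)"
  \<comment> \<open>Values of \<open>g\<close> below \<open>\<tau> j\<close> are negligible at distances above \<open>\<sigma> j (r j)\<close>, so \<open>S\<close> is prescribed only on \<open>{\<tau> j..r j}\<close>.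
    The factor \<open>1/2\<close> in the recursion separates consecutive ranges, which keeps \<open>S\<close> Lipschitz.\<close>
  define \<tau> where "\<tau> j = \<sigma> j (r j) / 2 ^ j" for j
  have r0: "r 0 = 1" and rS: "r (Suc j) = \<tau> j / 2" for j
    by (simp_all add: r_def \<tau>_def)
  have rpos: "0 < r j" for j
    by (induction j) (use \<sigma> in \<open>auto simp: r0 rS \<tau>_def\<close>)
  have \<tau>pos: "0 < \<tau> j" for j using \<sigma>[OF rpos] by (simp add: \<tau>_def)
  have \<tau>\<sigma>: "\<tau> j \<le> \<sigma> j (r j)" for j
    using \<sigma>[OF rpos, of j j] by (simp add: \<tau>_def field_simps)
  have \<tau>r: "\<tau> j < r j" for j using \<tau>\<sigma>[of j] \<sigma>[OF rpos, of j j] by linarith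
  have r_le: "r j \<le> (1/2)^j" for j
  proof (induction j)
    case (Suc j)
    have "r (Suc j) \<le> r j / 2" using \<tau>r[of j] by (simp add: rS)
    with Suc show ?case by simp
  qed (simp add: r0)
  have rlim: "r \<longlonglongrightarrow> 0"
  proof (rule tendsto_sandwich[OF _ _ tendsto_const])
    show "(\<lambda>j. (1/2::real)^j) \<longlonglongrightarrow> 0" by (simp add: LIMSEQ_realpow_zero)
  qed (use rpos r_le in \<open>auto intro!: always_eventually less_imp_le\<close>)
  have dec: "r k \<le> r j" if "j \<le> k" for j k
    using that
  proof (induction rule: dec_induct)
    case (step k)
    then show ?case using \<tau>r[of k] rpos[of k] by (simp add: rS)
  qed simp
  have good: "detecting_scales M n \<phi> (\<lambda>j. \<sigma> j (r j)) r"
    using \<sigma>' rpos rlim by simp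
  define Z where "Z = (\<Union>j\<in>{j. odd j}. {\<tau> j..r j})"
  have "\<tau> 1 \<in> Z" unfolding Z_def by (rule UN_I[of 1]) (use \<tau>r[of 1] in auto)
  then have "Z \<noteq> {}" by blast
  have gapZ: "t / 2 \<le> infdist t Z" if "even j" "\<tau> j \<le> t" "t \<le> r j" for t j
  proof -
    have "t / 2 \<le> dist t z" if "z \<in> Z" for z
    proof -
      from that obtain k where k: "odd k" "\<tau> k \<le> z" "z \<le> r k" by (auto simp: Z_def)
      have "k \<noteq> j" using k \<open>even j\<close> by auto
      then consider "Suc j \<le> k" | "Suc k \<le> j" by linarith
      then show ?thesis
      proof cases
        case 1
        then have "z \<le> r (Suc j)" using dec[OF 1] k by linarith
        then show ?thesis using \<open>\<tau> j \<le> t\<close> unfolding rS dist_real_def by linarith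
      next
        case 2
        then have "r j \<le> r (Suc k)" by (rule dec)
        then show ?thesis using \<open>t \<le> r j\<close> k rpos[of j] \<open>\<tau> j \<le> t\<close> \<tau>pos[of j] unfolding rS dist_real_def by linarith
      qed
    qed
    with \<open>Z \<noteq> {}\<close> show ?thesis by (rule le_infdistI)
  qed
  define g where "g y = infdist y A" for y
  define S where "S t = min t (2 * infdist t Z)" for t
  have g0: "0 \<le> g y" for y by (simp add: g_def infdist_nonneg)
  have gL: "1-lipschitz_on UNIV g"
    by (rule lipschitz_onI) (auto simp: g_def dist_real_def infdist_triangle_abs)
  have SL: "2-lipschitz_on UNIV S"
  proof (rule lipschitz_onI)
    fix s t :: real
    define e where "e = \<bar>s - t\<bar>"
    have "infdist s Z - infdist t Z \<le> e" "infdist t Z - infdist s Z \<le> e" "s - t \<le> e" "t - s \<le> e"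
      using infdist_triangle_abs[of s Z t] by (auto simp: e_def dist_real_def)
    then have "\<bar>S s - S t\<bar> \<le> 2 * e"
      unfolding S_def min_def abs_le_iff by (simp only: split: if_split, intro conjI impI) linarith+
    then show "dist (S s) (S t) \<le> 2 * dist s t" by (simp add: e_def dist_real_def)
  qed simp
  have "(2 * 1)-lipschitz_on UNIV (S \<circ> g)"
    using gL SL by (intro lipschitz_on_compose) (auto intro: lipschitz_on_subset)
  then have dS: "AE x in M. x \<in> U \<longrightarrow> differentiable_wrt n \<phi> x (S \<circ> g)" by (rule diff)
  show ?thesis
    using diff[OF gL] dS good[unfolded detecting_scales_def]
  proof eventually_elim
    case (elim x)
    show ?case
    proof
      assume x: "x \<in> U \<inter> A"
      have g_x: "g x = 0" using x by (simp add: g_def)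
      have S_0: "S 0 = 0" by (simp add: S_def infdist_nonneg)
      have S_le: "0 \<le> S t \<and> S t \<le> t" if "0 \<le> t" for t using that by (simp add: S_def infdist_nonneg)
      have g_le: "g y \<le> dist x y" for y using infdist_le[of x A y] x by (simp add: g_def dist_commute)
      have small: "\<bar>S (g y) - (if even j then g y else 0)\<bar> \<le> (1/2)^j * dist x y"
        if y: "y \<in> annulus x (\<sigma> j (r j)) (r j)" for j y
      proof (cases "\<tau> j \<le> g y")
        case True
        have gr: "g y \<le> r j" using y g_le[of y] by (simp add: annulus_def)
        have "S (g y) = (if even j then g y else 0)"
        proof (cases "even j")
          case True then show ?thesis using gapZ[OF True \<open>\<tau> j \<le> g y\<close> gr] by (simp add: S_def)
        next
          case False then have "g y \<in> Z" using gr \<open>\<tau> j \<le> g y\<close> by (auto simp: Z_def)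
          then show ?thesis using False g0[of y] by (simp add: S_def)
        qed
        then show ?thesis by simp
      next
        case False
        have "\<bar>S (g y) - (if even j then g y else 0)\<bar> \<le> g y" using S_le[OF g0[of y]] by auto
        also have "\<dots> \<le> \<sigma> j (r j) * (1/2)^j" using False by (simp add: \<tau>_def power_one_over divide_simps)
        also have "\<dots> \<le> dist x y * (1/2)^j" using y by (intro mult_right_mono) (auto simp: annulus_def)
        finally show ?thesis by (simp add: mult.commute)
      qed
      have frequently_small: "\<exists>\<^sub>F j in sequentially. \<forall>y\<in>annulus x (\<sigma> j (r j)) (r j). \<bar>D y - D x\<bar> \<le> e * dist x y"
        if "e > 0" and D: "\<And>j y. even j = b \<Longrightarrow> y \<in> annulus x (\<sigma> j (r j)) (r j) \<Longrightarrow> \<bar>D y - D x\<bar> \<le> (1/2)^j * dist x y"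
        for D :: "'a \<Rightarrow> real" and e b
        unfolding frequently_sequentially
      proof
        fix N
        have "(\<lambda>j. (1/2::real)^j) \<longlonglongrightarrow> 0" by (simp add: LIMSEQ_realpow_zero)
        from order_tendstoD(2)[OF this \<open>e > 0\<close>] obtain K where K: "\<And>j. K \<le> j \<Longrightarrow> (1/2)^j < e"
          by (auto simp: eventually_sequentially)
        define j where "j = 2 * (N + K) + (if b then 0 else 1)"
        have j: "even j = b" "N \<le> j" "K \<le> j" by (auto simp: j_def)
        have "\<bar>D y - D x\<bar> \<le> e * dist x y" if y: "y \<in> annulus x (\<sigma> j (r j)) (r j)" for y
        proof -
          have "(1/2)^j * dist x y \<le> e * dist x y" using K[OF j(3)] by (intro mult_right_mono) auto
          with D[OF j(1) y] show ?thesis by linarith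
        qed
        with j show "\<exists>j\<ge>N. \<forall>y\<in>annulus x (\<sigma> j (r j)) (r j). \<bar>D y - D x\<bar> \<le> e * dist x y" by blast
      qed
      have dx: "differentiable_wrt n \<phi> x (\<lambda>y. S (g y))" "differentiable_wrt n \<phi> x g"
        using elim(1,2) x by (auto simp: comp_def)
      have "flat_at x (\<lambda>y. S (g y) - g y)"
      proof (rule elim(3)[rule_format, OF differentiable_wrt_diff[OF dx]])
        fix e :: real assume "e > 0"
        then show "\<exists>\<^sub>F j in sequentially. \<forall>y\<in>annulus x (\<sigma> j (r j)) (r j).
            \<bar>S (g y) - g y - (S (g x) - g x)\<bar> \<le> e * dist x y"
        proof (rule frequently_small[where b = True])
          fix j y assume "even j = True" "y \<in> annulus x (\<sigma> j (r j)) (r j)"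
          then show "\<bar>S (g y) - g y - (S (g x) - g x)\<bar> \<le> (1/2)^j * dist x y"
            using small[of y j] by (simp add: g_x S_0)
        qed
      qed
      moreover have "flat_at x (\<lambda>y. S (g y))"
      proof (rule elim(3)[rule_format, OF dx(1)])
        fix e :: real assume "e > 0"
        then show "\<exists>\<^sub>F j in sequentially. \<forall>y\<in>annulus x (\<sigma> j (r j)) (r j).
            \<bar>S (g y) - S (g x)\<bar> \<le> e * dist x y"
        proof (rule frequently_small[where b = False])
          fix j y assume "even j = False" "y \<in> annulus x (\<sigma> j (r j)) (r j)"
          then show "\<bar>S (g y) - S (g x)\<bar> \<le> (1/2)^j * dist x y"
            using small[of y j] by (simp add: g_x S_0)
        qed
      qed
      ultimately have "flat_at x (\<lambda>y. S (g y) - (S (g y) - g y))" by (rule flat_at_diff[rotated])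
      then show "flat_at x (\<lambda>y. infdist y A)" by (simp add: g_def)
    qed
  qed
qed auto

section \<open>Smooth partitions of unity\<close>

text \<open>
  On each of its cells, the intervals of length \<open>\<pi>\<close> starting at \<open>\<theta> + k * \<pi>\<close>, this is a bump. It
  vanishes to second order at the endpoints, and the two families with \<open>\<theta> = 0\<close> and \<open>\<theta> = \<pi>/2\<close>
  form a partition of unity.
\<close>

definition bump :: "real \<Rightarrow> real \<Rightarrow> real" where "bump \<theta> t = (sin (t - \<theta>))\<^sup>2"

definition bump' :: "real \<Rightarrow> real \<Rightarrow> real" where "bump' \<theta> t = 2 * sin (t - \<theta>) * cos (t - \<theta>)"

lemma abs_sin_diff_le: "\<bar>sin s - sin t\<bar> \<le> \<bar>s - t\<bar>" for s t :: real
proof -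
  have "\<bar>sin b - sin a\<bar> \<le> \<bar>b - a\<bar>" if "a < b" for a b :: real
  proof -
    from MVT2[OF that, of sin cos] obtain z where "sin b - sin a = (b - a) * cos z"
      by (auto intro: DERIV_sin)
    then show ?thesis using mult_left_mono[of "\<bar>cos z\<bar>" 1 "\<bar>b - a\<bar>"] by (simp add: abs_mult)
  qed
  from this[of s t] this[of t s] show ?thesis by (cases s t rule: linorder_cases) auto
qed

lemma bump_range: "0 \<le> bump \<theta> t" "bump \<theta> t \<le> 1"
  by (auto simp: bump_def abs_square_le_1)

lemma bump'_eq: "bump' \<theta> t = sin (2 * (t - \<theta>))"
  by (simp add: bump'_def sin_double del: right_diff_distrib_numeral)

lemma abs_bump'_le: "\<bar>bump' \<theta> t\<bar> \<le> 1"
  by (simp add: bump'_eq)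

lemma bump_has_derivative: "(bump \<theta> has_real_derivative bump' \<theta> t) (at t)"
  unfolding bump_def[abs_def] bump'_def by (auto intro!: derivative_eq_intros)

lemma bump_taylor: "\<bar>bump \<theta> s - bump \<theta> t - bump' \<theta> t * (s - t)\<bar> \<le> 2 * (s - t)\<^sup>2"
proof -
  have mv: "\<exists>z. \<bar>z - t\<bar> \<le> \<bar>s - t\<bar> \<and> bump \<theta> s - bump \<theta> t = (s - t) * bump' \<theta> z"
  proof (cases s t rule: linorder_cases)
    case less
    from MVT2[OF this, of "bump \<theta>" "bump' \<theta>"] bump_has_derivative obtain z
      where "z > s" "z < t" "bump \<theta> t - bump \<theta> s = (t - s) * bump' \<theta> z" by blast
    then show ?thesis by (intro exI[of _ z]) (auto simp: algebra_simps)
  next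
    case greater
    from MVT2[OF this, of "bump \<theta>" "bump' \<theta>"] bump_has_derivative obtain z
      where "z > t" "z < s" "bump \<theta> s - bump \<theta> t = (s - t) * bump' \<theta> z" by blast
    then show ?thesis by (intro exI[of _ z]) auto
  qed auto
  then obtain z where z: "\<bar>z - t\<bar> \<le> \<bar>s - t\<bar>" "bump \<theta> s - bump \<theta> t = (s - t) * bump' \<theta> z" by blast
  have "\<bar>bump' \<theta> z - bump' \<theta> t\<bar> \<le> 2 * \<bar>z - t\<bar>"
  proof -
    have "\<bar>2 * (z - \<theta>) - 2 * (t - \<theta>)\<bar> = 2 * \<bar>z - t\<bar>" by (simp add: abs_if)
    then show ?thesis
      using abs_sin_diff_le[of "2 * (z - \<theta>)" "2 * (t - \<theta>)"] by (simp only: bump'_eq)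
  qed
  then have "\<bar>s - t\<bar> * \<bar>bump' \<theta> z - bump' \<theta> t\<bar> \<le> \<bar>s - t\<bar> * (2 * \<bar>s - t\<bar>)"
    using z(1) by (intro mult_left_mono) auto
  moreover have "bump \<theta> s - bump \<theta> t - bump' \<theta> t * (s - t) = (s - t) * (bump' \<theta> z - bump' \<theta> t)"
    using z(2) by (simp add: algebra_simps)
  ultimately show ?thesis by (simp add: abs_mult power2_eq_square)
qed

lemma bump_lipschitz: "\<bar>bump \<theta> s - bump \<theta> t\<bar> \<le> 2 * \<bar>s - t\<bar>"
proof -
  have "bump \<theta> s - bump \<theta> t = (sin (s - \<theta>) + sin (t - \<theta>)) * (sin (s - \<theta>) - sin (t - \<theta>))"
    by (simp add: bump_def power2_eq_square algebra_simps)
  also have "\<bar>\<dots>\<bar> \<le> 2 * \<bar>(s - \<theta>) - (t - \<theta>)\<bar>"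
    unfolding abs_mult
  proof (intro mult_mono abs_sin_diff_le)
    show "\<bar>sin (s - \<theta>) + sin (t - \<theta>)\<bar> \<le> 2"
      using abs_sin_le_one[of "s - \<theta>"] abs_sin_le_one[of "t - \<theta>"] by linarith
  qed auto
  finally show ?thesis by simp
qed

definition cell :: "real \<Rightarrow> real \<Rightarrow> int" where "cell \<theta> t = \<lfloor>(t - \<theta>) / pi\<rfloor>"

lemma abs_diff_less_pi_of_cell_eq:
  assumes "cell \<theta> s = cell \<theta> t" shows "\<bar>s - t\<bar> \<le> pi"
proof -
  have "\<bar>(s - \<theta>) / pi - (t - \<theta>) / pi\<bar> \<le> 1"
    using assms unfolding cell_def by linarith
  then have "\<bar>s - t\<bar> / pi \<le> 1" by (simp flip: diff_divide_distrib)
  then show ?thesis by (simp add: pos_divide_le_eq)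
qed

text \<open>Between points of different cells lies a zero of the sine, which is \<open>1\<close>-Lipschitz.\<close>

lemma cell_neq:
  assumes "cell \<theta> s \<noteq> cell \<theta> t"
  shows "\<bar>sin (s - \<theta>)\<bar> \<le> \<bar>s - t\<bar>"
proof -
  define k where "k = max (cell \<theta> s) (cell \<theta> t)"
  define z where "z = real_of_int k * pi"
  have "(min s t - \<theta>) / pi \<le> real_of_int k \<and> real_of_int k \<le> (max s t - \<theta>) / pi"
  proof (cases "s \<le> t")
    case True
    then have "cell \<theta> s \<le> cell \<theta> t" unfolding cell_def by (intro floor_mono divide_right_mono) auto
    with assms have "cell \<theta> s < k" "k = cell \<theta> t" by (auto simp: k_def)
    then show ?thesis using True unfolding cell_def by (simp add: min_def max_def) linarith
  next
    case False
    then have "cell \<theta> t \<le> cell \<theta> s" unfolding cell_def by (intro floor_mono divide_right_mono) auto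
    with assms have "cell \<theta> t < k" "k = cell \<theta> s" by (auto simp: k_def)
    then show ?thesis using False unfolding cell_def by (simp add: min_def max_def) linarith
  qed
  then have "min s t - \<theta> \<le> z" "z \<le> max s t - \<theta>"
    by (auto simp: z_def pos_divide_le_eq pos_le_divide_eq)
  then have "\<bar>(s - \<theta>) - z\<bar> \<le> \<bar>s - t\<bar>" by (auto simp: min_def max_def split: if_splits)
  moreover have "sin z = 0" by (simp add: z_def sin_zero_iff_int2)
  ultimately show ?thesis using abs_sin_diff_le[of "s - \<theta>" z] by simp
qed

lemma bump_le_of_cell_neq:
  assumes "cell \<theta> s \<noteq> cell \<theta> t"
  shows "bump \<theta> s \<le> (s - t)\<^sup>2" "\<bar>bump' \<theta> s\<bar> \<le> 2 * \<bar>s - t\<bar>"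
proof -
  note z = cell_neq[OF assms]
  show "bump \<theta> s \<le> (s - t)\<^sup>2" unfolding bump_def using z by (simp add: abs_le_square_iff)
  have "\<bar>bump' \<theta> s\<bar> = 2 * \<bar>sin (s - \<theta>)\<bar> * \<bar>cos (s - \<theta>)\<bar>" by (simp add: bump'_def abs_mult)
  also have "\<dots> \<le> 2 * \<bar>s - t\<bar> * 1" using z by (intro mult_mono) auto
  finally show "\<bar>bump' \<theta> s\<bar> \<le> 2 * \<bar>s - t\<bar>" by simp
qed

lemma bump_complement: "bump 0 t + bump (pi / 2) t = 1"
  by (simp add: bump_def sin_diff)

text \<open>
  The error of the product rule is quadratic, with \<open>d\<close> in the role of the first-order part of \<open>q
  - p\<close>.
\<close>

lemma prod_taylor:
  fixes p q d :: "'i \<Rightarrow> real"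
  assumes "finite I" and t0: "0 \<le> t"
    and p: "\<And>i. i \<in> I \<Longrightarrow> \<bar>p i\<bar> \<le> 1" and q: "\<And>i. i \<in> I \<Longrightarrow> \<bar>q i\<bar> \<le> 1"
    and pq: "\<And>i. i \<in> I \<Longrightarrow> \<bar>q i - p i\<bar> \<le> t"
    and d: "\<And>i. i \<in> I \<Longrightarrow> \<bar>d i\<bar> \<le> t" and t: "\<And>i. i \<in> I \<Longrightarrow> \<bar>q i - p i - d i\<bar> \<le> t\<^sup>2"
  shows "\<bar>prod q I - prod p I - (\<Sum>i\<in>I. d i * prod p (I - {i}))\<bar> \<le> (real (card I))\<^sup>2 * t\<^sup>2"
  using assms(1) p q pq d t
proof (induction I rule: finite_induct)
  case (insert k I)
  have le1: "\<bar>prod q I\<bar> \<le> 1" "\<bar>p k\<bar> \<le> 1"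
    using insert.prems by (auto simp: abs_prod intro!: prod_le_1)
  have "\<bar>prod q I - prod p I\<bar> \<le> (\<Sum>i\<in>I. \<bar>q i - p i\<bar>)"
    using norm_prod_diff[of I q p] insert.prems by simp
  also have "\<dots> \<le> real (card I) * t" using insert.prems by (intro sum_bounded_above) auto
  finally have diff: "\<bar>prod q I - prod p I\<bar> \<le> real (card I) * t" .
  have sum: "(\<Sum>i\<in>I. d i * prod p (insert k I - {i})) = p k * (\<Sum>i\<in>I. d i * prod p (I - {i}))"
    unfolding sum_distrib_left
  proof (rule sum.cong)
    fix i assume "i \<in> I"
    then have "insert k I - {i} = insert k (I - {i})" using insert.hyps by auto
    then show "d i * prod p (insert k I - {i}) = p k * (d i * prod p (I - {i}))"
      using insert.hyps by simp
  qed simp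
  have "prod q (insert k I) - prod p (insert k I) - (\<Sum>i\<in>insert k I. d i * prod p (insert k I - {i}))
      = (q k - p k - d k) * prod q I + p k * (prod q I - prod p I - (\<Sum>i\<in>I. d i * prod p (I - {i})))
        + d k * (prod q I - prod p I)"
    using insert.hyps by (simp add: sum algebra_simps)
  also have "\<bar>\<dots>\<bar> \<le> t\<^sup>2 * 1 + 1 * ((real (card I))\<^sup>2 * t\<^sup>2) + t * (real (card I) * t)"
  proof (intro order_trans[OF abs_triangle_ineq] add_mono)
    show "\<bar>(q k - p k - d k) * prod q I\<bar> \<le> t\<^sup>2 * 1"
      unfolding abs_mult using insert.prems(5)[of k] le1 by (intro mult_mono) auto
    have "\<bar>prod q I - prod p I - (\<Sum>i\<in>I. d i * prod p (I - {i}))\<bar> \<le> (real (card I))\<^sup>2 * t\<^sup>2"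
      using insert.prems by (intro insert.IH) auto
    then show "\<bar>p k * (prod q I - prod p I - (\<Sum>i\<in>I. d i * prod p (I - {i})))\<bar>
        \<le> 1 * ((real (card I))\<^sup>2 * t\<^sup>2)"
      unfolding abs_mult using le1 by (intro mult_mono) auto
    show "\<bar>d k * (prod q I - prod p I)\<bar> \<le> t * (real (card I) * t)"
      unfolding abs_mult using insert.prems(4)[of k] diff t0 by (intro mult_mono) auto
  qed
  also have "\<dots> \<le> (real (card (insert k I)))\<^sup>2 * t\<^sup>2"
    using insert.hyps t0 by (simp add: power2_eq_square algebra_simps)
  finally show ?case .
qed simp

section \<open>Approximation by smooth functions of a Lipschitz light map\<close>

lemma abs_le_L2_set:
  fixes v :: "nat \<Rightarrow> real"
  assumes "i < n" shows "\<bar>v i\<bar> \<le> L2_set v {..<n}"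
proof -
  have "\<bar>v i\<bar> = L2_set v {i}" by (simp add: L2_set_def)
  also have "\<dots> \<le> L2_set v {..<n}"
    using assms unfolding L2_set_def by (intro real_sqrt_le_mono sum_mono2) auto
  finally show ?thesis .
qed

definition chain_in :: "'a::metric_space set \<Rightarrow> real \<Rightarrow> 'a \<Rightarrow> 'a \<Rightarrow> bool" where
  "chain_in S R = (\<lambda>a b. a \<in> S \<and> b \<in> S \<and> dist a b \<le> R)\<^sup>*\<^sup>*"

text \<open>
  The consequence of lightness that the construction uses. Here \<open>S\<close> is a set with small image
  instead of a full preimage, and the \<open>R\<close>-component of a point is described by \<open>R\<close>-chains.
\<close>

definition chain_light :: "real \<Rightarrow> nat \<Rightarrow> ('a::metric_space \<Rightarrow> nat \<Rightarrow> real) \<Rightarrow> bool" where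
  "chain_light C m f \<longleftrightarrow> 0 < C \<and> (\<forall>i<m. C-lipschitz_on UNIV (\<lambda>x. f x i)) \<and>
     (\<forall>R>0. \<forall>S. (\<forall>u\<in>S. \<forall>v\<in>S. L2_set (\<lambda>i. f u i - f v i) {..<m} \<le> R) \<longrightarrow>
        (\<forall>x\<in>S. \<forall>y. chain_in S R x y \<longrightarrow> dist x y \<le> C * R))"

lemma chain_light_of_lipschitz_light:
  fixes f :: "'a::metric_space \<Rightarrow> nat \<Rightarrow> real"
  assumes "lipschitz_light euclidean_metric (Rn m) f"
  shows "\<exists>C. chain_light C m f"
proof -
  from assms obtain C where C: "C > 0"
    and Lip: "\<And>x y. L2_set (\<lambda>i. f x i - f y i) {..<m} \<le> C * dist x y"
    and light: "\<And>r W x. r > 0 \<Longrightarrow> W \<subseteq> mspace (Rn m) \<Longrightarrow> diam_le (Rn m) W r \<Longrightarrow> f x \<in> W \<Longrightarrow>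
       diam_le euclidean_metric (r_component (submetric euclidean_metric (f -` W)) r x) (C * r)"
    and fR: "\<And>x. f x \<in> mspace (Rn m)"
    unfolding lipschitz_light_def by (auto simp: mdist_Rn Pi_iff)
  have "C-lipschitz_on UNIV (\<lambda>x. f x i)" if "i < m" for i
  proof (rule lipschitz_onI)
    fix x y
    show "dist (f x i) (f y i) \<le> C * dist x y"
      using abs_le_L2_set[OF that, of "\<lambda>i. f x i - f y i"] Lip[of x y] by (simp add: dist_real_def)
  qed (use C in simp)
  moreover have "dist x y \<le> C * R"
    if "R > 0" and S: "\<forall>u\<in>S. \<forall>v\<in>S. L2_set (\<lambda>i. f u i - f v i) {..<m} \<le> R" "x \<in> S"
      and ch: "chain_in S R x y" for R S x y
  proof -
    let ?m = "submetric euclidean_metric (f -` (f ` S)) :: 'a metric"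
    have "\<exists>xs. r_path ?m R xs \<and> x \<in> set xs \<and> last xs = y"
      using ch unfolding chain_in_def
    proof (induction rule: rtranclp_induct)
      case base
      then show ?case using \<open>x \<in> S\<close> by (intro exI[of _ "[x]"]) (auto simp: r_path_def)
    next
      case (step y z)
      then obtain xs where xs: "r_path ?m R xs" "x \<in> set xs" "last xs = y" by blast
      with step(2) show ?case
        by (intro exI[of _ "xs @ [z]"]) (auto simp: r_path_def successively_append_iff)
    qed
    then obtain xs where xs: "r_path ?m R xs" "x \<in> set xs" "last xs = y" by blast
    then have "y \<in> set xs" by (auto simp: r_path_def)
    with xs have "x \<in> r_component ?m R x" "y \<in> r_component ?m R x"
      by (auto simp: r_component_def)
    moreover have "diam_le euclidean_metric (r_component ?m R x) (C * R)"
      using S \<open>R > 0\<close> fR by (intro light) (auto simp: diam_le_def mdist_Rn)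
    ultimately show ?thesis by (auto simp: diam_le_def)
  qed
  ultimately show ?thesis using C unfolding chain_light_def by blast
qed

text \<open>
  Approximations \<open>F\<close> of \<open>h\<close> that are, to second order, functions of \<open>f\<close> with gradient \<open>a\<close>. The
  bounds \<open>\<eta>\<close> and \<open>L\<close> are part of the data, while the constant of the quadratic error may depend
  on \<open>F\<close>; in the construction below it grows like the inverse of the mesh size.
\<close>

definition jet_approximations ::
  "nat \<Rightarrow> ('a::metric_space \<Rightarrow> nat \<Rightarrow> real) \<Rightarrow> ('a \<Rightarrow> real) \<Rightarrow> real \<Rightarrow> real \<Rightarrow>
    (('a \<Rightarrow> real) \<times> ('a \<Rightarrow> nat \<Rightarrow> real)) set" where
  "jet_approximations m f h L \<eta> = {(F, a).
     (\<forall>x. \<bar>F x - h x\<bar> \<le> \<eta>) \<and> L-lipschitz_on UNIV F \<and>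
     (\<forall>i<m. continuous_on UNIV (\<lambda>x. a x i) \<and> (\<forall>x. \<bar>a x i\<bar> \<le> L)) \<and>
     (\<exists>K\<ge>0. \<forall>x y. \<bar>F y - F x - inner_Rn m (a x) (\<lambda>i. f y i - f x i)\<bar> \<le> K * (dist x y)\<^sup>2)}"

text \<open>
  Each set \<open>\<epsilon>\<close> of coordinates selects a tiling of \<open>\<real>\<^sup>m\<close> by cubes of side \<open>\<pi> * \<delta>\<close>: shifted by
  half a side in the coordinates of \<open>\<epsilon>\<close> and unshifted in the others. The products \<open>weight \<epsilon>\<close> of
  the corresponding bumps sum to \<open>1\<close>, and each of them vanishes to second order on the boundary
  of its cubes. Hence \<open>val \<epsilon>\<close> may jump from cube to cube, and inside the preimage of a cube from
  piece to piece, where pieces are \<open>R\<close>-separated.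
\<close>

locale light_grid =
  fixes C :: real and m :: nat and f :: "'a::metric_space \<Rightarrow> nat \<Rightarrow> real"
    and h :: "'a \<Rightarrow> real" and L \<delta> :: real
  assumes light: "chain_light C m f" and h_lipschitz: "L-lipschitz_on UNIV h" and \<delta>: "0 < \<delta>"
begin

definition "R = 4 * (real m + 1) * \<delta>"

definition "\<theta> \<epsilon> i = (if i \<in> \<epsilon> then pi / 2 else 0 :: real)" for \<epsilon> :: "nat set" and i

definition "weight \<epsilon> x = (\<Prod>i<m. bump (\<theta> \<epsilon> i) (f x i / \<delta>))"

text \<open>
  The partial derivative of the weight in direction \<open>i\<close>, as a function on the target.
\<close>

definition "grad \<epsilon> x i =
  bump' (\<theta> \<epsilon> i) (f x i / \<delta>) / \<delta> * (\<Prod>j\<in>{..<m} - {i}. bump (\<theta> \<epsilon> j) (f x j / \<delta>))"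

definition "same_cell \<epsilon> x y \<longleftrightarrow> (\<forall>i<m. cell (\<theta> \<epsilon> i) (f x i / \<delta>) = cell (\<theta> \<epsilon> i) (f y i / \<delta>))"

definition "piece \<epsilon> x = {y. (\<lambda>a b. same_cell \<epsilon> a b \<and> dist a b \<le> R)\<^sup>*\<^sup>* x y}"

definition "val \<epsilon> x = h (SOME z. z \<in> piece \<epsilon> x)"

definition "F x = (\<Sum>\<epsilon>\<in>Pow {..<m}. weight \<epsilon> x * val \<epsilon> x)"

text \<open>
  The gradients of the weights sum to \<open>0\<close>, so subtracting \<open>h x\<close> does not change this sum; it
  makes the terms bounded independently of \<open>\<delta>\<close>, because \<open>grad\<close> is of order \<open>1 / \<delta>\<close> and \<open>val \<epsilon> x
  - h x\<close> of order \<open>\<delta>\<close>.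
\<close>

definition "a x i = (\<Sum>\<epsilon>\<in>Pow {..<m}. grad \<epsilon> x i * (val \<epsilon> x - h x))"

lemma C: "0 < C" and f_lipschitz: "i < m \<Longrightarrow> C-lipschitz_on UNIV (\<lambda>x. f x i)"
  using light by (auto simp: chain_light_def)

lemma L: "0 \<le> L" using h_lipschitz lipschitz_on_nonneg by blast

lemma R: "0 < R" using \<delta> by (simp add: R_def)

lemma abs_f_diff_le: "i < m \<Longrightarrow> \<bar>f y i - f x i\<bar> \<le> C * dist x y"
  using lipschitz_onD[OF f_lipschitz, of i y x] by (simp add: dist_real_def dist_commute)

lemma abs_h_diff_le: "\<bar>h y - h x\<bar> \<le> L * dist x y"
  using lipschitz_onD[OF h_lipschitz, of y x] by (simp add: dist_real_def dist_commute)

lemma same_cell_refl: "same_cell \<epsilon> x x" and same_cell_sym: "same_cell \<epsilon> x y \<Longrightarrow> same_cell \<epsilon> y x"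
  and same_cell_trans: "same_cell \<epsilon> x y \<Longrightarrow> same_cell \<epsilon> y z \<Longrightarrow> same_cell \<epsilon> x z"
  by (auto simp: same_cell_def)

text \<open>
  This is where lightness is used: a piece is an \<open>R\<close>-component over a set of diameter at most
  \<open>R\<close>.
\<close>

lemma dist_piece_le:
  assumes "z \<in> piece \<epsilon> x" shows "dist x z \<le> C * R"
proof -
  define S where "S = {u. same_cell \<epsilon> x u}"
  have "chain_in S R x z"
    using assms unfolding piece_def mem_Collect_eq
  proof (induction rule: rtranclp_induct)
    case base show ?case by (simp add: chain_in_def)
  next
    case (step y z)
    have "y \<in> S" using step.IH by (cases rule: rtranclp.cases[OF step.IH[unfolded chain_in_def]])
        (auto simp: S_def same_cell_refl)
    then have "z \<in> S" using step.hyps by (auto simp: S_def intro: same_cell_trans)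
    with step \<open>y \<in> S\<close> show ?case unfolding chain_in_def
      by (elim rtranclp.rtrancl_into_rtrancl) auto
  qed
  moreover have "L2_set (\<lambda>i. f u i - f v i) {..<m} \<le> R" if "u \<in> S" "v \<in> S" for u v
  proof -
    have uv: "same_cell \<epsilon> u v" using that by (auto simp: S_def intro: same_cell_trans same_cell_sym)
    have "\<bar>f u i - f v i\<bar> \<le> 4 * \<delta>" if "i < m" for i
    proof -
      have "\<bar>f u i / \<delta> - f v i / \<delta>\<bar> \<le> pi"
        using uv that by (intro abs_diff_less_pi_of_cell_eq) (auto simp: same_cell_def)
      also have "\<dots> \<le> 4" using pi_less_4 by simp
      finally have "\<bar>f u i - f v i\<bar> / \<delta> \<le> 4" using \<delta> by (simp flip: diff_divide_distrib)
      then show ?thesis using \<delta> by (simp add: pos_divide_le_eq)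
    qed
    then have "(\<Sum>i<m. \<bar>f u i - f v i\<bar>) \<le> real (card {..<m}) * (4 * \<delta>)"
      by (intro sum_bounded_above) auto
    also have "\<dots> \<le> R" using \<delta> by (simp add: R_def algebra_simps)
    finally show ?thesis using L2_set_le_sum_abs[of "\<lambda>i. f u i - f v i" "{..<m}"] by linarith
  qed
  moreover have "x \<in> S" by (simp add: S_def same_cell_refl)
  ultimately show ?thesis using light R unfolding chain_light_def by blast
qed

lemma abs_val_diff_le: "\<bar>val \<epsilon> x - h x\<bar> \<le> L * C * R"
proof -
  have "x \<in> piece \<epsilon> x" by (simp add: piece_def)
  then have "(SOME z. z \<in> piece \<epsilon> x) \<in> piece \<epsilon> x" by (rule someI)
  from dist_piece_le[OF this] have "L * dist x (SOME z. z \<in> piece \<epsilon> x) \<le> L * (C * R)"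
    using L by (rule mult_left_mono)
  then show ?thesis using abs_h_diff_le[of "SOME z. z \<in> piece \<epsilon> x" x] by (simp add: val_def)
qed

lemma val_eq:
  assumes "same_cell \<epsilon> x y" "dist x y \<le> R" shows "val \<epsilon> x = val \<epsilon> y"
proof -
  have "piece \<epsilon> x = piece \<epsilon> y"
    unfolding piece_def using assms
    by (auto intro: converse_rtranclp_into_rtranclp same_cell_sym simp: dist_commute)
  then show ?thesis by (simp add: val_def)
qed

lemma weight_nonneg: "0 \<le> weight \<epsilon> x"
  unfolding weight_def by (intro prod_nonneg) (simp add: bump_range)

lemma sum_weight: "(\<Sum>\<epsilon>\<in>Pow {..<m}. weight \<epsilon> x) = 1"
proof -
  have "(\<Prod>i<m. bump (pi / 2) (f x i / \<delta>) + bump 0 (f x i / \<delta>)) = 1"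
    by (simp add: bump_complement add.commute)
  moreover have "(\<Prod>i\<in>\<epsilon>. bump (pi / 2) (f x i / \<delta>)) * (\<Prod>i\<in>{..<m} - \<epsilon>. bump 0 (f x i / \<delta>)) = weight \<epsilon> x"
    if "\<epsilon> \<in> Pow {..<m}" for \<epsilon>
  proof -
    have "(\<Prod>i\<in>\<epsilon>. bump (pi / 2) (f x i / \<delta>)) = (\<Prod>i\<in>\<epsilon>. bump (\<theta> \<epsilon> i) (f x i / \<delta>))"
      "(\<Prod>i\<in>{..<m} - \<epsilon>. bump 0 (f x i / \<delta>)) = (\<Prod>i\<in>{..<m} - \<epsilon>. bump (\<theta> \<epsilon> i) (f x i / \<delta>))"
      by (auto simp: \<theta>_def intro!: prod.cong)
    moreover have "\<epsilon> \<subseteq> {..<m}" using that by simp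
    ultimately show ?thesis using prod.subset_diff[of \<epsilon> "{..<m}" "\<lambda>i. bump (\<theta> \<epsilon> i) (f x i / \<delta>)"]
      by (simp add: weight_def mult.commute)
  qed
  ultimately show ?thesis by (simp add: prod_add)
qed

lemma prod_bump_le_1: "(\<Prod>j\<in>J. bump (\<theta> \<epsilon> j) (f x j / \<delta>)) \<le> 1"
  by (rule prod_le_1) (simp add: bump_range)

lemma prod_bump_le:
  assumes "finite J" "k \<in> J"
  shows "(\<Prod>j\<in>J. bump (\<theta> \<epsilon> j) (f x j / \<delta>)) \<le> bump (\<theta> \<epsilon> k) (f x k / \<delta>)"
proof -
  have "bump (\<theta> \<epsilon> k) (f x k / \<delta>) * (\<Prod>j\<in>J - {k}. bump (\<theta> \<epsilon> j) (f x j / \<delta>)) \<le> bump (\<theta> \<epsilon> k) (f x k / \<delta>) * 1"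
    by (intro mult_left_mono prod_bump_le_1) (simp add: bump_range)
  then show ?thesis using assms by (simp add: prod.remove)
qed

lemma abs_grad_le: "\<bar>grad \<epsilon> x i\<bar> \<le> 1 / \<delta>"
proof -
  have "\<bar>grad \<epsilon> x i\<bar> = \<bar>bump' (\<theta> \<epsilon> i) (f x i / \<delta>)\<bar> / \<delta> * (\<Prod>j\<in>{..<m} - {i}. bump (\<theta> \<epsilon> j) (f x j / \<delta>))"
    using \<delta> by (simp add: grad_def abs_mult abs_prod bump_range)
  also have "\<dots> \<le> 1 / \<delta> * 1"
    using \<delta> abs_bump'_le by (intro mult_mono divide_right_mono prod_bump_le_1 prod_nonneg) (auto simp: bump_range)
  finally show ?thesis by simp
qed

text \<open>
  Dominates the increments of the bumps between \<open>x\<close> and \<open>y\<close> and their first-order parts.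
\<close>

definition t :: "'a \<Rightarrow> 'a \<Rightarrow> real" where "t x y = 2 * C / \<delta> * dist x y"

lemma t_nonneg: "0 \<le> t x y" using C \<delta> by (simp add: t_def)

lemma abs_f_diff_le_t: "i < m \<Longrightarrow> 2 * \<bar>f y i / \<delta> - f x i / \<delta>\<bar> \<le> t x y"
proof -
  assume "i < m"
  then have "2 * \<bar>f y i - f x i\<bar> / \<delta> \<le> 2 * (C * dist x y) / \<delta>"
    using abs_f_diff_le \<delta> by (intro divide_right_mono) auto
  then show ?thesis using \<delta> by (simp add: t_def flip: diff_divide_distrib)
qed

lemma weight_taylor:
  "\<bar>weight \<epsilon> y - weight \<epsilon> x - (\<Sum>i<m. grad \<epsilon> x i * (f y i - f x i))\<bar> \<le> (real m)\<^sup>2 * (t x y)\<^sup>2"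
proof -
  define p where "p i = bump (\<theta> \<epsilon> i) (f x i / \<delta>)" for i
  define q where "q i = bump (\<theta> \<epsilon> i) (f y i / \<delta>)" for i
  define d where "d i = bump' (\<theta> \<epsilon> i) (f x i / \<delta>) * (f y i / \<delta> - f x i / \<delta>)" for i
  have "\<bar>prod q {..<m} - prod p {..<m} - (\<Sum>i\<in>{..<m}. d i * prod p ({..<m} - {i}))\<bar>
      \<le> (real (card {..<m}))\<^sup>2 * (t x y)\<^sup>2"
  proof (rule prod_taylor)
    fix i assume "i \<in> {..<m}"
    then have t: "2 * \<bar>f y i / \<delta> - f x i / \<delta>\<bar> \<le> t x y" using abs_f_diff_le_t by simp
    show "\<bar>p i\<bar> \<le> 1" "\<bar>q i\<bar> \<le> 1" by (simp_all add: p_def q_def bump_range)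
    show "\<bar>q i - p i\<bar> \<le> t x y" unfolding p_def q_def using bump_lipschitz t by (rule order_trans)
    have "\<bar>d i\<bar> \<le> 1 * \<bar>f y i / \<delta> - f x i / \<delta>\<bar>" unfolding d_def abs_mult
      by (intro mult_right_mono abs_bump'_le) simp
    then show "\<bar>d i\<bar> \<le> t x y" using t by linarith
    have "\<bar>q i - p i - d i\<bar> \<le> 2 * (f y i / \<delta> - f x i / \<delta>)\<^sup>2"
      unfolding p_def q_def d_def by (rule bump_taylor)
    also have "\<dots> \<le> (2 * \<bar>f y i / \<delta> - f x i / \<delta>\<bar>)\<^sup>2" by (simp add: power2_eq_square)
    also have "\<dots> \<le> (t x y)\<^sup>2" using t by (intro power_mono) auto
    finally show "\<bar>q i - p i - d i\<bar> \<le> (t x y)\<^sup>2" .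
  qed (auto simp: t_nonneg)
  moreover have "d i * prod p ({..<m} - {i}) = grad \<epsilon> x i * (f y i - f x i)" for i
    using \<delta> by (simp add: d_def p_def grad_def field_simps)
  ultimately show ?thesis by (simp add: weight_def p_def q_def)
qed

text \<open>
  Some coordinate crosses a zero between \<open>x\<close> and \<open>y\<close>, and there the bump vanishes to second
  order.
\<close>

lemma other_cell:
  assumes "\<not> same_cell \<epsilon> x y"
  shows "weight \<epsilon> x \<le> (t x y)\<^sup>2" "\<bar>grad \<epsilon> x i\<bar> \<le> t x y / \<delta>"
proof -
  from assms obtain k where k: "k < m" "cell (\<theta> \<epsilon> k) (f x k / \<delta>) \<noteq> cell (\<theta> \<epsilon> k) (f y k / \<delta>)"
    by (auto simp: same_cell_def)
  define s where "s = \<bar>f x k / \<delta> - f y k / \<delta>\<bar>"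
  have s: "2 * s \<le> t x y" "0 \<le> s" using abs_f_diff_le_t[OF k(1), of y x] by (auto simp: s_def abs_minus_commute)
  have b: "bump (\<theta> \<epsilon> k) (f x k / \<delta>) \<le> s\<^sup>2" "\<bar>bump' (\<theta> \<epsilon> k) (f x k / \<delta>)\<bar> \<le> 2 * s"
    using bump_le_of_cell_neq[OF k(2)] by (auto simp: s_def)
  have "weight \<epsilon> x \<le> s\<^sup>2" using prod_bump_le[of "{..<m}" k \<epsilon> x] k(1) b(1) unfolding weight_def by simp
  also have "\<dots> \<le> (t x y)\<^sup>2" using s by (intro power_mono) auto
  finally show "weight \<epsilon> x \<le> (t x y)\<^sup>2" .
  have bt: "bump (\<theta> \<epsilon> k) (f x k / \<delta>) \<le> t x y"
  proof (cases "t x y \<le> 1")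
    case True
    have "s * s \<le> s * 1" using s True by (intro mult_left_mono) auto
    then show ?thesis using b(1) s by (simp add: power2_eq_square)
  qed (use bump_range(2)[of "\<theta> \<epsilon> k" "f x k / \<delta>"] in linarith)
  have eq: "\<bar>grad \<epsilon> x i\<bar> = \<bar>bump' (\<theta> \<epsilon> i) (f x i / \<delta>)\<bar> / \<delta> * (\<Prod>j\<in>{..<m} - {i}. bump (\<theta> \<epsilon> j) (f x j / \<delta>))"
    using \<delta> by (simp add: grad_def abs_mult abs_prod bump_range)
  show "\<bar>grad \<epsilon> x i\<bar> \<le> t x y / \<delta>"
  proof (cases "i = k")
    case True
    have "\<bar>grad \<epsilon> x i\<bar> \<le> t x y / \<delta> * 1"
      unfolding eq using \<delta> b(2) s True t_nonneg
      by (intro mult_mono divide_right_mono prod_bump_le_1 prod_nonneg) (auto simp: bump_range)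
    then show ?thesis by simp
  next
    case False
    have "(\<Prod>j\<in>{..<m} - {i}. bump (\<theta> \<epsilon> j) (f x j / \<delta>)) \<le> t x y"
      using prod_bump_le[of "{..<m} - {i}" k \<epsilon> x] k False bt by simp
    then have "\<bar>grad \<epsilon> x i\<bar> \<le> 1 / \<delta> * t x y"
      unfolding eq using \<delta> abs_bump'_le
      by (intro mult_mono divide_right_mono prod_nonneg) (auto simp: bump_range)
    then show ?thesis by simp
  qed
qed

definition "M = L * (C + 1) * R"

definition "K = 2 ^ m * (M * (real m + 2)\<^sup>2 * (2 * C / \<delta>)\<^sup>2)"

lemma M: "0 \<le> M" using L C R by (simp add: M_def)

lemma K: "0 \<le> K" using M by (simp add: K_def)

text \<open>
  Since the weights sum to \<open>1\<close>, the constant \<open>h x\<close> can be subtracted from all values, which are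
  then at most \<open>M\<close> in modulus. If \<open>x\<close> and \<open>y\<close>, at distance at most \<open>R\<close>, lie in one cell, they
  lie in one piece and the error is that of the weight. Otherwise the terms for this \<open>\<epsilon>\<close> are all
  quadratically small.
\<close>

lemma jet_local:
  assumes "dist x y \<le> R"
  shows "\<bar>F y - F x - inner_Rn m (a x) (\<lambda>i. f y i - f x i)\<bar> \<le> K * (dist x y)\<^sup>2"
proof -
  define E where "E \<epsilon> = weight \<epsilon> y * (val \<epsilon> y - h x) - weight \<epsilon> x * (val \<epsilon> x - h x)
     - (\<Sum>i<m. grad \<epsilon> x i * (f y i - f x i)) * (val \<epsilon> x - h x)" for \<epsilon>
  have F_eq: "F z - h x = (\<Sum>\<epsilon>\<in>Pow {..<m}. weight \<epsilon> z * (val \<epsilon> z - h x))" for z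
    by (simp add: F_def right_diff_distrib sum_subtractf sum_weight flip: sum_distrib_right)
  have a_eq: "inner_Rn m (a x) (\<lambda>i. f y i - f x i) =
      (\<Sum>\<epsilon>\<in>Pow {..<m}. (\<Sum>i<m. grad \<epsilon> x i * (f y i - f x i)) * (val \<epsilon> x - h x))"
    unfolding inner_Rn_def a_def sum_distrib_right by (subst sum.swap) (simp add: mult_ac)
  have "F y - F x - inner_Rn m (a x) (\<lambda>i. f y i - f x i) = (\<Sum>\<epsilon>\<in>Pow {..<m}. E \<epsilon>)"
    using F_eq[of x] F_eq[of y] by (simp add: a_eq E_def sum_subtractf)
  moreover have "\<bar>E \<epsilon>\<bar> \<le> M * (real m + 2)\<^sup>2 * (t x y)\<^sup>2" for \<epsilon>
  proof -
    have vx: "\<bar>val \<epsilon> x - h x\<bar> \<le> M"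
    proof -
      have "L * C * R \<le> M" using L R by (simp add: M_def algebra_simps)
      then show ?thesis using abs_val_diff_le[of \<epsilon> x] by linarith
    qed
    have vy: "\<bar>val \<epsilon> y - h x\<bar> \<le> M"
    proof -
      have "L * dist x y \<le> L * R" using assms L by (intro mult_left_mono)
      then have "L * C * R + L * dist x y \<le> M" by (simp add: M_def algebra_simps)
      then show ?thesis using abs_val_diff_le[of \<epsilon> y] abs_h_diff_le[of y x] by linarith
    qed
    show ?thesis
    proof (cases "same_cell \<epsilon> x y")
      case True
      then have "E \<epsilon> = (val \<epsilon> x - h x) * (weight \<epsilon> y - weight \<epsilon> x - (\<Sum>i<m. grad \<epsilon> x i * (f y i - f x i)))"
        using val_eq[OF True assms] by (simp add: E_def algebra_simps)
      then have "\<bar>E \<epsilon>\<bar> \<le> M * ((real m)\<^sup>2 * (t x y)\<^sup>2)"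
        unfolding abs_mult using M vx weight_taylor by (simp add: abs_mult mult_mono)
      also have "\<dots> \<le> M * ((real m + 2)\<^sup>2 * (t x y)\<^sup>2)"
        using M by (intro mult_left_mono mult_right_mono power_mono) auto
      finally show ?thesis by (simp add: mult_ac)
    next
      case False
      have "\<bar>grad \<epsilon> x i * (f y i - f x i)\<bar> \<le> (t x y)\<^sup>2" if "i < m" for i
      proof -
        have "\<bar>f y i - f x i\<bar> / \<delta> \<le> t x y"
          using abs_f_diff_le_t[OF that, of y x] t_nonneg[of x y] \<delta> by (simp flip: diff_divide_distrib)
        then have "\<bar>f y i - f x i\<bar> \<le> t x y * \<delta>" using \<delta> by (simp add: pos_divide_le_eq)
        then have "\<bar>grad \<epsilon> x i * (f y i - f x i)\<bar> \<le> t x y / \<delta> * (t x y * \<delta>)"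
          unfolding abs_mult using other_cell(2)[OF False] t_nonneg \<delta> by (intro mult_mono) auto
        then show ?thesis using \<delta> by (simp add: power2_eq_square)
      qed
      then have "(\<Sum>i<m. \<bar>grad \<epsilon> x i * (f y i - f x i)\<bar>) \<le> real (card {..<m}) * (t x y)\<^sup>2"
        by (intro sum_bounded_above) auto
      then have g: "\<bar>\<Sum>i<m. grad \<epsilon> x i * (f y i - f x i)\<bar> \<le> real m * (t x y)\<^sup>2"
        using sum_abs[of "\<lambda>i. grad \<epsilon> x i * (f y i - f x i)" "{..<m}"] unfolding card_lessThan by linarith
      have wx: "\<bar>weight \<epsilon> x\<bar> \<le> (t x y)\<^sup>2" using other_cell(1)[OF False] weight_nonneg by simp
      have "t y x = t x y" by (simp add: t_def dist_commute)
      then have wy: "\<bar>weight \<epsilon> y\<bar> \<le> (t x y)\<^sup>2"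
        using other_cell(1)[of \<epsilon> y x] False same_cell_sym weight_nonneg by fastforce
      have "\<bar>E \<epsilon>\<bar> \<le> \<bar>weight \<epsilon> y * (val \<epsilon> y - h x)\<bar> + \<bar>weight \<epsilon> x * (val \<epsilon> x - h x)\<bar>
          + \<bar>(\<Sum>i<m. grad \<epsilon> x i * (f y i - f x i)) * (val \<epsilon> x - h x)\<bar>"
        unfolding E_def by linarith
      also have "\<dots> \<le> (t x y)\<^sup>2 * M + (t x y)\<^sup>2 * M + real m * (t x y)\<^sup>2 * M"
        unfolding abs_mult using wx wy g vx vy by (intro add_mono mult_mono) auto
      also have "\<dots> = M * ((real m + 2) * 1) * (t x y)\<^sup>2" by (simp add: algebra_simps)
      also have "\<dots> \<le> M * ((real m + 2) * (real m + 2)) * (t x y)\<^sup>2"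
        using M by (intro mult_right_mono mult_left_mono) auto
      finally show ?thesis by (simp add: power2_eq_square)
    qed
  qed
  then have "(\<Sum>\<epsilon>\<in>Pow {..<m}. \<bar>E \<epsilon>\<bar>) \<le> real (card (Pow {..<m})) * (M * (real m + 2)\<^sup>2 * (t x y)\<^sup>2)"
    by (intro sum_bounded_above)
  ultimately have "\<bar>F y - F x - inner_Rn m (a x) (\<lambda>i. f y i - f x i)\<bar> \<le> 2 ^ m * (M * (real m + 2)\<^sup>2 * (t x y)\<^sup>2)"
    using sum_abs[of E "Pow {..<m}"] unfolding card_Pow[OF finite_lessThan] card_lessThan of_nat_power of_nat_numeral by linarith
  also have "\<dots> = K * (dist x y)\<^sup>2" unfolding K_def t_def power_mult_distrib by simp
  finally show ?thesis .
qed

lemma abs_F_diff_le: "\<bar>F x - h x\<bar> \<le> L * C * R"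
proof -
  have "F x - h x = (\<Sum>\<epsilon>\<in>Pow {..<m}. weight \<epsilon> x * (val \<epsilon> x - h x))"
    by (simp add: F_def right_diff_distrib sum_subtractf sum_weight flip: sum_distrib_right)
  also have "\<bar>\<dots>\<bar> \<le> (\<Sum>\<epsilon>\<in>Pow {..<m}. weight \<epsilon> x * (L * C * R))"
    by (rule order_trans[OF sum_abs])
      (auto simp: abs_mult weight_nonneg intro!: sum_mono mult_left_mono abs_val_diff_le)
  also have "\<dots> = L * C * R" by (simp add: sum_weight flip: sum_distrib_right)
  finally show ?thesis .
qed

definition "B = 2 ^ m * (4 * (real m + 1) * L * C)"

lemma B: "0 \<le> B" using L C by (simp add: B_def)

lemma abs_a_le: "\<bar>a x i\<bar> \<le> B"
proof -
  have "\<bar>a x i\<bar> \<le> (\<Sum>\<epsilon>\<in>Pow {..<m}. \<bar>grad \<epsilon> x i * (val \<epsilon> x - h x)\<bar>)"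
    unfolding a_def by (rule sum_abs)
  also have "\<dots> \<le> real (card (Pow {..<m})) * (1 / \<delta> * (L * C * R))"
    unfolding abs_mult using \<delta>
    by (intro sum_bounded_above mult_mono abs_grad_le abs_val_diff_le) auto
  also have "\<dots> = B" using \<delta> by (simp add: card_Pow B_def R_def)
  finally show ?thesis .
qed

lemma abs_inner_a_le: "\<bar>inner_Rn m (a x) (\<lambda>i. f y i - f x i)\<bar> \<le> real m * B * C * dist x y"
proof -
  have "\<bar>inner_Rn m (a x) (\<lambda>i. f y i - f x i)\<bar> \<le> (\<Sum>i<m. \<bar>a x i * (f y i - f x i)\<bar>)"
    unfolding inner_Rn_def by (rule sum_abs)
  also have "\<dots> \<le> real (card {..<m}) * (B * (C * dist x y))"
    unfolding abs_mult using B by (intro sum_bounded_above mult_mono abs_a_le abs_f_diff_le) auto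
  finally show ?thesis by (simp add: mult_ac)
qed

text \<open>The second summand is \<open>K * R\<close>, written out to show that \<open>\<delta>\<close> cancels.\<close>

definition "L' = real m * B * C + 2 ^ m * 64 * (L * (C + 1) * C\<^sup>2 * (real m + 1)\<^sup>2 * (real m + 2)\<^sup>2) + 2 * L * C + L + B"

lemma L': "0 \<le> L'" "B \<le> L'" using B C L by (auto simp: L'_def)

lemma F_lipschitz: "L'-lipschitz_on UNIV F"
proof (rule lipschitz_onI)
  fix x y
  have nn: "0 \<le> real m * B * C" "0 \<le> 2 ^ m * 64 * (L * (C + 1) * C\<^sup>2 * (real m + 1)\<^sup>2 * (real m + 2)\<^sup>2)"
    "0 \<le> 2 * L * C + L"
    using B C L by auto
  have "\<bar>F y - F x\<bar> \<le> L' * dist x y"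
  proof (cases "dist x y \<le> R")
    case True
    have KR: "K * R = 2 ^ m * 64 * (L * (C + 1) * C\<^sup>2 * (real m + 1)\<^sup>2 * (real m + 2)\<^sup>2)"
    proof -
      have "K * R = 2 ^ m * (L * (C + 1) * (real m + 2)\<^sup>2) * (2 * C * (R / \<delta>))\<^sup>2"
        by (simp add: K_def M_def power2_eq_square)
      also have "R / \<delta> = 4 * (real m + 1)" using \<delta> by (simp add: R_def)
      finally show ?thesis by (simp only: power_mult_distrib) simp
    qed
    have "K * (dist x y)\<^sup>2 \<le> K * R * dist x y"
      using True K by (simp add: power2_eq_square mult_left_mono mult_right_mono flip: mult.assoc)
    then have "\<bar>F y - F x\<bar> \<le> (real m * B * C + K * R) * dist x y"
      using jet_local[OF True] abs_inner_a_le[of x y] unfolding distrib_right by linarith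
    also have "\<dots> \<le> L' * dist x y"
      using nn B unfolding L'_def KR by (intro mult_right_mono) auto
    finally show ?thesis .
  next
    case False
    have "L * C * R \<le> L * C * dist x y" using False L C by (intro mult_left_mono) auto
    then have "\<bar>F y - F x\<bar> \<le> (2 * L * C + L) * dist x y"
      using abs_F_diff_le[of x] abs_F_diff_le[of y] abs_h_diff_le[of y x] unfolding distrib_right by linarith
    also have "\<dots> \<le> L' * dist x y"
      using nn B unfolding L'_def by (intro mult_right_mono) auto
    finally show ?thesis .
  qed
  then show "dist (F x) (F y) \<le> L' * dist x y" by (simp add: dist_real_def abs_minus_commute)
qed (rule L')

lemma jet: "\<exists>K\<ge>0. \<forall>x y. \<bar>F y - F x - inner_Rn m (a x) (\<lambda>i. f y i - f x i)\<bar> \<le> K * (dist x y)\<^sup>2"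
proof (intro exI[of _ "K + (L' + real m * B * C) / R"] conjI allI)
  have nn: "0 \<le> (L' + real m * B * C) / R" using L' B C R by auto
  then show "0 \<le> K + (L' + real m * B * C) / R" using K by simp
  fix x y
  show "\<bar>F y - F x - inner_Rn m (a x) (\<lambda>i. f y i - f x i)\<bar> \<le> (K + (L' + real m * B * C) / R) * (dist x y)\<^sup>2"
  proof (cases "dist x y \<le> R")
    case True
    then show ?thesis using jet_local[OF True] mult_nonneg_nonneg[OF nn zero_le_power2[of "dist x y"]]
      unfolding distrib_right by linarith
  next
    case False
    have "\<bar>F y - F x\<bar> \<le> L' * dist x y"
      using lipschitz_onD[OF F_lipschitz, of y x] by (simp add: dist_real_def dist_commute)
    then have "\<bar>F y - F x - inner_Rn m (a x) (\<lambda>i. f y i - f x i)\<bar> \<le> (L' + real m * B * C) * dist x y"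
      using abs_inner_a_le[of x y] unfolding distrib_right by linarith
    also have "\<dots> = (L' + real m * B * C) / R * (R * dist x y)" using R by simp
    also have "\<dots> \<le> (L' + real m * B * C) / R * (dist x y)\<^sup>2"
      using False nn unfolding power2_eq_square by (intro mult_left_mono mult_right_mono) auto
    also have "\<dots> \<le> (K + (L' + real m * B * C) / R) * (dist x y)\<^sup>2"
      using K by (intro mult_right_mono) auto
    finally show ?thesis .
  qed
qed

lemma f_continuous: "i < m \<Longrightarrow> continuous_on UNIV (\<lambda>x. f x i)"
  by (rule lipschitz_on_continuous_on[OF f_lipschitz])

lemma grad_continuous:
  assumes "i < m" shows "isCont (\<lambda>x. grad \<epsilon> x i) x"
proof -
  have "isCont (\<lambda>x. f x j) x" if "j < m" for j
    using f_continuous[OF that] by (simp add: continuous_on_eq_continuous_at)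
  then show ?thesis using assms \<delta> unfolding grad_def bump_def bump'_def
    by (intro continuous_intros) auto
qed

text \<open>The jumps of \<open>val\<close> occur only where \<open>grad\<close> vanishes.\<close>

lemma a_continuous:
  assumes "i < m" shows "continuous_on UNIV (\<lambda>x. a x i)"
proof -
  have "isCont (\<lambda>x. grad \<epsilon> x i * (val \<epsilon> x - h x)) x" for \<epsilon> x
  proof -
    define G where "G y = grad \<epsilon> y i * (val \<epsilon> x - h y)" for y
    have h: "isCont h x"
      using lipschitz_on_continuous_on[OF h_lipschitz] by (simp add: continuous_on_eq_continuous_at)
    have "isCont G x" unfolding G_def by (intro continuous_intros grad_continuous assms h)
    then have "((\<lambda>y. \<bar>G y - G x\<bar> + 2 * (t x y / \<delta> * (L * C * R))) \<longlongrightarrow> \<bar>G x - G x\<bar> + 2 * (t x x / \<delta> * (L * C * R))) (at x)"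
      unfolding t_def isCont_def using \<delta> by (intro tendsto_intros) auto
    then have lim: "((\<lambda>y. \<bar>G y - G x\<bar> + 2 * (t x y / \<delta> * (L * C * R))) \<longlongrightarrow> 0) (at x)"
      by (simp add: t_def)
    have LCR: "0 \<le> L * C * R" using L C R by simp
    have "\<forall>\<^sub>F y in at x. dist y x \<le> R"
      using R unfolding eventually_at by (intro exI[of _ R]) auto
    then have bound: "\<forall>\<^sub>F y in at x. norm (grad \<epsilon> y i * (val \<epsilon> y - h y) - grad \<epsilon> x i * (val \<epsilon> x - h x))
        \<le> \<bar>G y - G x\<bar> + 2 * (t x y / \<delta> * (L * C * R))"
    proof eventually_elim
      case (elim y)
      show ?case
      proof (cases "same_cell \<epsilon> x y")
        case True
        have "val \<epsilon> x = val \<epsilon> y" using val_eq[OF True] elim by (simp add: dist_commute)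
        moreover have "0 \<le> t x y / \<delta> * (L * C * R)" using LCR t_nonneg \<delta> by simp
        ultimately show ?thesis unfolding G_def real_norm_def by simp
      next
        case False
        have "t y x = t x y" by (simp add: t_def dist_commute)
        then have "\<bar>grad \<epsilon> y i\<bar> \<le> t x y / \<delta>" "\<bar>grad \<epsilon> x i\<bar> \<le> t x y / \<delta>"
          using other_cell(2)[of \<epsilon> y x i] other_cell(2)[OF False] False same_cell_sym by auto
        then have "\<bar>grad \<epsilon> y i * (val \<epsilon> y - h y)\<bar> \<le> t x y / \<delta> * (L * C * R)"
          "\<bar>grad \<epsilon> x i * (val \<epsilon> x - h x)\<bar> \<le> t x y / \<delta> * (L * C * R)"
          unfolding abs_mult using t_nonneg[of x y] \<delta>
          by (intro mult_mono abs_val_diff_le; simp)+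
        then show ?thesis unfolding real_norm_def by linarith
      qed
    qed
    show ?thesis unfolding isCont_def
      by (rule LIM_zero_cancel[OF Lim_null_comparison[OF bound lim]])
  qed
  then show ?thesis unfolding a_def continuous_on_eq_continuous_at[OF open_UNIV]
    by (intro ballI continuous_sum)
qed

lemma in_jet_approximations:
  assumes "L * C * R \<le> \<eta>"
  shows "(F, a) \<in> jet_approximations m f h L' \<eta>"
  unfolding jet_approximations_def mem_Collect_eq case_prod_conv
proof (intro conjI allI impI)
  show "\<bar>F x - h x\<bar> \<le> \<eta>" for x using abs_F_diff_le[of x] assms by linarith
  show "\<bar>a x i\<bar> \<le> L'" for x i using abs_a_le[of x i] L' by linarith
qed (use F_lipschitz jet a_continuous in auto)

end

lemma jet_approximations_nonempty:
  assumes "chain_light C m f" "L-lipschitz_on UNIV h"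
  shows "\<exists>L'\<ge>0. \<forall>\<eta>>0. jet_approximations m f h L' \<eta> \<noteq> {}"
proof -
  have C: "0 < C" using assms by (simp add: chain_light_def)
  have L: "0 \<le> L" using assms(2) lipschitz_on_nonneg by blast
  have grid: "light_grid C m f h L \<delta>" if "0 < \<delta>" for \<delta>
    using assms that by unfold_locales
  have "jet_approximations m f h (light_grid.L' C m L) \<eta> \<noteq> {}" if "\<eta> > 0" for \<eta>
  proof -
    define \<delta> where "\<delta> = \<eta> / (4 * (real m + 1) * (L * C + 1))"
    have "0 < \<delta>" using that C L by (simp add: \<delta>_def add_nonneg_pos)
    interpret light_grid C m f h L \<delta> using grid[OF \<open>0 < \<delta>\<close>] .
    have "(L * C + 1) * R = \<eta>"
    proof -
      have "L * C + 1 \<noteq> 0" using C L by (simp add: add_nonneg_pos less_imp_neq[symmetric])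
      moreover have "4 * (real m + 1) \<noteq> 0" using of_nat_0_le_iff[of m, where 'a = real] by auto
      ultimately have "4 * (real m + 1) * (L * C + 1) \<noteq> 0" by (metis mult_eq_0_iff)
      then have "4 * (real m + 1) * (L * C + 1) * \<delta> = \<eta>" unfolding \<delta>_def by (rule nonzero_mult_div_cancel_left[THEN trans[OF times_divide_eq_right]])
      then show ?thesis by (simp add: R_def mult_ac)
    qed
    then have "L * C * R \<le> \<eta>" using R by (simp add: algebra_simps)
    from in_jet_approximations[OF this] show ?thesis by blast
  qed
  moreover have "0 \<le> light_grid.L' C m L"
    using light_grid.L'(1)[OF grid[of 1]] by simp
  ultimately show ?thesis by blast
qed

section \<open>Approximations with strongly convergent derivatives\<close>

lemma jet_approximations_mono:
  assumes "\<eta> \<le> \<eta>'" shows "jet_approximations m f h L \<eta> \<subseteq> jet_approximations m f h L \<eta>'"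
  using order_trans[OF _ assms] by (auto simp: jet_approximations_def)

lemma jet_approximations_midpoint:
  fixes f :: "'a::metric_space \<Rightarrow> nat \<Rightarrow> real"
  assumes "(F, a) \<in> jet_approximations m f h L \<eta>" "(G, b) \<in> jet_approximations m f h L \<eta>"
  shows "(\<lambda>x. (F x + G x) / 2, \<lambda>x i. (a x i + b x i) / 2) \<in> jet_approximations m f h L \<eta>"
  unfolding jet_approximations_def mem_Collect_eq case_prod_conv
proof (intro conjI allI impI)
  note F = assms(1)[unfolded jet_approximations_def mem_Collect_eq case_prod_conv]
  note G = assms(2)[unfolded jet_approximations_def mem_Collect_eq case_prod_conv]
  show "\<bar>(F x + G x) / 2 - h x\<bar> \<le> \<eta>" for x
  proof -
    have "\<bar>F x - h x\<bar> \<le> \<eta>" "\<bar>G x - h x\<bar> \<le> \<eta>" using F G by auto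
    then show ?thesis by (auto simp: abs_le_iff field_simps)
  qed
  show "L-lipschitz_on UNIV (\<lambda>x. (F x + G x) / 2)"
  proof (rule lipschitz_onI)
    fix x y
    have "\<bar>F x - F y\<bar> \<le> L * dist x y" "\<bar>G x - G y\<bar> \<le> L * dist x y"
      using F G by (auto simp: lipschitz_on_def dist_real_def)
    then show "dist ((F x + G x) / 2) ((F y + G y) / 2) \<le> L * dist x y"
      by (auto simp: dist_real_def abs_le_iff field_simps)
  qed (use F in \<open>auto simp: lipschitz_on_def\<close>)
  show "continuous_on UNIV (\<lambda>x. (a x i + b x i) / 2)" if "i < m" for i
    using F G that by (intro continuous_intros) auto
  show "\<bar>(a x i + b x i) / 2\<bar> \<le> L" if "i < m" for x i
  proof -
    have "\<bar>a x i\<bar> \<le> L" "\<bar>b x i\<bar> \<le> L" using F G that by auto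
    then show ?thesis by (auto simp: abs_le_iff field_simps)
  qed
  obtain K1 where K1: "K1 \<ge> 0"
    "\<forall>x y. \<bar>F y - F x - inner_Rn m (a x) (\<lambda>i. f y i - f x i)\<bar> \<le> K1 * (dist x y)\<^sup>2"
    using F by (elim conjE exE) (rule that)
  obtain K2 where K2: "K2 \<ge> 0"
    "\<forall>x y. \<bar>G y - G x - inner_Rn m (b x) (\<lambda>i. f y i - f x i)\<bar> \<le> K2 * (dist x y)\<^sup>2"
    using G by (elim conjE exE) (rule that)
  have inner: "inner_Rn m (\<lambda>i. (a x i + b x i) / 2) v = (inner_Rn m (a x) v + inner_Rn m (b x) v) / 2" for x v
    by (simp add: inner_Rn_def algebra_simps sum.distrib sum_divide_distrib add_divide_distrib)
  show "\<exists>K\<ge>0. \<forall>x y. \<bar>(F y + G y) / 2 - (F x + G x) / 2 - inner_Rn m (\<lambda>i. (a x i + b x i) / 2) (\<lambda>i. f y i - f x i)\<bar> \<le> K * (dist x y)\<^sup>2"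
  proof (intro exI[of _ "K1 + K2"] conjI allI)
    fix x y :: 'a
    define u where "u = F y - F x - inner_Rn m (a x) (\<lambda>i. f y i - f x i)"
    define v where "v = G y - G x - inner_Rn m (b x) (\<lambda>i. f y i - f x i)"
    have "\<bar>u\<bar> \<le> K1 * (dist x y)\<^sup>2" "\<bar>v\<bar> \<le> K2 * (dist x y)\<^sup>2" using K1 K2 by (auto simp: u_def v_def)
    then have "\<bar>(u + v) / 2\<bar> \<le> (K1 + K2) * (dist x y)\<^sup>2" by (simp add: distrib_right)
    also have "(u + v) / 2 = (F y + G y) / 2 - (F x + G x) / 2 -
        inner_Rn m (\<lambda>i. (a x i + b x i) / 2) (\<lambda>i. f y i - f x i)"
      unfolding inner u_def v_def by (simp add: field_simps)
    finally show "\<bar>(F y + G y) / 2 - (F x + G x) / 2 - inner_Rn m (\<lambda>i. (a x i + b x i) / 2) (\<lambda>i. f y i - f x i)\<bar>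
        \<le> (K1 + K2) * (dist x y)\<^sup>2" .
  qed (use K1 K2 in auto)
qed

definition energy :: "'a measure \<Rightarrow> nat \<Rightarrow> ('a \<Rightarrow> nat \<Rightarrow> real) \<Rightarrow> real" where
  "energy M m a = (\<integral>x. (\<Sum>i<m. (a x i)\<^sup>2) \<partial>M)"

lemma integrable_bounded_continuous:
  fixes g :: "'a::metric_space \<Rightarrow> real"
  assumes "sets M = sets borel" "finite_measure M" "continuous_on UNIV g" "\<And>x. \<bar>g x\<bar> \<le> B"
  shows "integrable M g"
proof (rule finite_measure.integrable_const_bound[OF assms(2)])
  show "AE x in M. norm (g x) \<le> B" using assms(4) by simp
  have "g \<in> borel_measurable borel" by (rule borel_measurable_continuous_onI[OF assms(3)])
  then show "g \<in> borel_measurable M" using measurable_cong_sets[OF assms(1) refl] by blast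
qed

lemma integrable_sum_squares:
  fixes a :: "'a::metric_space \<Rightarrow> nat \<Rightarrow> real"
  assumes M: "sets M = sets borel" "finite_measure M"
    and a: "\<forall>i<m. continuous_on UNIV (\<lambda>x. a x i) \<and> (\<forall>x. \<bar>a x i\<bar> \<le> B)"
  shows "integrable M (\<lambda>x. \<Sum>i<m. (a x i)\<^sup>2)"
proof (rule integrable_bounded_continuous[OF M])
  show "continuous_on UNIV (\<lambda>x. \<Sum>i<m. (a x i)\<^sup>2)"
    using a by (intro continuous_intros) auto
  have "(a x i)\<^sup>2 \<le> B\<^sup>2" if "i < m" for x i
    using a that power_mono[of "\<bar>a x i\<bar>" B 2] by auto
  then have "(\<Sum>i<m. (a x i)\<^sup>2) \<le> real (card {..<m}) * B\<^sup>2" for x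
    by (intro sum_bounded_above) auto
  then show "\<bar>\<Sum>i<m. (a x i)\<^sup>2\<bar> \<le> real (card {..<m}) * B\<^sup>2" for x
    by (simp add: sum_nonneg)
qed

lemma energy_parallelogram:
  fixes a b :: "'a::metric_space \<Rightarrow> nat \<Rightarrow> real"
  assumes M: "sets M = sets borel" "finite_measure M"
    and a: "\<forall>i<m. continuous_on UNIV (\<lambda>x. a x i) \<and> (\<forall>x. \<bar>a x i\<bar> \<le> B)"
    and b: "\<forall>i<m. continuous_on UNIV (\<lambda>x. b x i) \<and> (\<forall>x. \<bar>b x i\<bar> \<le> B)"
  shows "energy M m (\<lambda>x i. a x i - b x i) =
    2 * energy M m a + 2 * energy M m b - 4 * energy M m (\<lambda>x i. (a x i + b x i) / 2)"
proof -
  have mid: "\<forall>i<m. continuous_on UNIV (\<lambda>x. (a x i + b x i) / 2) \<and> (\<forall>x. \<bar>(a x i + b x i) / 2\<bar> \<le> B)"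
  proof (intro allI impI conjI)
    fix i assume "i < m"
    then show "continuous_on UNIV (\<lambda>x. (a x i + b x i) / 2)" using a b by (intro continuous_intros) auto
    fix x
    have "\<bar>a x i\<bar> \<le> B" "\<bar>b x i\<bar> \<le> B" using a b \<open>i < m\<close> by auto
    then show "\<bar>(a x i + b x i) / 2\<bar> \<le> B" by (auto simp: abs_le_iff field_simps)
  qed
  have eq: "(\<Sum>i<m. (a x i - b x i)\<^sup>2) = 2 * (\<Sum>i<m. (a x i)\<^sup>2) + 2 * (\<Sum>i<m. (b x i)\<^sup>2)
      - 4 * (\<Sum>i<m. ((a x i + b x i) / 2)\<^sup>2)" for x
  proof -
    have "(\<Sum>i<m. (a x i - b x i)\<^sup>2) =
        (\<Sum>i<m. 2 * (a x i)\<^sup>2 + 2 * (b x i)\<^sup>2 - 4 * ((a x i + b x i) / 2)\<^sup>2)"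
      by (intro sum.cong refl) (simp add: power2_eq_square field_simps)
    then show ?thesis by (simp add: sum.distrib sum_subtractf sum_distrib_left)
  qed
  show ?thesis unfolding energy_def eq
    using integrable_sum_squares[OF M a] integrable_sum_squares[OF M b] integrable_sum_squares[OF M mid]
    by simp
qed

text \<open>
  Let \<open>I k\<close> be the infimum of the energy over approximations of accuracy \<open>(1/2)^k\<close>. It increases
  to a finite limit. For two nearly minimal approximations the midpoint has energy at least the
  infimum at a coarser level, so by the parallelogram law their difference has small energy.
\<close>

lemma strongly_convergent_jets:
  fixes M :: "'a::metric_space measure"
  assumes M: "sets M = sets borel" "finite_measure M"
    and ne: "\<forall>\<eta>>0. jet_approximations m f h L \<eta> \<noteq> {}"
  shows "\<exists>F a. (\<forall>k. (F k, a k) \<in> jet_approximations m f h L ((1/2)^k)) \<and>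
    (\<forall>e>0. \<exists>N. \<forall>k\<ge>N. \<forall>l\<ge>N. energy M m (\<lambda>x i. a k x i - a l x i) \<le> e)"
proof -
  define J where "J k = jet_approximations m f h L ((1/2)^k)" for k :: nat
  define E where "E = energy M m"
  have bd: "\<forall>i<m. continuous_on UNIV (\<lambda>x. a x i) \<and> (\<forall>x. \<bar>a x i\<bar> \<le> L)" if "(F, a) \<in> J k" for F a k
    using that by (auto simp: J_def jet_approximations_def)
  have J_ne: "J k \<noteq> {}" for k unfolding J_def using ne by simp
  have J_anti: "J l \<subseteq> J k" if "k \<le> l" for k l
    unfolding J_def by (intro jet_approximations_mono power_decreasing) (use that in auto)
  have E_nonneg: "0 \<le> E a" for a unfolding E_def energy_def by (intro Bochner_Integration.integral_nonneg sum_nonneg) auto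
  define B where "B = real m * L\<^sup>2 * measure M (space M)"
  have E_le: "E a \<le> B" if "(F, a) \<in> J k" for F a k
  proof -
    have "(a x i)\<^sup>2 \<le> L\<^sup>2" if "i < m" for x i
      using bd[OF \<open>(F, a) \<in> J k\<close>] that power_mono[of "\<bar>a x i\<bar>" L 2] by auto
    then have "(\<Sum>i<m. (a x i)\<^sup>2) \<le> real (card {..<m}) * L\<^sup>2" for x
      by (intro sum_bounded_above) auto
    then have "E a \<le> (\<integral>x. real (card {..<m}) * L\<^sup>2 \<partial>M)"
      unfolding E_def energy_def using integrable_sum_squares[OF M bd[OF that]] M(2)
      by (intro integral_mono) (auto simp: finite_measure.integrable_const)
    then show ?thesis using M(2) by (simp add: B_def finite_measure.finite_emeasure_space mult_ac)
  qed
  define I where "I k = (INF p\<in>J k. E (snd p))" for k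
  have bdd: "bdd_below ((\<lambda>p. E (snd p)) ` S)" for S
    by (rule bdd_belowI2[of _ 0]) (rule E_nonneg)
  have I_le: "I k \<le> E a" if "(F, a) \<in> J k" for F a k
    unfolding I_def using cINF_lower[OF bdd that] by simp
  have I_mono: "I k \<le> I l" if "k \<le> l" for k l
    unfolding I_def by (rule cINF_superset_mono[OF J_ne bdd J_anti[OF that]]) simp
  have I_le_B: "I k \<le> B" for k
  proof -
    obtain F a where "(F, a) \<in> J k" using J_ne[of k] by auto
    then show ?thesis using I_le E_le by fastforce
  qed
  have "\<exists>p\<in>J k. E (snd p) < I k + (1/2)^k" for k
    using cINF_less_iff[OF J_ne bdd, of k "I k + (1/2)^k"] unfolding I_def by auto
  then obtain p where p: "\<And>k. p k \<in> J k" "\<And>k. E (snd (p k)) < I k + (1/2)^k" by metis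
  define F where "F k = fst (p k)" for k
  define a where "a k = snd (p k)" for k
  have Fa: "(F k, a k) \<in> J k" "E (a k) < I k + (1/2)^k" for k
    using p by (auto simp: F_def a_def)
  have "incseq I" using I_mono by (auto simp: incseq_def)
  then obtain \<Lambda> where \<Lambda>: "I \<longlonglongrightarrow> \<Lambda>" "\<And>k. I k \<le> \<Lambda>"
    using incseq_convergent[of I B] I_le_B by blast
  have "\<exists>N. \<forall>k\<ge>N. \<forall>l\<ge>N. E (\<lambda>x i. a k x i - a l x i) \<le> e" if "e > 0" for e
  proof -
    have "e / 8 > 0" using that by simp
    have "\<forall>\<^sub>F k in sequentially. \<Lambda> - e / 8 < I k"
      using \<open>e / 8 > 0\<close> by (intro order_tendstoD(1)[OF \<Lambda>(1)]) simp
    moreover have "(\<lambda>k. (1/2::real)^k) \<longlonglongrightarrow> 0" by (simp add: LIMSEQ_realpow_zero)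
    then have "\<forall>\<^sub>F k in sequentially. (1/2::real)^k < e / 8"
      using \<open>e / 8 > 0\<close> by (rule order_tendstoD(2))
    ultimately have "\<forall>\<^sub>F k in sequentially. \<Lambda> - e / 8 < I k \<and> (1/2)^k < e / 8"
      by (rule eventually_conj)
    then obtain N where N: "\<And>k. N \<le> k \<Longrightarrow> \<Lambda> - e / 8 < I k \<and> (1/2)^k < e / 8"
      unfolding eventually_sequentially by blast
    have "E (\<lambda>x i. a k x i - a l x i) \<le> e" if "N \<le> k" "N \<le> l" for k l
    proof -
      have "(F k, a k) \<in> J N" "(F l, a l) \<in> J N"
        using subsetD[OF J_anti Fa(1)] that by auto
      then have "(\<lambda>x. (F k x + F l x) / 2, \<lambda>x i. (a k x i + a l x i) / 2) \<in> J N"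
        unfolding J_def by (rule jet_approximations_midpoint)
      then have "I N \<le> E (\<lambda>x i. (a k x i + a l x i) / 2)" by (rule I_le)
      moreover have "E (\<lambda>x i. a k x i - a l x i) =
          2 * E (a k) + 2 * E (a l) - 4 * E (\<lambda>x i. (a k x i + a l x i) / 2)"
        unfolding E_def by (rule energy_parallelogram[OF M bd[OF Fa(1)] bd[OF Fa(1)]])
      ultimately show ?thesis
        using Fa(2)[of k] Fa(2)[of l] N[OF that(1)] N[OF that(2)] N[of N] \<Lambda>(2)[of k] \<Lambda>(2)[of l] by linarith
    qed
    then show ?thesis by blast
  qed
  then have Cauchy: "\<forall>e>0. \<exists>N. \<forall>k\<ge>N. \<forall>l\<ge>N. energy M m (\<lambda>x i. a k x i - a l x i) \<le> e"
    unfolding E_def by simp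
  have jets: "\<forall>k. (F k, a k) \<in> jet_approximations m f h L ((1/2)^k)"
    using Fa(1) by (simp add: J_def)
  show ?thesis
    by (rule exI[of _ F], rule exI[of _ a], rule conjI) (rule jets, rule Cauchy)
qed

section \<open>The alternating series\<close>

lemma abs_add_diff_le:
  fixes a b c :: real
  assumes "\<bar>a\<bar> \<le> p" "\<bar>b\<bar> \<le> q" "\<bar>c\<bar> \<le> s"
  shows "\<bar>a + b - c\<bar> \<le> p + q + s"
  using assms by linarith

text \<open>McShane's extension by an infimum of cones.\<close>

lemma lipschitz_extension:
  fixes T :: "'a::metric_space \<Rightarrow> real"
  assumes "A \<noteq> {}" "0 \<le> \<Lambda>" and T: "\<And>x y. x \<in> A \<Longrightarrow> y \<in> A \<Longrightarrow> \<bar>T x - T y\<bar> \<le> \<Lambda> * dist x y"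
  shows "\<exists>S. \<Lambda>-lipschitz_on UNIV S \<and> (\<forall>x\<in>A. S x = T x)"
proof -
  define S where "S y = (INF z\<in>A. T z + \<Lambda> * dist z y)" for y
  obtain z0 where z0: "z0 \<in> A" using assms by blast
  have tri: "\<Lambda> * dist z y \<le> \<Lambda> * dist z x + \<Lambda> * dist x y" for x y z
    using mult_left_mono[OF dist_triangle \<open>0 \<le> \<Lambda>\<close>, of z y x] by (simp add: distrib_left)
  have bdd: "bdd_below ((\<lambda>z. T z + \<Lambda> * dist z y) ` A)" for y
  proof (rule bdd_belowI2)
    fix z assume "z \<in> A"
    then show "T z0 - \<Lambda> * dist z0 y \<le> T z + \<Lambda> * dist z y"
      using T[OF z0 \<open>z \<in> A\<close>] tri[of z0 z y] dist_commute[of y z] by simp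
  qed
  have S_le: "S y \<le> T z + \<Lambda> * dist z y" if "z \<in> A" for z y
    unfolding S_def by (rule cINF_lower[OF bdd that])
  have half: "S y - S x \<le> \<Lambda> * dist x y" for x y
  proof -
    have "S y - \<Lambda> * dist x y \<le> S x"
      unfolding S_def[of x]
    proof (rule cINF_greatest[OF \<open>A \<noteq> {}\<close>])
      fix z assume "z \<in> A"
      then show "S y - \<Lambda> * dist x y \<le> T z + \<Lambda> * dist z x" using S_le[of z y] tri[of z y x] by linarith
    qed
    then show ?thesis by linarith
  qed
  have lip: "\<Lambda>-lipschitz_on UNIV S"
  proof (rule lipschitz_onI)
    fix x y show "dist (S x) (S y) \<le> \<Lambda> * dist x y"
      using half[of x y] half[of y x] by (simp add: dist_real_def dist_commute abs_le_iff)
  qed fact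
  have eq: "S x = T x" if "x \<in> A" for x
  proof (rule antisym)
    show "S x \<le> T x" using S_le[OF that, of x] by simp
    show "T x \<le> S x" unfolding S_def
    proof (rule cINF_greatest[OF \<open>A \<noteq> {}\<close>])
      fix z assume "z \<in> A"
      then show "T x \<le> T z + \<Lambda> * dist z x" using T[OF that \<open>z \<in> A\<close>] by (simp add: dist_commute)
    qed
  qed
  show ?thesis
  proof (rule exI[of _ S], rule conjI)
    show "\<forall>x\<in>A. S x = T x" using eq by blast
  qed (rule lip)
qed

text \<open>
  The distances between \<open>\<sigma> j\<close> and \<open>r j\<close> form the range that belongs to \<open>j\<close>. There the quadratic
  errors of \<open>G 0, \<dots>, G j\<close> are small because \<open>r j\<close> is small compared with the inverses of their
  constants, and \<open>G (Suc j) - h\<close> is small because it is chosen after \<open>\<sigma> j\<close>.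
\<close>

locale alternating_series =
  fixes C :: real and m :: nat and f :: "'a::metric_space \<Rightarrow> nat \<Rightarrow> real"
    and h :: "'a \<Rightarrow> real" and L :: real
    and G :: "nat \<Rightarrow> 'a \<Rightarrow> real" and \<alpha> :: "nat \<Rightarrow> 'a \<Rightarrow> nat \<Rightarrow> real" and K \<sigma> r :: "nat \<Rightarrow> real"
  assumes C: "0 \<le> C" and f_lipschitz: "\<forall>i<m. C-lipschitz_on UNIV (\<lambda>x. f x i)"
    and h_lipschitz: "L-lipschitz_on UNIV h"
    and \<sigma>: "0 < \<sigma> j" "\<sigma> j < r j" and r_Suc: "r (Suc j) \<le> \<sigma> j / 2" and r_0: "r 0 \<le> 1"
    and G_0: "\<bar>G 0 x - h x\<bar> \<le> 1" and G_Suc: "\<bar>G (Suc j) x - h x\<bar> \<le> (1/2)^Suc j * \<sigma> j"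
    and G_lipschitz: "L-lipschitz_on UNIV (G j)"
    and K: "0 \<le> K j" and Kr: "i \<le> j \<Longrightarrow> K i * r j \<le> (1/4)^j"
    and jet: "\<bar>G j y - G j x - inner_Rn m (\<alpha> j x) (\<lambda>i. f y i - f x i)\<bar> \<le> K j * (dist x y)\<^sup>2"
    and \<alpha>_bound: "i < m \<Longrightarrow> \<bar>\<alpha> j x i\<bar> \<le> L"
begin

definition H :: "nat \<Rightarrow> 'a \<Rightarrow> real" where "H j x = (-1)^j * (G j x - h x)"

definition T :: "'a \<Rightarrow> real" where "T x = (\<Sum>j. H j x)"

definition S :: "nat \<Rightarrow> 'a \<Rightarrow> real" where "S j x = (\<Sum>i<Suc j. H i x)"

definition \<beta> :: "nat \<Rightarrow> 'a \<Rightarrow> nat \<Rightarrow> real" where "\<beta> j x i = (\<Sum>l<Suc j. (-1)^l * \<alpha> l x i)"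

text \<open>
  At such points the gradients \<open>\<alpha> j\<close> converge geometrically, and the alternating sums \<open>\<beta> j\<close> stay
  bounded and have a limit along each parity.
\<close>

definition regular :: "real \<Rightarrow> 'a \<Rightarrow> bool" where
  "regular c x \<longleftrightarrow> (\<forall>j. \<forall>i<m. \<bar>\<alpha> j x i - \<alpha> (Suc j) x i\<bar> \<le> c * (1/2)^j)"

lemma L: "0 \<le> L" using h_lipschitz lipschitz_on_nonneg by blast

lemma r_pos: "0 < r j" using \<sigma>(1)[of j] \<sigma>(2)[of j] by linarith

lemma \<sigma>_Suc_le: "\<sigma> (Suc j) \<le> \<sigma> j"
  using \<sigma>(2)[of "Suc j"] r_Suc[of j] \<sigma>(1)[of j] by linarith

lemma \<sigma>_antimono: "j \<le> k \<Longrightarrow> \<sigma> k \<le> \<sigma> j"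
  using decseqD[of \<sigma> j k] \<sigma>_Suc_le by (simp add: decseq_SucI)

lemma r_le: "r j \<le> (1/2)^j"
proof (induction j)
  case (Suc j)
  then show ?case using r_Suc[of j] \<sigma>(2)[of j] by simp
qed (use r_0 in simp)

lemma r_tendsto: "r \<longlonglongrightarrow> 0"
proof (rule tendsto_sandwich[OF _ _ tendsto_const])
  show "(\<lambda>j. (1/2::real)^j) \<longlonglongrightarrow> 0" by (simp add: LIMSEQ_realpow_zero)
qed (use r_pos r_le in \<open>auto intro!: always_eventually less_imp_le\<close>)

lemma abs_H_le: "\<bar>H (Suc (i + j)) x\<bar> \<le> (1/2)^Suc i * ((1/2)^j * \<sigma> j)"
proof -
  have "\<bar>H (Suc (i + j)) x\<bar> \<le> (1/2)^Suc (i + j) * \<sigma> (i + j)"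
    using G_Suc[of "i + j" x] by (simp add: H_def abs_mult power_abs)
  also have "\<dots> \<le> (1/2)^Suc (i + j) * \<sigma> j"
    by (intro mult_left_mono \<sigma>_antimono) auto
  finally show ?thesis by (simp add: power_add mult_ac)
qed

lemma summable_H: "summable (\<lambda>j. H j x)"
proof -
  have "summable (\<lambda>i. (1/2)^Suc i * ((1/2)^0 * \<sigma> 0))"
    by (intro summable_mult2) (simp add: summable_geometric)
  then have "summable (\<lambda>i. H (Suc i) x)"
    by (rule summable_comparison_test[rotated]) (use abs_H_le[of _ 0 x] in auto)
  then show ?thesis by (rule summable_Suc_iff[THEN iffD1])
qed

lemma tail: "\<bar>T x - S j x\<bar> \<le> (1/2)^j * \<sigma> j"
proof -
  have "T x = (\<Sum>i. H (i + Suc j) x) + S j x"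
    unfolding T_def S_def by (rule suminf_split_initial_segment[OF summable_H])
  then have "T x - S j x = (\<Sum>i. H (Suc (i + j)) x)" by simp
  moreover have geo: "(\<lambda>i. (1/2)^Suc i * ((1/2)^j * \<sigma> j)) sums (1 * ((1/2)^j * \<sigma> j))"
    by (intro sums_mult2 power_half_series)
  moreover have "norm (\<Sum>i. H (Suc (i + j)) x) \<le> (\<Sum>i. (1/2)^Suc i * ((1/2)^j * \<sigma> j))"
    using abs_H_le[of _ j x] sums_summable[OF geo] by (intro norm_suminf_le) (auto simp: mult.assoc)
  ultimately show ?thesis using sums_unique[OF geo] by simp
qed

lemma sum_alternating: "(\<Sum>l<Suc j. (-1)^l) = (if even j then 1 else 0 :: real)"
  by (induction j) auto

lemma abs_h_diff_le: "\<bar>h y - h x\<bar> \<le> L * dist x y"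
  using lipschitz_onD[OF h_lipschitz, of y x] by (simp add: dist_real_def dist_commute)

lemma abs_f_diff_le: "i < m \<Longrightarrow> \<bar>f y i - f x i\<bar> \<le> C * dist x y"
  using lipschitz_onD[OF f_lipschitz[rule_format], of i y x] by (simp add: dist_real_def dist_commute)

lemma abs_H_diff_le: "\<bar>H j y - H j x\<bar> \<le> 2 * L * dist x y"
proof -
  have "\<bar>H j y - H j x\<bar> = \<bar>(G j y - G j x) - (h y - h x)\<bar>"
    by (cases "even j") (auto simp: H_def)
  moreover have "\<bar>G j y - G j x\<bar> \<le> L * dist x y"
    using lipschitz_onD[OF G_lipschitz, of y x] by (simp add: dist_real_def dist_commute)
  ultimately show ?thesis using abs_h_diff_le[of y x] by linarith
qed

text \<open>
  The first-order part of the increments of the partial sum \<open>S j\<close>. The alternating signs leave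
  \<open>h\<close> with the coefficient \<open>-1\<close> or \<open>0\<close>, according to the parity of \<open>j\<close>.
\<close>

definition main_part :: "nat \<Rightarrow> 'a \<Rightarrow> 'a \<Rightarrow> real" where
  "main_part j x y = inner_Rn m (\<beta> j x) (\<lambda>i. f y i - f x i) - (if even j then h y - h x else 0)"

lemma partial_sum_jet:
  assumes "dist x y < r j"
  shows "\<bar>S j y - S j x - main_part j x y\<bar> \<le> (1/2)^j * dist x y"
proof -
  define e where "e l = (-1)^l * (G l y - G l x - inner_Rn m (\<alpha> l x) (\<lambda>i. f y i - f x i))" for l
  have inner: "inner_Rn m (\<beta> j x) v = (\<Sum>l<Suc j. (-1)^l * inner_Rn m (\<alpha> l x) v)" for v
    unfolding inner_Rn_def \<beta>_def sum_distrib_right sum_distrib_left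
    by (subst sum.swap) (simp add: mult_ac)
  have "S j y - S j x = (\<Sum>l<Suc j. (-1)^l * (G l y - G l x)) - (\<Sum>l<Suc j. (-1)^l) * (h y - h x)"
    unfolding S_def H_def sum_distrib_right by (simp only: sum_subtractf[symmetric]) (simp add: algebra_simps)
  moreover have "(\<Sum>l<Suc j. (-1)^l) * (h y - h x) = (if even j then h y - h x else 0)"
    unfolding sum_alternating by simp
  ultimately have "S j y - S j x - main_part j x y = (\<Sum>l<Suc j. e l)"
    unfolding main_part_def inner e_def by (simp only: right_diff_distrib sum_subtractf)
  also have "\<bar>\<dots>\<bar> \<le> (\<Sum>l<Suc j. \<bar>e l\<bar>)" by (rule sum_abs)
  also have "\<dots> \<le> real (card {..<Suc j}) * ((1/4)^j * dist x y)"
  proof (rule sum_bounded_above)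
    fix l assume l: "l \<in> {..<Suc j}"
    have "\<bar>e l\<bar> \<le> K l * (dist x y)\<^sup>2" using jet[of l y x] by (simp add: e_def abs_mult power_abs)
    also have "\<dots> \<le> K l * r j * dist x y"
      using assms K[of l] unfolding power2_eq_square mult.assoc
      by (intro mult_left_mono mult_right_mono) auto
    also have "\<dots> \<le> (1/4)^j * dist x y" using l by (intro mult_right_mono Kr) auto
    finally show "\<bar>e l\<bar> \<le> (1/4)^j * dist x y" .
  qed
  also have "\<dots> \<le> 2^j * ((1/4)^j * dist x y)"
  proof (intro mult_right_mono)
    have "real (Suc j) \<le> real (2 ^ j)" using less_exp[of j] by (intro of_nat_mono) (simp add: Suc_le_eq)
    then show "real (card {..<Suc j}) \<le> 2 ^ j" by simp
  qed simp
  also have "\<dots> = (1/2)^j * dist x y"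
  proof -
    have "(2::real)^j * (1/4)^j = (2 * (1/4))^j" by (rule power_mult_distrib[symmetric])
    then show ?thesis by (simp add: mult.assoc[symmetric])
  qed
  finally show ?thesis .
qed

lemma increment:
  assumes "y \<in> annulus x (\<sigma> j) (r j)"
  shows "\<bar>T y - T x - main_part j x y\<bar> \<le> 3 * (1/2)^j * dist x y"
proof -
  have \<sigma>d: "(1/2)^j * \<sigma> j \<le> (1/2)^j * dist x y"
    using assms by (intro mult_left_mono) (auto simp: annulus_def)
  have "T y - T x - main_part j x y = (S j y - S j x - main_part j x y) + (T y - S j y) - (T x - S j x)"
    by simp
  also have "\<bar>\<dots>\<bar> \<le> (1/2)^j * dist x y + (1/2)^j * \<sigma> j + (1/2)^j * \<sigma> j"
    using assms by (intro abs_add_diff_le tail partial_sum_jet) (auto simp: annulus_def)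
  finally show ?thesis using \<sigma>d unfolding mult.assoc by linarith
qed

text \<open>
  Pairing consecutive terms bounds an alternating sum by the variation of the sequence.
\<close>

lemma abs_\<beta>_le:
  assumes "regular c x" "i < m"
  shows "\<bar>\<beta> j x i\<bar> \<le> L + 2 * c"
proof -
  have step: "\<bar>\<alpha> l x i - \<alpha> (Suc l) x i\<bar> \<le> c * (1/2)^l" for l
    using assms by (simp add: regular_def)
  have c: "0 \<le> c" using step[of 0] by simp
  have "\<bar>\<beta> j x i\<bar> \<le> L + (\<Sum>l<j. c * (1/2)^l)"
  proof (induction j rule: induct_nat_012)
    case 0 then show ?case using \<alpha>_bound[OF assms(2)] by (simp add: \<beta>_def)
  next
    case 1 then show ?case using step[of 0] L by (simp add: \<beta>_def)
  next
    case (ge2 n)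
    have "\<bar>\<beta> (Suc (Suc n)) x i - \<beta> n x i\<bar> = \<bar>\<alpha> (Suc n) x i - \<alpha> (Suc (Suc n)) x i\<bar>"
      by (cases "even n") (auto simp: \<beta>_def)
    also have "\<dots> \<le> c * (1/2)^Suc n" by (rule step)
    also have "\<dots> \<le> c * (1/2)^n" using c by (intro mult_left_mono power_decreasing) auto
    finally have "\<bar>\<beta> (Suc (Suc n)) x i - \<beta> n x i\<bar> \<le> c * (1/2)^n" .
    moreover have "0 \<le> c * (1/2)^n" using c by simp
    ultimately show ?case using ge2(1) by simp
  qed
  also have "(\<Sum>l<j. c * (1/2)^l) \<le> c * 2"
  proof -
    have "(\<Sum>l<j. (1/2::real)^l) = 2 - 2 * (1/2)^j" by (induction j) auto
    then show ?thesis unfolding sum_distrib_left[symmetric] using c by (intro mult_left_mono) simp_all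
  qed
  finally show ?thesis by simp
qed

lemma \<beta>_convergent:
  assumes "regular c x" "i < m"
  shows "convergent (\<lambda>p. \<beta> (2 * p) x i)" "convergent (\<lambda>p. \<beta> (Suc (2 * p)) x i)"
proof -
  have step: "\<bar>\<alpha> l x i - \<alpha> (Suc l) x i\<bar> \<le> c * (1/2)^l" for l
    using assms by (simp add: regular_def)
  have c: "0 \<le> c" using step[of 0] by simp
  have summ: "summable (\<lambda>q. \<alpha> (2 * q + k) x i - \<alpha> (Suc (2 * q + k)) x i)" for k
  proof (rule summable_comparison_test)
    show "summable (\<lambda>q. c * (1/2::real)^q)" by (intro summable_mult) (simp add: summable_geometric)
    have "c * (1/2)^(2 * q + k) \<le> c * (1/2)^q" for q
      using c by (intro mult_left_mono power_decreasing) auto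
    then have "norm (\<alpha> (2 * q + k) x i - \<alpha> (Suc (2 * q + k)) x i) \<le> c * (1/2)^q" for q
      unfolding real_norm_def by (rule order_trans[OF step])
    then show "\<exists>N. \<forall>q\<ge>N. norm (\<alpha> (2 * q + k) x i - \<alpha> (Suc (2 * q + k)) x i) \<le> c * (1/2)^q"
      by simp
  qed
  have "\<beta> (2 * p) x i = \<alpha> 0 x i - (\<Sum>q<p. \<alpha> (2 * q + 1) x i - \<alpha> (Suc (2 * q + 1)) x i)" for p
    by (induction p) (auto simp: \<beta>_def)
  then show "convergent (\<lambda>p. \<beta> (2 * p) x i)"
    using summ[of 1] by (auto simp: summable_iff_convergent intro!: convergent_diff convergent_const)
  have "\<beta> (Suc (2 * p)) x i = (\<Sum>q<Suc p. \<alpha> (2 * q + 0) x i - \<alpha> (Suc (2 * q + 0)) x i)" for p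
    by (induction p) (auto simp: \<beta>_def)
  then show "convergent (\<lambda>p. \<beta> (Suc (2 * p)) x i)"
    using summ[of 0] unfolding summable_iff_convergent
    by (simp only: convergent_Suc_iff[of "\<lambda>p. \<Sum>q<p. \<alpha> (2 * q + 0) x i - \<alpha> (Suc (2 * q + 0)) x i"])
qed

lemma inner_le:
  assumes "\<And>i. i < m \<Longrightarrow> \<bar>v i\<bar> \<le> B" "0 \<le> B"
  shows "\<bar>inner_Rn m v (\<lambda>i. f y i - f x i)\<bar> \<le> real m * B * C * dist x y"
proof -
  have "\<bar>inner_Rn m v (\<lambda>i. f y i - f x i)\<bar> \<le> (\<Sum>i<m. \<bar>v i * (f y i - f x i)\<bar>)"
    unfolding inner_Rn_def by (rule sum_abs)
  also have "\<dots> \<le> real (card {..<m}) * (B * (C * dist x y))"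
    unfolding abs_mult using assms by (intro sum_bounded_above mult_mono abs_f_diff_le) auto
  finally show ?thesis by (simp add: mult_ac)
qed

text \<open>
  If \<open>r (Suc j) \<le> dist x y < r j\<close>, the terms up to \<open>j\<close> are controlled by their jets, the term
  \<open>Suc j\<close> by its Lipschitz constant, and the later ones by their size.
\<close>

lemma lipschitz_at_regular:
  assumes "0 \<le> c"
  shows "\<exists>\<Lambda>\<ge>0. \<forall>x y. regular c x \<longrightarrow> \<bar>T y - T x\<bar> \<le> \<Lambda> * dist x y"
proof -
  define \<tau> where "\<tau> = 2 * (1 + \<sigma> 0)"
  define \<Lambda> where "\<Lambda> = real m * (L + 2 * c) * C + L + 1 + 2 * L + 1 + 2 * \<tau> / r 0"
  have \<tau>: "0 \<le> \<tau> / r 0" using \<sigma>(1)[of 0] r_pos[of 0] by (simp add: \<tau>_def)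
  have n: "0 \<le> real m * (L + 2 * c) * C" using L C assms by simp
  have \<Lambda>: "0 \<le> \<Lambda>" using \<tau> n L by (simp add: \<Lambda>_def)
  have T_le: "\<bar>T x\<bar> \<le> \<tau>" for x
    using tail[of x 0] G_0[of x] \<sigma>(1)[of 0] by (simp add: S_def H_def \<tau>_def)
  have "\<bar>T y - T x\<bar> \<le> \<Lambda> * dist x y" if x: "regular c x" for x y
  proof (cases "x = y")
    case False
    then have d: "0 < dist x y" by simp
    show ?thesis
    proof (cases "dist x y < r 0")
      case False
      have "\<bar>T y - T x\<bar> \<le> 2 * \<tau> / r 0 * r 0" using T_le[of x] T_le[of y] r_pos[of 0] by simp
      also have "\<dots> \<le> 2 * \<tau> / r 0 * dist x y" using False \<tau> by (intro mult_left_mono) auto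
      also have "\<dots> \<le> \<Lambda> * dist x y" using n L by (intro mult_right_mono) (auto simp: \<Lambda>_def)
      finally show ?thesis .
    next
      case True
      obtain k0 where "r k0 < dist x y"
        using order_tendstoD(2)[OF r_tendsto d] unfolding eventually_sequentially by auto
      then have ex: "\<exists>k. r k \<le> dist x y" by (intro exI[of _ k0]) simp
      define k where "k = (LEAST k. r k \<le> dist x y)"
      have k: "r k \<le> dist x y" unfolding k_def using ex by (rule LeastI_ex)
      then obtain j where j: "k = Suc j" using True by (cases k) auto
      have jr: "dist x y < r j" using not_less_Least[of j "\<lambda>k. r k \<le> dist x y"] j by (simp add: k_def)
      have hd: "\<bar>if even j then h y - h x else 0\<bar> \<le> L * dist x y"
        using abs_h_diff_le[of y x] L by simp
      have "\<bar>main_part j x y\<bar> \<le> real m * (L + 2 * c) * C * dist x y + L * dist x y"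
      proof -
        have "\<bar>inner_Rn m (\<beta> j x) (\<lambda>i. f y i - f x i)\<bar> \<le> real m * (L + 2 * c) * C * dist x y"
          by (rule inner_le) (use abs_\<beta>_le[OF x] L assms in auto)
        from order_trans[OF abs_triangle_ineq4 add_mono[OF this hd]] show ?thesis
          unfolding main_part_def .
      qed
      moreover have "(1/2)^j * dist x y \<le> 1 * dist x y"
        by (intro mult_right_mono) (auto simp: power_le_one)
      ultimately have "\<bar>S j y - S j x\<bar> \<le> (real m * (L + 2 * c) * C + L + 1) * dist x y"
        using partial_sum_jet[OF jr] unfolding distrib_right by linarith
      moreover have "S k y - S k x = (S j y - S j x) + (H k y - H k x)" by (simp add: S_def j)
      moreover note abs_H_diff_le[of k y x]
      ultimately have Sk: "\<bar>S k y - S k x\<bar> \<le> (real m * (L + 2 * c) * C + L + 1) * dist x y + 2 * L * dist x y"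
        by linarith
      have tk: "\<bar>T z - S k z\<bar> \<le> dist x y / 2" for z
      proof -
        have "(1/2)^k * \<sigma> k \<le> 1/2 * r k"
          using \<sigma>[of k] unfolding j by (intro mult_mono) (auto simp: power_le_one)
        then show ?thesis using tail[of z k] k by linarith
      qed
      have "T y - T x = (S k y - S k x) + (T y - S k y) - (T x - S k x)" by simp
      also have "\<bar>\<dots>\<bar> \<le> (real m * (L + 2 * c) * C + L + 1) * dist x y + 2 * L * dist x y + dist x y / 2 + dist x y / 2"
        by (rule abs_add_diff_le[OF Sk tk tk])
      also have "\<dots> = (real m * (L + 2 * c) * C + L + 1 + 2 * L + 1) * dist x y"
        by (simp add: algebra_simps)
      also have "\<dots> \<le> \<Lambda> * dist x y"
        using \<tau> by (intro mult_right_mono) (auto simp: \<Lambda>_def)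
      finally show ?thesis .
    qed
  qed simp
  with \<Lambda> show ?thesis by auto
qed

end

context alternating_series
begin

text \<open>
  The increments of a Lipschitz extension \<open>S'\<close> of \<open>T\<close> from the regular points agree with those
  of \<open>T\<close> up to the distance to the regular set, which is negligible at \<open>x\<close>. The sequence \<open>s\<close>
  runs through one parity.
\<close>

lemma increment_asymptotics:
  assumes x: "regular c x" and s: "\<And>p. p \<le> s p"
    and lim: "\<And>i. i < m \<Longrightarrow> (\<lambda>p. \<beta> (s p) x i) \<longlonglongrightarrow> b i"
    and flat: "flat_at x (\<lambda>y. infdist y {x. regular c x})"
    and \<Lambda>: "0 \<le> \<Lambda>" and T\<Lambda>: "\<And>x y. regular c x \<Longrightarrow> \<bar>T y - T x\<bar> \<le> \<Lambda> * dist x y"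
    and S\<Lambda>: "\<Lambda>-lipschitz_on UNIV S'" and ST: "\<And>x. regular c x \<Longrightarrow> S' x = T x"
    and "0 < e"
  shows "\<forall>\<^sub>F p in sequentially. \<forall>y\<in>annulus x (\<sigma> (s p)) (r (s p)).
    \<bar>S' y - S' x - (inner_Rn m b (\<lambda>i. f y i - f x i) - (if even (s p) then h y - h x else 0))\<bar> \<le> e * dist x y"
proof -
  have s_top: "filterlim s at_top sequentially"
    by (rule filterlim_at_top_mono[OF filterlim_ident]) (use s in auto)
  have ST_le: "\<bar>S' y - T y\<bar> \<le> 2 * (\<Lambda> + 1) * infdist y {x. regular c x}" for y
  proof -
    have "\<bar>S' y - T y\<bar> / (2 * (\<Lambda> + 1)) \<le> infdist y {x. regular c x}"
    proof (rule le_infdistI)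
      show "{x. regular c x} \<noteq> {}" using x by blast
      fix z assume "z \<in> {x. regular c x}"
      then have z: "regular c z" by simp
      have "\<bar>S' y - S' z\<bar> \<le> \<Lambda> * dist y z"
        using lipschitz_onD[OF S\<Lambda>, of y z] by (simp add: dist_real_def)
      moreover have "\<bar>T y - T z\<bar> \<le> \<Lambda> * dist y z" using T\<Lambda>[OF z, of y] by (simp add: dist_commute)
      ultimately have "\<bar>S' y - T y\<bar> \<le> 2 * (\<Lambda> * dist y z)"
        unfolding ST[OF z] by linarith
      also have "\<dots> \<le> dist y z * (2 * (\<Lambda> + 1))" by (simp add: algebra_simps)
      finally have "\<bar>S' y - T y\<bar> \<le> dist y z * (2 * (\<Lambda> + 1))" .
      then show "\<bar>S' y - T y\<bar> / (2 * (\<Lambda> + 1)) \<le> dist y z" using \<Lambda> by (simp add: pos_divide_le_eq)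
    qed
    then show ?thesis using \<Lambda> by (simp add: pos_divide_le_eq mult.commute)
  qed
  define \<epsilon> where "\<epsilon> = e / 3 / (2 * (\<Lambda> + 1))"
  have \<Lambda>1: "0 < 2 * (\<Lambda> + 1)" using \<Lambda> by simp
  then have \<epsilon>: "0 < \<epsilon>" unfolding \<epsilon>_def using \<open>0 < e\<close> by (intro divide_pos_pos) auto
  have \<epsilon>_eq: "2 * (\<Lambda> + 1) * \<epsilon> = e / 3"
  proof -
    have "q * (e / 3 / q) = e / 3" if "0 < q" for q :: real using that by simp
    from this[OF \<Lambda>1] show ?thesis by (simp only: \<epsilon>_def)
  qed
  have infdist_x: "infdist x {x. regular c x} = 0" using x by simp
  have "\<forall>\<^sub>F y in at x. infdist y {x. regular c x} \<le> \<epsilon> * dist x y"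
    using flat \<epsilon> unfolding flat_at_def infdist_x by (simp add: infdist_nonneg)
  then obtain d0 where d0: "0 < d0" "\<And>y. y \<noteq> x \<Longrightarrow> dist y x < d0 \<Longrightarrow> infdist y {x. regular c x} \<le> \<epsilon> * dist x y"
    by (auto simp: eventually_at)
  have "\<forall>\<^sub>F p in sequentially. r (s p) < d0"
    using filterlim_compose[OF r_tendsto s_top] d0(1) by (rule order_tendstoD(2))
  moreover have "(\<lambda>p. (1/2::real)^s p) \<longlonglongrightarrow> 0"
    by (intro filterlim_compose[OF LIMSEQ_realpow_zero s_top]) auto
  then have "\<forall>\<^sub>F p in sequentially. (1/2::real)^s p < e / 9"
    using \<open>0 < e\<close> by (intro order_tendstoD(2)) auto
  moreover define \<eta> where "\<eta> = e / (3 * (real m * C + 1))"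
  have mC: "0 < real m * C + 1" using C by (simp add: add_nonneg_pos)
  then have \<eta>: "0 < \<eta>" using \<open>0 < e\<close> by (simp add: \<eta>_def)
  have "\<forall>\<^sub>F p in sequentially. \<forall>i\<in>{..<m}. \<bar>\<beta> (s p) x i - b i\<bar> < \<eta>"
  proof (rule eventually_ball_finite)
    show "\<forall>i\<in>{..<m}. \<forall>\<^sub>F p in sequentially. \<bar>\<beta> (s p) x i - b i\<bar> < \<eta>"
      using lim \<eta> by (auto simp: tendsto_iff dist_real_def)
  qed simp
  ultimately show ?thesis
  proof eventually_elim
    case (elim p)
    show ?case
    proof
      fix y assume y: "y \<in> annulus x (\<sigma> (s p)) (r (s p))"
      then have yx: "y \<noteq> x" "dist y x < d0" using \<sigma>(1)[of "s p"] elim(1) by (auto simp: annulus_def dist_commute)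
      have "\<bar>S' y - T y\<bar> \<le> 2 * (\<Lambda> + 1) * (\<epsilon> * dist x y)"
        using \<Lambda> by (intro order_trans[OF ST_le] mult_left_mono d0(2) yx) auto
      then have 1: "\<bar>S' y - T y\<bar> \<le> e / 3 * dist x y" by (simp only: \<epsilon>_eq mult.assoc[symmetric])
      have "3 * (1/2)^s p * dist x y \<le> e / 3 * dist x y" using elim(2) by (intro mult_right_mono) auto
      then have 2: "\<bar>T y - T x - main_part (s p) x y\<bar> \<le> e / 3 * dist x y"
        using increment[OF y] by linarith
      have "\<bar>inner_Rn m (\<lambda>i. b i - \<beta> (s p) x i) (\<lambda>i. f y i - f x i)\<bar> \<le> real m * \<eta> * C * dist x y"
        using elim(3) \<eta> by (intro inner_le) (auto simp: abs_minus_commute intro: less_imp_le)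
      also have "real m * \<eta> * C = e / 3 * (real m * C / (real m * C + 1))" by (simp add: \<eta>_def)
      also have "\<dots> \<le> e / 3 * 1" using \<open>0 < e\<close> mC by (intro mult_left_mono) (auto simp: pos_divide_le_eq)
      finally have 3: "\<bar>inner_Rn m (\<lambda>i. b i - \<beta> (s p) x i) (\<lambda>i. f y i - f x i)\<bar> \<le> e / 3 * dist x y"
        by (simp add: mult_right_mono)
      have "S' y - S' x - (inner_Rn m b (\<lambda>i. f y i - f x i) - (if even (s p) then h y - h x else 0)) =
         (S' y - T y) + (T y - T x - main_part (s p) x y) - inner_Rn m (\<lambda>i. b i - \<beta> (s p) x i) (\<lambda>i. f y i - f x i)"
        using ST[OF x] by (simp add: main_part_def inner_Rn_def left_diff_distrib sum_subtractf)
      also have "\<bar>\<dots>\<bar> \<le> e / 3 * dist x y + e / 3 * dist x y + e / 3 * dist x y"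
        by (rule abs_add_diff_le[OF 1 2 3])
      finally show "\<bar>S' y - S' x - (inner_Rn m b (\<lambda>i. f y i - f x i) - (if even (s p) then h y - h x else 0))\<bar> \<le> e * dist x y"
        by simp
    qed
  qed
qed

text \<open>
  Both \<open>S' - b \<bullet> f + h\<close> and \<open>S' - b' \<bullet> f\<close> have small increments on infinitely many annuli, the
  former on even and the latter on odd ones. They are differentiable with respect to \<open>\<phi>\<close>, hence
  flat, and \<open>S'\<close> cancels in their difference.
\<close>

lemma differential_at_regular_point:
  assumes x: "regular c x"
    and flat: "flat_at x (\<lambda>y. infdist y {x. regular c x})"
    and \<Lambda>: "0 \<le> \<Lambda>" and T\<Lambda>: "\<And>x y. regular c x \<Longrightarrow> \<bar>T y - T x\<bar> \<le> \<Lambda> * dist x y"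
    and S\<Lambda>: "\<Lambda>-lipschitz_on UNIV S'" and ST: "\<And>x. regular c x \<Longrightarrow> S' x = T x"
    and diff: "differentiable_wrt n \<phi> x S'" "differentiable_wrt n \<phi> x h"
      "\<And>i. i < m \<Longrightarrow> differentiable_wrt n \<phi> x (\<lambda>y. f y i)"
    and detect: "\<And>D. differentiable_wrt n \<phi> x D \<Longrightarrow>
        (\<And>e. 0 < e \<Longrightarrow> \<exists>\<^sub>F j in sequentially. \<forall>y\<in>annulus x (\<sigma> j) (r j). \<bar>D y - D x\<bar> \<le> e * dist x y) \<Longrightarrow>
        flat_at x D"
  shows "\<exists>v. differential_at m f h x v"
proof -
  have "\<forall>i. \<exists>l. i < m \<longrightarrow> (\<lambda>p. \<beta> (2 * p) x i) \<longlonglongrightarrow> l" "\<forall>i. \<exists>l. i < m \<longrightarrow> (\<lambda>p. \<beta> (Suc (2 * p)) x i) \<longlonglongrightarrow> l"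
    using \<beta>_convergent[OF x] unfolding convergent_def by auto
  then obtain b b' where b: "\<And>i. i < m \<Longrightarrow> (\<lambda>p. \<beta> (2 * p) x i) \<longlonglongrightarrow> b i"
    and b': "\<And>i. i < m \<Longrightarrow> (\<lambda>p. \<beta> (Suc (2 * p)) x i) \<longlonglongrightarrow> b' i"
    by metis
  note asymp = increment_asymptotics[OF x _ _ flat \<Lambda> T\<Lambda> S\<Lambda> ST]
  have inner: "inner_Rn m v (\<lambda>i. f y i - f x i) = inner_Rn m v (f y) - inner_Rn m v (f x)" for v y
    by (rule inner_Rn_diff_right)
  have diff_inner: "differentiable_wrt n \<phi> x (\<lambda>y. inner_Rn m v (f y))" for v
    unfolding inner_Rn_def by (intro differentiable_wrt_sum differentiable_wrt_cmult diff(3)) simp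
  have frequently: "\<exists>\<^sub>F j in sequentially. P j"
    if "\<forall>\<^sub>F p in sequentially. P (s p)" and s: "\<And>p. p \<le> s p" for P and s :: "nat \<Rightarrow> nat"
    unfolding frequently_sequentially
  proof
    fix N
    from that(1) obtain p where "\<And>q. p \<le> q \<Longrightarrow> P (s q)" by (auto simp: eventually_sequentially)
    then have "P (s (max p N))" by simp
    then show "\<exists>j\<ge>N. P j" using s[of "max p N"] by (intro exI[of _ "s (max p N)"]) simp
  qed
  have even: "flat_at x (\<lambda>y. S' y - inner_Rn m b (f y) + h y)"
  proof (rule detect)
    show "differentiable_wrt n \<phi> x (\<lambda>y. S' y - inner_Rn m b (f y) + h y)"
      by (intro differentiable_wrt_add differentiable_wrt_diff diff(1,2) diff_inner)
    fix e :: real assume "0 < e"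
    show "\<exists>\<^sub>F j in sequentially. \<forall>y\<in>annulus x (\<sigma> j) (r j).
        \<bar>S' y - inner_Rn m b (f y) + h y - (S' x - inner_Rn m b (f x) + h x)\<bar> \<le> e * dist x y"
      by (rule frequently[of _ "\<lambda>p. 2 * p"], rule eventually_mono[OF asymp[of "\<lambda>p. 2 * p" b e]])
        (use b \<open>0 < e\<close> in \<open>auto simp: inner algebra_simps\<close>)
  qed
  have odd: "flat_at x (\<lambda>y. S' y - inner_Rn m b' (f y))"
  proof (rule detect)
    show "differentiable_wrt n \<phi> x (\<lambda>y. S' y - inner_Rn m b' (f y))"
      by (intro differentiable_wrt_diff diff(1) diff_inner)
    fix e :: real assume "0 < e"
    show "\<exists>\<^sub>F j in sequentially. \<forall>y\<in>annulus x (\<sigma> j) (r j).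
        \<bar>S' y - inner_Rn m b' (f y) - (S' x - inner_Rn m b' (f x))\<bar> \<le> e * dist x y"
      by (rule frequently[of _ "\<lambda>p. Suc (2 * p)"], rule eventually_mono[OF asymp[of "\<lambda>p. Suc (2 * p)" b' e]])
        (use b' \<open>0 < e\<close> in \<open>auto simp: inner algebra_simps\<close>)
  qed
  have "flat_at x (\<lambda>y. h y - inner_Rn m (\<lambda>i. b i - b' i) (f y))"
    using flat_at_diff[OF even odd] by (simp add: inner_Rn_def left_diff_distrib sum_subtractf algebra_simps)
  then have "differential_at m f h x (\<lambda>i. b i - b' i)" by (simp only: differential_at_iff_flat)
  then show ?thesis by (rule exI[of _ "\<lambda>i. b i - b' i"])
qed

end

section \<open>Differentials lie in the span of a light map\<close>

text \<open>
  The choice of the ranges: given \<open>r j\<close>, the approximation \<open>k (Suc j)\<close> is taken so late that it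
  is accurate at scale \<open>\<sigma> j (r j)\<close>, and then \<open>r (Suc j)\<close> so small that the quadratic error of
  this approximation, with constant \<open>K\<close>, is under control.
\<close>

lemma fast_scales:
  fixes \<sigma> :: "nat \<Rightarrow> real \<Rightarrow> real" and K :: "nat \<Rightarrow> real" and \<kappa> :: "nat \<Rightarrow> nat"
  assumes \<sigma>: "\<forall>j r. 0 < r \<longrightarrow> 0 < \<sigma> j r" and K: "\<forall>k. 0 \<le> K k"
  shows "\<exists>k r. (\<forall>j. 0 < r j \<and> r j \<le> 1 \<and> K (k j) * r j \<le> (1/4)^j \<and> \<kappa> j \<le> k j) \<and>
    (\<forall>j. k j \<le> k (Suc j) \<and> (1/2)^k (Suc j) \<le> (1/2)^Suc j * \<sigma> j (r j) \<and> r (Suc j) \<le> \<sigma> j (r j) / 2)"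
proof -
  define P where "P j p \<longleftrightarrow> 0 < snd p \<and> snd p \<le> 1 \<and> K (fst p) * snd p \<le> (1/4)^j \<and> \<kappa> j \<le> fst p"
    for j and p :: "nat \<times> real"
  define Q where "Q j p q \<longleftrightarrow> fst p \<le> fst q \<and> (1/2)^fst q \<le> (1/2)^Suc j * \<sigma> j (snd p) \<and> snd q \<le> \<sigma> j (snd p) / 2"
    for j and p q :: "nat \<times> real"
  have choose: "\<exists>s>0. s \<le> 1 \<and> s \<le> b \<and> K k * s \<le> (1/4)^j" if "0 < b" for b :: real and j k
  proof -
    define s where "s = min (min 1 b) ((1/4)^j / (1 + K k))"
    have K1: "0 < 1 + K k" using K[rule_format, of k] by linarith
    have "K k * s \<le> K k * ((1/4)^j / (1 + K k))" using K by (intro mult_left_mono) (auto simp: s_def)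
    also have "\<dots> = (1/4)^j * (K k / (1 + K k))" by simp
    also have "\<dots> \<le> (1/4)^j * 1" using K1 by (intro mult_left_mono) (auto simp: pos_divide_le_eq)
    finally show ?thesis using that K1 by (intro exI[of _ s]) (auto simp: s_def)
  qed
  have "\<exists>s. \<forall>j. P j (s j) \<and> Q j (s j) (s (Suc j))"
  proof (rule dependent_nat_choice)
    show "\<exists>p. P 0 p"
      using choose[of 1 "\<kappa> 0" 0] by (auto simp: P_def)
    fix p j assume "P j p"
    then have r: "0 < \<sigma> j (snd p)" using \<sigma> by (simp add: P_def)
    then have "0 < (1/2)^Suc j * \<sigma> j (snd p)" by simp
    from real_arch_pow_inv[OF this, of "1/2"] obtain n0 where n0: "(1/2)^n0 < (1/2)^Suc j * \<sigma> j (snd p)" by auto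
    define k where "k = max (max (fst p) n0) (\<kappa> (Suc j))"
    have k: "fst p \<le> k" "n0 \<le> k" "\<kappa> (Suc j) \<le> k" by (auto simp: k_def)
    have "(1/2::real)^k \<le> (1/2)^n0" using k(2) by (intro power_decreasing) auto
    then have "(1/2)^k \<le> (1/2)^Suc j * \<sigma> j (snd p)" using n0 by linarith
    moreover obtain s where "0 < s" "s \<le> 1" "s \<le> \<sigma> j (snd p) / 2" "K k * s \<le> (1/4)^Suc j"
      using choose[of "\<sigma> j (snd p) / 2" k "Suc j"] r by auto
    ultimately have "P (Suc j) (k, s) \<and> Q j p (k, s)" using k by (simp add: P_def Q_def)
    then show "\<exists>q. P (Suc j) q \<and> Q j p q" by (rule exI[of _ "(k, s)"])
  qed
  then obtain s where s: "\<And>j. P j (s j)" "\<And>j. Q j (s j) (s (Suc j))" by auto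
  show ?thesis
    by (rule exI[of _ "\<lambda>j. fst (s j)"], rule exI[of _ "\<lambda>j. snd (s j)"])
      (use s in \<open>simp add: P_def Q_def\<close>)
qed

text \<open>
  By Markov's inequality the differences exceed \<open>(1/2)^j\<close> only on a set of measure at most
  \<open>(1/2)^j\<close>, and Borel--Cantelli applies; the constant \<open>c\<close> absorbs the finitely many exceptions.
\<close>

lemma AE_geometric_decay:
  fixes \<alpha> :: "nat \<Rightarrow> 'a::metric_space \<Rightarrow> nat \<Rightarrow> real"
  assumes M: "sets M = sets borel" "finite_measure M"
    and \<alpha>: "\<And>j. \<forall>i<m. continuous_on UNIV (\<lambda>x. \<alpha> j x i) \<and> (\<forall>x. \<bar>\<alpha> j x i\<bar> \<le> L)"
    and energy: "\<And>j. energy M m (\<lambda>x i. \<alpha> j x i - \<alpha> (Suc j) x i) \<le> (1/8)^j"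
  shows "AE x in M. \<exists>c::nat. \<forall>j. \<forall>i<m. \<bar>\<alpha> j x i - \<alpha> (Suc j) x i\<bar> \<le> real c * (1/2)^j"
proof -
  interpret finite_measure M by fact
  have space: "space M = UNIV" using sets_eq_imp_space_eq[OF M(1)] by simp
  define d where "d j x i = \<alpha> j x i - \<alpha> (Suc j) x i" for j x i
  define D where "D j = {x\<in>space M. (1/4)^j \<le> (\<Sum>i<m. (d j x i)\<^sup>2)}" for j
  have d: "\<forall>i<m. continuous_on UNIV (\<lambda>x. d j x i) \<and> (\<forall>x. \<bar>d j x i\<bar> \<le> 2 * L)" for j
  proof (intro allI impI conjI)
    fix i assume "i < m"
    then show "continuous_on UNIV (\<lambda>x. d j x i)" using \<alpha> unfolding d_def by (intro continuous_intros) auto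
    fix x
    have "\<bar>\<alpha> j x i\<bar> \<le> L" "\<bar>\<alpha> (Suc j) x i\<bar> \<le> L" using \<alpha> \<open>i < m\<close> by auto
    then show "\<bar>d j x i\<bar> \<le> 2 * L" unfolding d_def by linarith
  qed
  note int = integrable_sum_squares[OF M d]
  have D_meas: "D j \<in> sets M" for j
    unfolding D_def using borel_measurable_integrable[OF int] by measurable
  have D_small: "measure M (D j) \<le> (1/2)^j" for j
  proof -
    have "measure M (D j) \<le> (\<integral>x. (\<Sum>i<m. (d j x i)\<^sup>2) \<partial>M) / (1/4)^j"
      unfolding D_def by (rule integral_Markov_inequality_measure[OF int, of "{}"]) (auto intro!: AE_I2 sum_nonneg)
    also have "\<dots> \<le> (1/8)^j / (1/4)^j"
      using energy[of j] unfolding energy_def d_def by (intro divide_right_mono) auto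
    also have "\<dots> = ((1/8) / (1/4))^j" by (rule power_divide[symmetric])
    also have "\<dots> = (1/2)^j" by simp
    finally show ?thesis .
  qed
  have "AE x in M. eventually (\<lambda>j. x \<in> space M - D j) sequentially"
  proof (rule borel_cantelli_AE1)
    show "summable (\<lambda>j. measure M (D j))"
      by (rule summable_comparison_test[of _ "\<lambda>j. (1/2)^j"]) (use D_small in \<open>auto simp: summable_geometric\<close>)
  qed (auto simp: emeasure_eq_measure D_meas)
  then show ?thesis
  proof eventually_elim
    case (elim x)
    then obtain N where N: "\<And>j. N \<le> j \<Longrightarrow> x \<notin> D j" by (auto simp: eventually_sequentially)
    define c where "c = max 1 (nat \<lceil>2 * L * 2^N\<rceil>)"
    have c: "1 \<le> real c" "2 * L * 2^N \<le> real c" unfolding c_def by linarith+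
    have "\<bar>d j x i\<bar> \<le> real c * (1/2)^j" if "i < m" for j i
    proof (cases "N \<le> j")
      case True
      then have "(\<Sum>i<m. (d j x i)\<^sup>2) < (1/4)^j" using N[OF True] by (simp add: D_def space not_le)
      moreover have "(d j x i)\<^sup>2 \<le> (\<Sum>i<m. (d j x i)\<^sup>2)"
        using that by (intro member_le_sum) auto
      moreover have "(1/4::real)^j = ((1/2)^j)\<^sup>2"
        by (simp add: power2_eq_square flip: power_mult_distrib)
      ultimately have "\<bar>d j x i\<bar>\<^sup>2 \<le> ((1/2)^j)\<^sup>2" by simp
      then have "\<bar>d j x i\<bar> \<le> (1/2)^j" by (rule power2_le_imp_le) simp
      also have "\<dots> \<le> real c * (1/2)^j" using mult_right_mono[OF c(1), of "(1/2)^j"] by simp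
      finally show ?thesis .
    next
      case False
      have "\<bar>d j x i\<bar> \<le> 2 * L" using d that by blast
      also have "\<dots> = 2 * L * 2^N * (1/2)^N" by (simp add: power_one_over)
      also have "\<dots> \<le> real c * (1/2)^N" using c(2) by (intro mult_right_mono) auto
      also have "\<dots> \<le> real c * (1/2)^j" using False by (intro mult_left_mono power_decreasing) auto
      finally show ?thesis .
    qed
    then show ?case unfolding d_def by blast
  qed
qed

text \<open>
  The inner radii \<open>\<sigma>\<close> depend on \<open>M\<close> and \<open>\<phi>\<close> alone and are fixed first, as a function of the
  outer radius. So the sequence \<open>r\<close> can be adapted to the approximations of \<open>h\<close> and is still
  detecting. At almost every point of \<open>U\<close> the gradients converge geometrically, with some
  integer \<open>c\<close>, and for each \<open>c\<close> the Lipschitz extension of the alternating series is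
  differentiable almost everywhere in \<open>U\<close>.
\<close>

lemma light_map_spans_differentials:
  fixes M :: "'a::metric_space measure" and f :: "'a \<Rightarrow> nat \<Rightarrow> real"
  assumes M: "sets M = sets borel" "finite_measure M"
    and \<phi>: "\<forall>i<n. B-lipschitz_on UNIV (\<lambda>x. \<phi> x i)" and "0 \<le> B"
    and diff: "\<And>L F. L-lipschitz_on UNIV F \<Longrightarrow> AE x in M. x \<in> U \<longrightarrow> differentiable_wrt n \<phi> x F"
    and f: "chain_light C m f" and h: "L0-lipschitz_on UNIV h"
  shows "AE x in M. x \<in> U \<longrightarrow> (\<exists>v. differential_at m f h x v)"
proof -
  have C: "0 \<le> C" and f_lip: "\<forall>i<m. C-lipschitz_on UNIV (\<lambda>x. f x i)"
    using f by (auto simp: chain_light_def)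
  from jet_approximations_nonempty[OF f h] obtain L' where
    L': "0 \<le> L'" "\<forall>\<eta>>0. jet_approximations m f h L' \<eta> \<noteq> {}" by auto
  define L where "L = max L0 L'"
  have L_le: "L0 \<le> L" "L' \<le> L" by (auto simp: L_def)
  from strongly_convergent_jets[OF M L'(2)] obtain F a where
    "(\<forall>k. (F k, a k) \<in> jet_approximations m f h L' ((1/2)^k)) \<and>
     (\<forall>e>0. \<exists>N. \<forall>k\<ge>N. \<forall>l\<ge>N. energy M m (\<lambda>x i. a k x i - a l x i) \<le> e)"
    by (elim exE)
  then have jets: "\<And>k. (F k, a k) \<in> jet_approximations m f h L' ((1/2)^k)"
    and Cauchy: "\<forall>e>0. \<exists>N. \<forall>k\<ge>N. \<forall>l\<ge>N. energy M m (\<lambda>x i. a k x i - a l x i) \<le> e"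
    by auto
  note jets = jets[unfolded jet_approximations_def mem_Collect_eq case_prod_conv]
  have "\<forall>k. \<exists>K. 0 \<le> K \<and> (\<forall>x y. \<bar>F k y - F k x - inner_Rn m (a k x) (\<lambda>i. f y i - f x i)\<bar> \<le> K * (dist x y)\<^sup>2)"
    using jets by auto
  from choice[OF this] obtain K where K: "\<And>k. 0 \<le> K k"
    "\<And>k x y. \<bar>F k y - F k x - inner_Rn m (a k x) (\<lambda>i. f y i - f x i)\<bar> \<le> K k * (dist x y)\<^sup>2"
    by auto
  define K' where "K' k = (\<Sum>l\<le>k. K l)" for k
  have K'_ge: "K l \<le> K' k" if "l \<le> k" for l k
    unfolding K'_def using K(1) that by (intro member_le_sum) auto
  have K'_nonneg: "0 \<le> K' k" for k unfolding K'_def by (intro sum_nonneg K)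
  have "\<forall>j. \<exists>N. \<forall>k\<ge>N. \<forall>l\<ge>N. energy M m (\<lambda>x i. a k x i - a l x i) \<le> (1/8)^j"
    using Cauchy by simp
  from choice[OF this] obtain \<kappa> where
    \<kappa>: "\<And>j k l. \<kappa> j \<le> k \<Longrightarrow> \<kappa> j \<le> l \<Longrightarrow> energy M m (\<lambda>x i. a k x i - a l x i) \<le> (1/8)^j"
    by auto
  from testing_scales[OF M \<phi> \<open>0 \<le> B\<close>] obtain \<sigma> where
    \<sigma>': "(\<forall>j r. 0 < r \<longrightarrow> 0 < \<sigma> j r \<and> \<sigma> j r < r) \<and>
      (\<forall>r. (\<forall>j. 0 < r j) \<longrightarrow> r \<longlonglongrightarrow> 0 \<longrightarrow> detecting_scales M n \<phi> (\<lambda>j. \<sigma> j (r j)) r)"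
    by (elim exE)
  then have \<sigma>: "0 < r \<Longrightarrow> 0 < \<sigma> j r" "0 < r \<Longrightarrow> \<sigma> j r < r" for j r by auto
  have "\<forall>j r. 0 < r \<longrightarrow> 0 < \<sigma> j r" "\<forall>k. 0 \<le> K' k" using \<sigma>(1) K'_nonneg by auto
  from fast_scales[OF this, of \<kappa>] obtain k r where
    kr: "(\<forall>j. 0 < r j \<and> r j \<le> 1 \<and> K' (k j) * r j \<le> (1/4)^j \<and> \<kappa> j \<le> k j) \<and>
    (\<forall>j. k j \<le> k (Suc j) \<and> (1/2)^k (Suc j) \<le> (1/2)^Suc j * \<sigma> j (r j) \<and> r (Suc j) \<le> \<sigma> j (r j) / 2)"
    by (elim exE)
  then have r: "0 < r j" "r j \<le> 1" "K' (k j) * r j \<le> (1/4)^j" "\<kappa> j \<le> k j"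
    and k: "k j \<le> k (Suc j)" "(1/2)^k (Suc j) \<le> (1/2)^Suc j * \<sigma> j (r j)" "r (Suc j) \<le> \<sigma> j (r j) / 2" for j
    by auto
  have k_mono: "k i \<le> k j" if "i \<le> j" for i j using lift_Suc_mono_le[of k, OF k(1) that] .
  interpret alternating_series C m f h L "\<lambda>j. F (k j)" "\<lambda>j. a (k j)" "\<lambda>j. K (k j)" "\<lambda>j. \<sigma> j (r j)" r
  proof
    show "0 \<le> C" "\<forall>i<m. C-lipschitz_on UNIV (\<lambda>x. f x i)" by fact+
    show "L-lipschitz_on UNIV h" by (rule lipschitz_on_mono[OF h order_refl L_le(1)])
    show "0 < \<sigma> j (r j)" "\<sigma> j (r j) < r j" "r (Suc j) \<le> \<sigma> j (r j) / 2" "r 0 \<le> 1" for j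
      using \<sigma> r k by auto
    have close: "\<bar>F l x - h x\<bar> \<le> (1/2)^l" for l x using jets by blast
    show "\<bar>F (k 0) x - h x\<bar> \<le> 1" for x
      by (rule order_trans[OF close]) (simp add: power_le_one)
    show "\<bar>F (k (Suc j)) x - h x\<bar> \<le> (1/2)^Suc j * \<sigma> j (r j)" for j x
      by (rule order_trans[OF close k(2)])
    show "L-lipschitz_on UNIV (F (k j))" for j
      using jets[of "k j"] by (intro lipschitz_on_mono[OF _ order_refl L_le(2)]) blast
    show "0 \<le> K (k j)" for j by (rule K)
    show "K (k i) * r j \<le> (1/4)^j" if "i \<le> j" for i j
      using mult_right_mono[OF K'_ge[OF k_mono[OF that]], of "r j"] r(1,3)[of j] by linarith
    show "\<bar>F (k j) y - F (k j) x - inner_Rn m (a (k j) x) (\<lambda>i. f y i - f x i)\<bar> \<le> K (k j) * (dist x y)\<^sup>2" for j x y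
      by (rule K)
    show "\<bar>a (k j) x i\<bar> \<le> L" if "i < m" for i j x
    proof -
      have "\<bar>a (k j) x i\<bar> \<le> L'" using jets[of "k j"] that by blast
      then show ?thesis using L_le(2) by linarith
    qed
  qed
  have regular_AE: "AE x in M. \<exists>c::nat. regular (real c) x"
    unfolding regular_def
  proof (rule AE_geometric_decay[OF M, where L = L'])
    show "\<forall>i<m. continuous_on UNIV (\<lambda>x. a (k j) x i) \<and> (\<forall>x. \<bar>a (k j) x i\<bar> \<le> L')" for j
      using jets[of "k j"] by blast
    show "energy M m (\<lambda>x i. a (k j) x i - a (k (Suc j)) x i) \<le> (1/8)^j" for j
      using r(4)[of j] k(1)[of j] by (intro \<kappa>) auto
  qed
  have h_AE: "AE x in M. x \<in> U \<longrightarrow> differentiable_wrt n \<phi> x h" by (rule diff[OF h])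
  have f_AE: "AE x in M. \<forall>i\<in>{..<m}. x \<in> U \<longrightarrow> differentiable_wrt n \<phi> x (\<lambda>y. f y i)"
    using f_lip by (intro AE_finite_allI diff[of C]) auto
  have "detecting_scales M n \<phi> (\<lambda>j. \<sigma> j (r j)) r" using \<sigma>' r_pos r_tendsto by simp
  note detect_AE = this[unfolded detecting_scales_def]
  have "AE x in M. x \<in> U \<and> regular (real c) x \<longrightarrow> (\<exists>v. differential_at m f h x v)" for c :: nat
  proof (cases "\<exists>z. regular (real c) z")
    case True
    obtain \<Lambda> where \<Lambda>: "0 \<le> \<Lambda>" "\<And>x y. regular (real c) x \<Longrightarrow> \<bar>T y - T x\<bar> \<le> \<Lambda> * dist x y"
      using lipschitz_at_regular[of "real c"] by auto
    have "\<exists>S'. \<Lambda>-lipschitz_on UNIV S' \<and> (\<forall>x\<in>{x. regular (real c) x}. S' x = T x)"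
    proof (rule lipschitz_extension)
      fix x y assume "x \<in> {x. regular (real c) x}"
      then show "\<bar>T x - T y\<bar> \<le> \<Lambda> * dist x y" using \<Lambda>(2)[of x y] by (simp add: abs_minus_commute)
    qed (use True \<Lambda>(1) in auto)
    then obtain S' where S': "\<Lambda>-lipschitz_on UNIV S'" "\<And>x. regular (real c) x \<Longrightarrow> S' x = T x"
      by auto
    have flat_AE: "AE x in M. x \<in> U \<inter> {x. regular (real c) x} \<longrightarrow> flat_at x (\<lambda>y. infdist y {x. regular (real c) x})"
      by (rule set_not_porous[OF M \<phi> \<open>0 \<le> B\<close> diff])
    show ?thesis
      using diff[OF S'(1)] h_AE f_AE detect_AE flat_AE
    proof eventually_elim
      case (elim x)
      show ?case
      proof
        assume x: "x \<in> U \<and> regular (real c) x"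
        show "\<exists>v. differential_at m f h x v"
        proof (rule differential_at_regular_point[OF _ _ \<Lambda> S'])
          show "regular (real c) x" "flat_at x (\<lambda>y. infdist y {x. regular (real c) x})"
            using x elim(5) by auto
          show "differentiable_wrt n \<phi> x S'" "differentiable_wrt n \<phi> x h" using x elim(1,2) by auto
          show "differentiable_wrt n \<phi> x (\<lambda>y. f y i)" if "i < m" for i using x elim(3) that by auto
          show "flat_at x D" if "differentiable_wrt n \<phi> x D"
            "\<And>e. 0 < e \<Longrightarrow> \<exists>\<^sub>F j in sequentially. \<forall>y\<in>annulus x (\<sigma> j (r j)) (r j). \<bar>D y - D x\<bar> \<le> e * dist x y" for D
            using elim(4)[rule_format, OF that(1)] that(2) by simp
        qed
      qed
    qed
  qed simp
  then have "AE x in M. \<forall>c::nat. x \<in> U \<and> regular (real c) x \<longrightarrow> (\<exists>v. differential_at m f h x v)"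
    unfolding AE_all_countable by (rule allI)
  with regular_AE show ?thesis
    by eventually_elim auto
qed

section \<open>Comparison of the dimensions\<close>

lemma chart_lipschitz:
  assumes "chart M n U \<phi>"
  shows "\<exists>B\<ge>0. \<forall>i<n. B-lipschitz_on UNIV (\<lambda>x. \<phi> x i)"
proof -
  from assms obtain B where
    B: "\<And>x y. L2_set (\<lambda>i. \<phi> x i - \<phi> y i) {..<n} \<le> B * dist x y"
    by (auto simp: chart_def Lipschitz_continuous_map_def mdist_Rn)
  have "(max B 0)-lipschitz_on UNIV (\<lambda>x. \<phi> x i)" if "i < n" for i
  proof (rule lipschitz_onI)
    fix x y
    have "dist (\<phi> x i) (\<phi> y i) \<le> B * dist x y"
      using abs_le_L2_set[OF that, of "\<lambda>i. \<phi> x i - \<phi> y i"] B[of x y] by (simp add: dist_real_def)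
    also have "\<dots> \<le> max B 0 * dist x y" by (intro mult_right_mono) auto
    finally show "dist (\<phi> x i) (\<phi> y i) \<le> max B 0 * dist x y" .
  qed simp
  then show ?thesis by (intro exI[of _ "max B 0"]) simp
qed

lemma chart_dim_le_light_dim:
  fixes M :: "'a::metric_space measure" and f :: "'a \<Rightarrow> nat \<Rightarrow> real"
  assumes M: "sets M = sets borel" "finite_measure M"
    and chart: "chart M n U \<phi>" and light: "lipschitz_light euclidean_metric (Rn m) f"
  shows "n \<le> m"
proof (rule ccontr)
  assume "\<not> n \<le> m"
  then have "m < n" by simp
  from chart have U: "U \<in> sets M" "emeasure M U > 0" by (auto simp: chart_def M)
  from chart_lipschitz[OF chart] obtain B where B: "0 \<le> B" "\<forall>i<n. B-lipschitz_on UNIV (\<lambda>x. \<phi> x i)"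
    by auto
  have unique: "AE x in M. x \<in> U \<longrightarrow> (\<exists>!v. v \<in> mspace (Rn n) \<and> differential_at n \<phi> F x v)"
    if "L-lipschitz_on UNIV F" for L F
    using chart that unfolding chart_def Lipschitz_map_euclidean by blast
  have diff: "AE x in M. x \<in> U \<longrightarrow> differentiable_wrt n \<phi> x F" if "L-lipschitz_on UNIV F" for L F
    using unique[OF that] by eventually_elim (auto simp: differentiable_wrt_def)
  obtain C where C: "chain_light C m f" using chain_light_of_lipschitz_light[OF light] by auto
  have span: "AE x in M. \<forall>l\<in>{..<n}. x \<in> U \<longrightarrow> (\<exists>v. differential_at m f (\<lambda>y. \<phi> y l) x v)"
    using B by (intro AE_finite_allI light_map_spans_differentials[OF M B(2) B(1) diff C]) auto
  have "0-lipschitz_on UNIV (\<lambda>_::'a. 0::real)" by (rule lipschitz_on_constant)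
  note zero = unique[OF this]
  have "\<exists>x. x \<in> U \<and> (\<forall>l\<in>{..<n}. \<exists>v. differential_at m f (\<lambda>y. \<phi> y l) x v) \<and>
      (\<exists>!v. v \<in> mspace (Rn n) \<and> differential_at n \<phi> (\<lambda>_. 0) x v)"
  proof (rule ccontr)
    assume none: "\<not> ?thesis"
    have "AE x in M. x \<notin> U" using span zero by eventually_elim (use none in blast)
    then have "U \<in> null_sets M" using U by (simp add: AE_iff_null_sets)
    with U show False by (simp add: null_sets_def)
  qed
  then obtain x where "\<forall>l\<in>{..<n}. \<exists>v. differential_at m f (\<lambda>y. \<phi> y l) x v"
    and ex1: "\<exists>!v. v \<in> mspace (Rn n) \<and> differential_at n \<phi> (\<lambda>_. 0) x v" by auto
  then obtain b where b: "\<And>l. l < n \<Longrightarrow> flat_at x (\<lambda>y. \<phi> y l - inner_Rn m (b l) (f y))"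
    unfolding differential_at_iff_flat by (metis lessThan_iff)
  from homogeneous_system_nontrivial[OF \<open>m < n\<close>, of b] obtain v where
    v: "\<exists>i<n. v i \<noteq> 0" "\<forall>i\<ge>n. v i = 0" "\<forall>j<m. (\<Sum>i<n. v i * b i j) = 0"
    by auto
  have "(\<Sum>l<n. v l * inner_Rn m (b l) w) = (\<Sum>j<m. (\<Sum>l<n. v l * b l j) * w j)" for w
    unfolding inner_Rn_def sum_distrib_left sum_distrib_right
    by (subst sum.swap) (simp add: mult.assoc)
  then have kernel: "(\<Sum>l<n. v l * inner_Rn m (b l) w) = 0" for w using v(3) by simp
  have "flat_at x (\<lambda>y. \<Sum>l<n. - v l * (\<phi> y l - inner_Rn m (b l) (f y)))"
    by (intro flat_at_sum flat_at_cmult b) simp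
  also have "(\<lambda>y. \<Sum>l<n. - v l * (\<phi> y l - inner_Rn m (b l) (f y))) = (\<lambda>y. 0 - inner_Rn n v (\<phi> y))"
    using kernel by (simp add: inner_Rn_def[of n] right_diff_distrib sum_subtractf sum_negf)
  finally have "differential_at n \<phi> (\<lambda>_. 0) x v" by (simp only: differential_at_iff_flat)
  moreover have "differential_at n \<phi> (\<lambda>_. 0) x (\<lambda>_. 0)"
    by (simp add: differential_at_iff_flat inner_Rn_def flat_at_const)
  ultimately have "v = (\<lambda>_. 0)" using ex1 v(2) by (auto simp: mspace_Rn)
  with v(1) show False by auto
qed

theorem theorem7p6:
  fixes M :: "'a::complete_space measure"
  assumes "lipschitz_differentiability_space M"
  shows "analytic_dim M \<le> lipschitz_dim (euclidean_metric :: 'a metric)"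
proof -
  have M: "sets M = sets borel" "finite_measure M"
    using assms by (auto simp: lipschitz_differentiability_space_def metric_measure_space_def)
  show ?thesis
    unfolding analytic_dim_def lipschitz_dim_def
    using chart_dim_le_light_dim[OF M] by (intro Sup_least Inf_greatest) auto
qed

end
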